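(* Let $n$ and $\alpha$ be integers with $\lceil n/2\rceil\le \alpha\le n-1$, and let $T^*$ be a minimizer graph of $\mathbb{G}_{n,\alpha}$ (it is a tree). Let $T^*_-=T^*-L(T^* )$ be its main tree, with vertex classes $V_1^*$ (odd vertices) and $V_2^*$ (even vertices). Then $T^*_-$ is (isomorphic to) a member of $\mathcal{T}^*_-(n,\alpha)$, its bipartition is $(V_1^*,V_2^* )$, and $$T^*=T^*_-\circ (l(u))_{u\in V_2^*},\qquad \sum_{u\in V_2^*} l(u)=|L(T^* )|=2\alpha-n+1,$$ where $l(u)$ is the number of vertices of $L(T^* )$ adjacent to $u$.
   Context: Graphs are finite and simple; $d(v)$ is the degree, $\rho(G)$ the spectral radius (largest adjacency eigenvalue), $\alpha(G)$ the independence number. $\mathbb{G}_{n,\alpha}$ is the set of connected graphs on $n$ vertices with independence number $\alpha$; a minimizer graph of $\mathbb{G}_{n,\alpha}$ is a graph in $\mathbb{G}_{n,\alpha}$ of minimum spectral radius among all graphs of $\mathbb{G}_{n,\alpha}$. $P_m$ is the path on $m$ vertices. For a tree $T$: if $T$ is not a path with an even number of vertices, $L(T)$ is its set of leaves; if $T=P_{2t}=v_1\cdots v_{2t}$ then $L(T)=\{v_1\}$. $D_m$ ($m$ even) is the tree obtained from a path $w_1w_2\cdots w_{m-2}$ by attaching two new pendant vertices to $w_1$. For a tree $T$ not isomorphic to a path or to $D_m$, a vertex $v$ is a control vertex if $d(v)\ge 3$ and at least $d(v)-1$ of the components of $T-v$ are paths. For $P_{2t+1}=v_1\cdots v_{2t+1}$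 the control vertices are $v_2,v_{2t}$; for $P_{2t}=v_1\cdots v_{2t}$ they are $v_2,v_{2t}$; for $D_m$ they are $w_1$ and $w_{m-3}$. A control path is a path whose two end vertices are control vertices (if $T$ has only one control vertex, its control path is the one-vertex path on it). For a minimizer tree $T^*$ of $\mathbb{G}_{n,\alpha}$ with $\alpha\ge\lceil n/2\rceil$, every vertex $x\notin L(T^* )$ lies on some control path $v_0v_1\cdots v_q$; $x$ is odd if $x=v_i$ with $i$ odd and even if $i$ is even (this parity does not depend on the control path chosen). $V_1^*$, $V_2^*$ are the sets of odd and even vertices, and $T^*_-=T^*-L(T^* )$ is the main tree. For a graph $G$, a set $U\subseteq V(G)$ and nonnegative integers $l(u)$ ($u\in U$), $G\circ(l(u))_{u\in U}$ is the graph obtained from $G$ by attaching $l(u)$ new pendant vertices to each $u\in U$. $\mathcal{T}^*_-(n,\alpha)$ is the set of trees $T$ obtained as follows: take a path $v_0v_1\cdots v_d$ with $d$ even; for $s=1,\dots,h$ add a set $M_s$ of $t_s\ge 1$ new pairwise disjoint edges $x_{s1}y_{s1},\dots,x_{st_s}y_{st_s}$; join each $x_{1j}$ to some vertex $v_i$ with $i$ even and $i\notin\{0,d\}$, and for $s\ge 2$ join each $x_{sj}$ to some vertex $y_{s-1,j'}$; here $d$ is the diameter of the resulting tree and the parameters satisfy: $d=2(n-\alpha)-2$ if $\alpha\in\{n-2,n-1\}$, $4\le d\le 2(n-\alpha)-2$ if $\lceil n/2\rceil\le\alpha\le n-3$; $h\le\min\{n-\alpha-1-d/2,\lfloor d/4\rfloor\}$;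 and $\sum_{s=1}^h t_s=n-\alpha-1-d/2$. *)

theory Defs
  imports
    "Graph_Theory.Digraph_Component"
    "Graph_Theory.Vertex_Walk"
    "Jordan_Normal_Form.Char_Poly"
begin

text \<open>
  A finite simple graph is a \<^locale>\<open>pair_graph\<close>: every edge $uv$ is represented by the two
  arcs \<open>(u, v)\<close> and \<open>(v, u)\<close>.
\<close>

definition ugraph :: "'a set \<Rightarrow> ('a \<times> 'a) set \<Rightarrow> 'a pair_pre_digraph" where
  "ugraph V E = \<lparr> pverts = V, parcs = E \<union> E\<inverse> \<rparr>"

definition induce :: "'a pair_pre_digraph \<Rightarrow> 'a set \<Rightarrow> 'a pair_pre_digraph" where
  "induce G S = \<lparr> pverts = pverts G \<inter> S, parcs = parcs G \<inter> (S \<times> S) \<rparr>"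

definition delete_verts :: "'a pair_pre_digraph \<Rightarrow> 'a set \<Rightarrow> 'a pair_pre_digraph" where
  "delete_verts G S = induce G (pverts G - S)"

abbreviation vertex_degree :: "'a pair_pre_digraph \<Rightarrow> 'a \<Rightarrow> nat" where
  "vertex_degree G v \<equiv> out_degree (with_proj G) v"

definition graph_isomorphism ::
    "('a \<Rightarrow> 'b) \<Rightarrow> 'a pair_pre_digraph \<Rightarrow> 'b pair_pre_digraph \<Rightarrow> bool" where
  "graph_isomorphism f G H \<longleftrightarrow>
     bij_betw f (pverts G) (pverts H) \<and>
     (\<forall>u\<in>pverts G. \<forall>v\<in>pverts G. (u, v) \<in> parcs G \<longleftrightarrow> (f u, f v) \<in> parcs H)"

definition bipartition :: "'a pair_pre_digraph \<Rightarrow> 'a set \<Rightarrow> 'a set \<Rightarrow> bool" where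
  "bipartition G A B \<longleftrightarrow>
     A \<union> B = pverts G \<and> A \<inter> B = {} \<and> parcs G \<subseteq> A \<times> B \<union> B \<times> A"

text \<open>
  The library predicate \<^const>\<open>Digraph_Component.tree\<close> is not usable here, since traversing one
  edge back and forth is a \<^const>\<open>pre_digraph.cycle\<close> with two arcs.
\<close>

definition is_tree :: "'a pair_pre_digraph \<Rightarrow> bool" where
  "is_tree G \<longleftrightarrow>
     pair_graph G \<and> Digraph_Component.connected (with_proj G) \<and>
     \<not> (\<exists>p. pre_digraph.cycle (with_proj G) p \<and> length p \<ge> 3)"

definition graph_dist :: "'a pair_pre_digraph \<Rightarrow> 'a \<Rightarrow> 'a \<Rightarrow> nat" where
  "graph_dist G u v =
     (LEAST k. \<exists>p. vwalk p (with_proj G) \<and> hd p = u \<and> last p = v \<and> vwalk_length p = k)"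

definition graph_diameter :: "'a pair_pre_digraph \<Rightarrow> nat" where
  "graph_diameter G = Max {graph_dist G u v | u v. u \<in> pverts G \<and> v \<in> pverts G}"


definition independent_set :: "'a pair_pre_digraph \<Rightarrow> 'a set \<Rightarrow> bool" where
  "independent_set G S \<longleftrightarrow> S \<subseteq> pverts G \<and> (\<forall>u\<in>S. \<forall>v\<in>S. (u, v) \<notin> parcs G)"

definition independence_number :: "'a pair_pre_digraph \<Rightarrow> nat" where
  "independence_number G = Max (card ` {S. independent_set G S})"

definition adjacency_matrix :: "'a pair_pre_digraph \<Rightarrow> 'a list \<Rightarrow> real mat" where
  "adjacency_matrix G vs =
     mat (length vs) (length vs) (\<lambda>(i, j). if (vs ! i, vs ! j) \<in> parcs G then 1 else 0)"

text \<open>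
  The eigenvalues do not depend on the enumeration \<open>vs\<close> of the vertices, and they are all real
  because the matrix is symmetric.
\<close>

definition adjacency_eigenvalue :: "'a pair_pre_digraph \<Rightarrow> real \<Rightarrow> bool" where
  "adjacency_eigenvalue G k \<longleftrightarrow>
     (\<exists>vs. distinct vs \<and> set vs = pverts G \<and> eigenvalue (adjacency_matrix G vs) k)"

definition adj_spectral_radius :: "'a pair_pre_digraph \<Rightarrow> real" where
  "adj_spectral_radius G = Max {k. adjacency_eigenvalue G k}"

definition graphs_with :: "nat \<Rightarrow> nat \<Rightarrow> 'a pair_pre_digraph set" where
  "graphs_with n \<alpha> =
     {G. pair_graph G \<and> Digraph_Component.connected (with_proj G) \<and>
         card (pverts G) = n \<and> independence_number G = \<alpha>}"

text \<open>
  The competitors have the same vertex type as \<open>T\<close>.  This is no restriction: since \<open>T\<close> has \<open>n\<close>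
  vertices, that type contains a copy of every graph on \<open>n\<close> vertices.
\<close>

definition minimizer_graph :: "nat \<Rightarrow> nat \<Rightarrow> 'a pair_pre_digraph \<Rightarrow> bool" where
  "minimizer_graph n \<alpha> T \<longleftrightarrow> is_arg_min adj_spectral_radius (\<lambda>G. G \<in> graphs_with n \<alpha>) T"


text \<open>\<open>G\<close> is the path $v_1 \cdots v_m$, where \<open>vs = [v\<^sub>1, \<dots>, v\<^sub>m]\<close>.\<close>

definition is_path_graph :: "'a pair_pre_digraph \<Rightarrow> 'a list \<Rightarrow> bool" where
  "is_path_graph G vs \<longleftrightarrow>
     vs \<noteq> [] \<and> distinct vs \<and> G = ugraph (set vs) (set (vwalk_arcs vs))"

text \<open>
  \<open>G\<close> is the tree $D_m$ (with $m$ even), where \<open>ws = [w\<^sub>1, \<dots>, w\<^sub>m\<^sub>-\<^sub>2]\<close> and \<open>a\<close>, \<open>b\<close> are the two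
  pendant vertices attached to $w_1$.
\<close>

definition is_D_graph :: "'a pair_pre_digraph \<Rightarrow> 'a list \<Rightarrow> 'a \<Rightarrow> 'a \<Rightarrow> bool" where
  "is_D_graph G ws a b \<longleftrightarrow>
     ws \<noteq> [] \<and> even (length ws) \<and> distinct (a # b # ws) \<and>
     G = ugraph (set (a # b # ws)) (set (vwalk_arcs ws) \<union> {(hd ws, a), (hd ws, b)})"

definition leaves :: "'a pair_pre_digraph \<Rightarrow> 'a set" where
  "leaves G = {v \<in> pverts G. vertex_degree G v = 1}"

definition path_components :: "'a pair_pre_digraph \<Rightarrow> 'a set set" where
  "path_components G =
     {S \<in> pre_digraph.sccs_verts (with_proj G). \<exists>vs. is_path_graph (induce G S) vs}"

definition branch_control :: "'a pair_pre_digraph \<Rightarrow> 'a \<Rightarrow> bool" where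
  "branch_control T v \<longleftrightarrow>
     v \<in> pverts T \<and> vertex_degree T v \<ge> 3 \<and>
     card (path_components (delete_verts T {v})) \<ge> vertex_degree T v - 1"

text \<open>
  \<open>tree_marking T L C\<close>: the set \<open>L\<close> is $L(T)$ and \<open>C\<close> is the set of control vertices of \<open>T\<close>.
  This is a relation and not a pair of functions because for $P_{2t} = v_1 \cdots v_{2t}$ both
  sets depend on which end is named $v_1$ (and the same choice has to be made in both of them).
  Lists are indexed from 0, so $v_i$ is \<open>vs ! (i - 1)\<close>, and $w_{m-3}$ is \<open>ws ! (length ws - 2)\<close>.
\<close>

inductive tree_marking :: "'a pair_pre_digraph \<Rightarrow> 'a set \<Rightarrow> 'a set \<Rightarrow> bool"
  for T :: "'a pair_pre_digraph"
where
  odd_path: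
    "\<lbrakk>is_path_graph T vs; odd (length vs); length vs \<ge> 2\<rbrakk>
     \<Longrightarrow> tree_marking T (leaves T) {vs ! 1, vs ! (length vs - 2)}"
| even_path:
    "\<lbrakk>is_path_graph T vs; even (length vs)\<rbrakk>
     \<Longrightarrow> tree_marking T {vs ! 0} {vs ! 1, vs ! (length vs - 1)}"
| D_graph:
    "is_D_graph T ws a b
     \<Longrightarrow> tree_marking T (leaves T) {ws ! 0, ws ! (length ws - 2)}"
| other_tree:
    "\<lbrakk>is_tree T; \<nexists>vs. is_path_graph T vs; \<nexists>ws a b. is_D_graph T ws a b\<rbrakk>
     \<Longrightarrow> tree_marking T (leaves T) {v. branch_control T v}"

lemma tree_marking_exists:
  assumes "is_tree T" and "card (pverts T) \<ge> 2"
  shows "\<exists>L C. tree_marking T L C"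
proof (cases "\<exists>vs. is_path_graph T vs")
  case True
  then obtain vs where vs: "is_path_graph T vs" by blast
  then have "pverts T = set vs"
    by (auto simp: is_path_graph_def ugraph_def)
  with assms(2) have "length vs \<ge> 2"
    using card_length[of vs] by simp
  with vs show ?thesis
    by (cases "even (length vs)") (blast intro: odd_path even_path)+
next
  case False
  with assms(1) show ?thesis
    by (blast intro: D_graph other_tree)
qed

definition control_path ::
    "'a pair_pre_digraph \<Rightarrow> 'a set \<Rightarrow> 'a list \<Rightarrow> bool" where
  "control_path T C p \<longleftrightarrow>
     vpath p (with_proj T) \<and> hd p \<in> C \<and> last p \<in> C \<and> (hd p \<noteq> last p \<or> C = {hd p})"

definition odd_verts :: "'a pair_pre_digraph \<Rightarrow> 'a set \<Rightarrow> 'a set \<Rightarrow> 'a set" where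
  "odd_verts T L C =
     {x \<in> pverts T - L. \<exists>p i. control_path T C p \<and> i < length p \<and> p ! i = x \<and> odd i}"

definition even_verts :: "'a pair_pre_digraph \<Rightarrow> 'a set \<Rightarrow> 'a set \<Rightarrow> 'a set" where
  "even_verts T L C =
     {x \<in> pverts T - L. \<exists>p i. control_path T C p \<and> i < length p \<and> p ! i = x \<and> even i}"

definition main_tree :: "'a pair_pre_digraph \<Rightarrow> 'a set \<Rightarrow> 'a pair_pre_digraph" where
  "main_tree T L = delete_verts T L"

definition pendant_count :: "'a pair_pre_digraph \<Rightarrow> 'a set \<Rightarrow> 'a \<Rightarrow> nat" where
  "pendant_count T L u = card {w \<in> L. (u, w) \<in> parcs T}"

text \<open>
  $G \circ (l(u))_{u \in U}$: the vertices of \<open>G\<close> are tagged with \<^const>\<open>Inl\<close>, and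
  \<open>Inr (u, 0), \<dots>, Inr (u, l u - 1)\<close> are the new pendant vertices at \<open>u\<close>.
\<close>

definition attach_pendants ::
    "'a pair_pre_digraph \<Rightarrow> 'a set \<Rightarrow> ('a \<Rightarrow> nat) \<Rightarrow> ('a + 'a \<times> nat) pair_pre_digraph" where
  "attach_pendants G U l =
     ugraph (Inl ` pverts G \<union> {Inr (u, i) | u i. u \<in> U \<and> i < l u})
            ({(Inl u, Inl v) | u v. (u, v) \<in> parcs G} \<union>
             {(Inl u, Inr (u, i)) | u i. u \<in> U \<and> i < l u})"

text \<open>
  The class $\mathcal{T}^*_-(n,\alpha)$, closed under isomorphism: the vertices of the tree are
  named by \<open>v i\<close> for $v_i$, \<open>x s j\<close> for $x_{sj}$ and \<open>y s j\<close> for $y_{sj}$.  The vertex $x_{1j}$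
  is joined to $v_{p(1,j)}$, and $x_{sj}$ with $s \ge 2$ is joined to $y_{s-1,p(s,j)}$.
  The parameter conditions are stated over the integers; the division by 2 is exact.
\<close>

definition main_trees :: "nat \<Rightarrow> nat \<Rightarrow> 'a pair_pre_digraph set" where
  "main_trees n \<alpha> =
     {T. \<exists>(d::nat) (h::nat) (t::nat \<Rightarrow> nat) (v::nat \<Rightarrow> 'a)
          (x::nat \<Rightarrow> nat \<Rightarrow> 'a) (y::nat \<Rightarrow> nat \<Rightarrow> 'a) (p::nat \<Rightarrow> nat \<Rightarrow> nat) I.
        I = (SIGMA s:{1..h}. {1..t s}) \<and>
        even d \<and>
        (\<forall>s\<in>{1..h}. t s \<ge> 1) \<and>
        inj_on v {0..d} \<and> inj_on (case_prod x) I \<and> inj_on (case_prod y) I \<and>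
        v ` {0..d} \<inter> case_prod x ` I = {} \<and>
        v ` {0..d} \<inter> case_prod y ` I = {} \<and>
        case_prod x ` I \<inter> case_prod y ` I = {} \<and>
        (\<forall>j. (1, j) \<in> I \<longrightarrow> p 1 j \<in> {0..d} - {0, d} \<and> even (p 1 j)) \<and>
        (\<forall>s j. (s, j) \<in> I \<and> s \<ge> 2 \<longrightarrow> p s j \<in> {1..t (s - 1)}) \<and>
        T = ugraph (v ` {0..d} \<union> case_prod x ` I \<union> case_prod y ` I)
              ({(v i, v (Suc i)) | i. i < d} \<union>
               {(x s j, y s j) | s j. (s, j) \<in> I} \<union>
               {(x 1 j, v (p 1 j)) | j. (1, j) \<in> I} \<union>
               {(x s j, y (s - 1) (p s j)) | s j. (s, j) \<in> I \<and> s \<ge> 2}) \<and>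
        graph_diameter T = d \<and>
        (int \<alpha> \<in> {int n - 2, int n - 1} \<longrightarrow> int d = 2 * (int n - int \<alpha>) - 2) \<and>
        (\<lceil>real n / 2\<rceil> \<le> int \<alpha> \<and> int \<alpha> \<le> int n - 3 \<longrightarrow>
           4 \<le> int d \<and> int d \<le> 2 * (int n - int \<alpha>) - 2) \<and>
        int h \<le> min (int n - int \<alpha> - 1 - int d div 2) \<lfloor>real d / 4\<rfloor> \<and>
        (\<Sum>s = 1..h. int (t s)) = int n - int \<alpha> - 1 - int d div 2}"

end

theory Submission
  imports Defs "HOL-Analysis.Function_Topology"
begin

text \<open>
  Upper bounds for spectral radii come from strict supersolutions: if \<open>A z \<le> r z\<close> for a positive
  vector \<open>z\<close>, strictly somewhere, then a connected graph with adjacency matrix \<open>A\<close> has spectral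
  radius below \<open>r\<close>.  Taking \<open>r\<close> and the Perron vector of a minimizer, each of several local
  rewirings (removing an edge on a cycle, moving a branch to a neighbour, subdividing an edge between two
  branch vertices once or twice, splitting a vertex) admits such a \<open>z\<close>, hence cannot
  produce an admissible competitor.  Consequently a minimizer is a tree in which, for a suitable
  maximum independent set \<open>S\<close>, the complement \<open>K\<close> of \<open>S\<close> is independent and all vertices of \<open>S\<close>
  have degree at most 2; so it is a subdivided tree on \<open>K\<close> with pendant vertices attached.
  Up to the cases of paths and \<open>D\<^sub>m\<close>, every leaf of that subdivided tree carries at least two
  pendant vertices, i.e. is a control vertex, and so every vertex lies on a control path.
  The parameters of \<open>main_trees n \<alpha>\<close> are read off by rooting the main tree at an end of a diametral path.
\<close>

section \<open>Spectral radius and Perron vectors\<close>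

text \<open>Competitors live on the vertex set of the minimizer, so a vertex inserted somewhere must
  be taken from elsewhere: a pendant vertex, or a pendant path on two vertices, is detached and
  reused, while some \<alpha> vertices have to stay independent. The old neighbour of the detached
  piece loses a summand, and this is where strictness of the supersolution comes from in every
  rewiring that keeps the number of edges. With K the class outside a maximum independent class, the
  sum of deg k - 2 over k in K equals 2\<alpha> - n - 1. This excess is -1 for paths of even order,
  0 for paths of odd order and 1 for D_n. Excess at least 2 supplies either a vertex of degree 4,
  which can be split, or two vertices of degree 3, between which an edge can be subdivided twice;
  this is what forces every pendant vertex to hang at a vertex of degree at least 3. Excess 1
  supplies neither, and is settled by comparison with D_n itself, whose spectral radius is below
  2.\<close>

definition simple_graph :: "'a set \<Rightarrow> ('a \<times> 'a) set \<Rightarrow> bool" where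
  "simple_graph V E \<longleftrightarrow> finite V \<and> E \<subseteq> V \<times> V \<and> sym E \<and> irrefl E"

definition conn :: "'a set \<Rightarrow> ('a \<times> 'a) set \<Rightarrow> bool" where
  "conn V E \<longleftrightarrow> (\<forall>u\<in>V. \<forall>v\<in>V. (u, v) \<in> E\<^sup>*)"

abbreviation nsum :: "('a \<times> 'a) set \<Rightarrow> ('a \<Rightarrow> real) \<Rightarrow> 'a \<Rightarrow> real" where
  "nsum E x v \<equiv> (\<Sum>w\<in>E `` {v}. x w)"

abbreviation mk_graph :: "'a set \<Rightarrow> ('a \<times> 'a) set \<Rightarrow> 'a pair_pre_digraph" where
  "mk_graph V E \<equiv> \<lparr>pverts = V, parcs = E\<rparr>"

abbreviation deg :: "('a \<times> 'a) set \<Rightarrow> 'a \<Rightarrow> nat" where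
  "deg E v \<equiv> card (E `` {v})"

lemma nsum_as_indicator_sum:
  assumes "finite V" "E \<subseteq> V \<times> V"
  shows "nsum E x v = (\<Sum>w\<in>V. of_bool ((v, w) \<in> E) * x w)"
proof -
  have "E `` {v} = {w \<in> V. (v, w) \<in> E}" using assms by auto
  then have "nsum E x v = (\<Sum>w\<in>{w \<in> V. (v, w) \<in> E}. x w)" by simp
  also have "\<dots> = (\<Sum>w\<in>V. if (v, w) \<in> E then x w else 0)"
    using assms(1) by (simp add: sum.inter_filter)
  also have "\<dots> = (\<Sum>w\<in>V. of_bool ((v, w) \<in> E) * x w)"
    by (rule sum.cong) auto
  finally show ?thesis .
qed

text \<open>Passing from coordinate vectors to functions on vertices removes the enumeration
  \<open>vs\<close> from the right-hand side; matrices do not occur after the next two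
  lemmas.\<close>

lemma eigenvalue_adjacency_matrix_iff:
  assumes vs: "distinct vs" "set vs = V" and E: "E \<subseteq> V \<times> V"
  shows "eigenvalue (adjacency_matrix (mk_graph V E) vs) k \<longleftrightarrow>
    (\<exists>x. (\<exists>v\<in>V. x v \<noteq> 0) \<and> (\<forall>v\<in>V. nsum E x v = k * x v))"
proof -
  let ?n = "length vs" and ?A = "adjacency_matrix (mk_graph V E) vs"
  have fin: "finite V" using vs(2) by auto
  have bij: "bij_betw ((!) vs) {0..<?n} V"
    using bij_betw_nth[OF vs(1) refl] vs(2) by (simp add: atLeast0LessThan)
  have row: "(?A *\<^sub>v vec ?n (\<lambda>j. x (vs ! j))) $ i = nsum E x (vs ! i)" if "i < ?n" for x i
  proof -
    have "(?A *\<^sub>v vec ?n (\<lambda>j. x (vs ! j))) $ i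
        = (\<Sum>j = 0..<?n. of_bool ((vs ! i, vs ! j) \<in> E) * x (vs ! j))"
      using that by (simp add: adjacency_matrix_def scalar_prod_def of_bool_def)
    also have "\<dots> = (\<Sum>w\<in>V. of_bool ((vs ! i, w) \<in> E) * x w)"
      by (rule sum.reindex_bij_betw[OF bij])
    finally show ?thesis using nsum_as_indicator_sum[OF fin E] by simp
  qed
  have ev: "eigenvector ?A (vec ?n (\<lambda>j. x (vs ! j))) k \<longleftrightarrow>
      (\<exists>v\<in>V. x v \<noteq> 0) \<and> (\<forall>v\<in>V. nsum E x v = k * x v)" for x
  proof -
    have dim: "dim_row ?A = ?n" by (simp add: adjacency_matrix_def)
    have 1: "vec ?n (\<lambda>j. x (vs ! j)) \<noteq> 0\<^sub>v ?n \<longleftrightarrow> (\<exists>v\<in>V. x v \<noteq> 0)"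
    proof -
      have "vec ?n (\<lambda>j. x (vs ! j)) = 0\<^sub>v ?n \<longleftrightarrow> (\<forall>i<?n. x (vs ! i) = 0)"
        by (auto simp: vec_eq_iff)
      then show ?thesis unfolding vs(2)[symmetric] by (metis in_set_conv_nth nth_mem)
    qed
    have 2: "?A *\<^sub>v vec ?n (\<lambda>j. x (vs ! j)) = k \<cdot>\<^sub>v vec ?n (\<lambda>j. x (vs ! j)) \<longleftrightarrow>
       (\<forall>v\<in>V. nsum E x v = k * x v)"
    proof -
      have "?A *\<^sub>v vec ?n (\<lambda>j. x (vs ! j)) = k \<cdot>\<^sub>v vec ?n (\<lambda>j. x (vs ! j)) \<longleftrightarrow>
        (\<forall>i<?n. nsum E x (vs ! i) = k * x (vs ! i))"
        using row[of _ x] by (auto simp: vec_eq_iff dim simp del: index_mult_mat_vec)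
      then show ?thesis unfolding vs(2)[symmetric] by (simp add: all_set_conv_all_nth)
    qed
    show ?thesis unfolding eigenvector_def dim using 1 2 by simp
  qed
  show ?thesis
  proof
    assume "eigenvalue ?A k"
    then obtain y where y: "eigenvector ?A y k" by (auto simp: eigenvalue_def)
    define x where "x = (\<lambda>u. y $ (inv_into {0..<?n} ((!) vs) u))"
    have "dim_vec y = ?n"
      using y by (auto simp: eigenvector_def adjacency_matrix_def)
    then have "y = vec ?n (\<lambda>j. x (vs ! j))"
      using bij by (auto simp: vec_eq_iff x_def bij_betw_inv_into_left)
    then show "\<exists>x. (\<exists>v\<in>V. x v \<noteq> 0) \<and> (\<forall>v\<in>V. nsum E x v = k * x v)"
      using y ev[of x] by auto
  qed (auto simp: eigenvalue_def ev[symmetric])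
qed

lemma adjacency_eigenvalue_iff:
  assumes "finite V" "E \<subseteq> V \<times> V"
  shows "adjacency_eigenvalue (mk_graph V E) k \<longleftrightarrow>
    (\<exists>x. (\<exists>v\<in>V. x v \<noteq> 0) \<and> (\<forall>v\<in>V. nsum E x v = k * x v))"
proof -
  obtain vs where "distinct vs" "set vs = V"
    using finite_distinct_list[OF assms(1)] by blast
  moreover have "eigenvalue (adjacency_matrix (mk_graph V E) us) k \<longleftrightarrow>
      eigenvalue (adjacency_matrix (mk_graph V E) vs) k" if "distinct us" "set us = V" for us
    using eigenvalue_adjacency_matrix_iff[OF that assms(2)]
      eigenvalue_adjacency_matrix_iff[OF calculation assms(2)] by simp
  ultimately have "adjacency_eigenvalue (mk_graph V E) k \<longleftrightarrow>
      eigenvalue (adjacency_matrix (mk_graph V E) vs) k"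
    unfolding adjacency_eigenvalue_def pair_pre_digraph.select_convs by blast
  then show ?thesis
    using eigenvalue_adjacency_matrix_iff[OF \<open>distinct vs\<close> \<open>set vs = V\<close> assms(2)] by simp
qed

text \<open>Needed because \<open>adj_spectral_radius\<close> is a \<open>Max\<close>, which is only
  meaningful for a finite set: the eigenvalues are roots of the characteristic polynomial.\<close>

lemma finite_adjacency_eigenvalues:
  assumes "finite V" "E \<subseteq> V \<times> V"
  shows "finite {k. adjacency_eigenvalue (mk_graph V E) k}"
proof -
  obtain vs where vs: "distinct vs" "set vs = V"
    using finite_distinct_list[OF assms(1)] by blast
  let ?A = "adjacency_matrix (mk_graph V E) vs"
  have A: "?A \<in> carrier_mat (length vs) (length vs)" by (simp add: adjacency_matrix_def)
  have "{k. adjacency_eigenvalue (mk_graph V E) k} = {k. poly (char_poly ?A) k = 0}"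
    using eigenvalue_root_char_poly[OF A] eigenvalue_adjacency_matrix_iff[OF vs assms(2)]
      adjacency_eigenvalue_iff[OF assms] by simp
  moreover have "char_poly ?A \<noteq> 0"
    using degree_monic_char_poly[OF A] by auto
  ultimately show ?thesis by (simp add: poly_roots_finite)
qed

text \<open>The first-order condition at an extremum, without derivatives. For t = - c / L with L >
  0 and L at least l, the linear term - 2 * c^2 / L outweighs the quadratic one, which is at most
  c^2 / L.\<close>

lemma linear_coefficient_zero:
  fixes c l :: real
  assumes "\<And>t. 2 * t * c + t\<^sup>2 * l \<ge> 0"
  shows "c = 0"
proof (rule ccontr)
  assume c: "c \<noteq> 0"
  define L where "L = \<bar>l\<bar> + 1"
  have L: "L > 0" "l \<le> L" by (auto simp: L_def)
  have "2 * (- c / L) * c + (- c / L)\<^sup>2 * l = (c\<^sup>2 / L) * (l / L - 2)"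
    using L by (simp add: field_simps power2_eq_square)
  moreover have "l / L - 2 < 0" using L by (simp add: field_simps)
  moreover have "c\<^sup>2 / L > 0" using c L by simp
  ultimately show False using assms[of "- c / L"] mult_pos_neg[of "c\<^sup>2 / L" "l / L - 2"] by linarith
qed

text \<open>The quadratic form of the adjacency matrix attains its maximum on the nonnegative part
  of the unit sphere. Replacing entries by absolute values does not decrease the form, so this is
  the maximum over the whole sphere and the maximizer is an eigenvector.\<close>

lemma perron_vector_nonneg:
  assumes G: "simple_graph V E" and ne: "V \<noteq> {}"
  shows "\<exists>x r. (\<forall>v\<in>V. x v \<ge> 0) \<and> (\<exists>v\<in>V. x v > 0) \<and> (\<forall>v\<in>V. nsum E x v = r * x v)"
proof -
  have fin: "finite V" and E: "E \<subseteq> V \<times> V" and sym: "sym E" and irr: "irrefl E"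
    using G by (auto simp: simple_graph_def)
  define M :: "'a \<Rightarrow> 'a \<Rightarrow> real" where "M = (\<lambda>a b. of_bool ((a, b) \<in> E))"
  have Msym: "M a b = M b a" for a b using sym by (auto simp: M_def sym_def)
  have Mirr: "M a a = 0" for a using irr by (auto simp: M_def irrefl_def)
  have nsum: "nsum E x v = (\<Sum>b\<in>V. M v b * x b)" for x v
    using nsum_as_indicator_sum[OF fin E] by (simp add: M_def)
  define q where "q = (\<lambda>x. \<Sum>a\<in>V. \<Sum>b\<in>V. M a b * x a * x b)"
  \<comment> \<open>Coordinates outside \<open>V\<close> are pinned to 0 and the others confined to
    [0, 1], so that \<open>X\<close> is a closed subset of a product of compact sets, compact by
    Tychonoff.\<close>
  define X where "X = {x \<in> PiE UNIV (\<lambda>i. if i \<in> V then {0..1} else {0::real}). (\<Sum>v\<in>V. (x v)\<^sup>2) = 1}"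
  have cont: "continuous_on S (\<lambda>x::'a \<Rightarrow> real. x v)" for S v
    by (rule continuous_on_product_coordinates[THEN continuous_on_subset]) auto
  have compP: "compact (PiE UNIV (\<lambda>i. if i \<in> V then {0..1} else {0::real}))"
  proof -
    have "compactin (product_topology (\<lambda>i. euclidean) UNIV)
       (PiE UNIV (\<lambda>i. if i \<in> V then {0..1} else {0::real}))"
      by (subst compactin_PiE) auto
    then show ?thesis by (simp add: euclidean_product_topology)
  qed
  have "closed {x::'a \<Rightarrow> real. (\<Sum>v\<in>V. (x v)\<^sup>2) = 1}"
    by (intro closed_Collect_eq continuous_intros cont)
  then have "compact X"
    unfolding X_def using compact_Int_closed[OF compP] by (simp add: Collect_conj_eq)
  moreover have "X \<noteq> {}"
  proof -
    obtain v where v: "v \<in> V" using ne by blast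
    have "(\<Sum>w\<in>V. (of_bool (w = v) :: real)\<^sup>2) = (\<Sum>w\<in>V. if w = v then 1 else 0)"
      by (intro sum.cong) auto
    also have "\<dots> = 1" using fin v by simp
    finally have "(\<lambda>w. of_bool (w = v)) \<in> X" unfolding X_def using v by auto
    then show ?thesis by blast
  qed
  moreover have "continuous_on X q"
    unfolding q_def by (intro continuous_intros cont)
  ultimately obtain x where x: "x \<in> X" and max: "\<And>y. y \<in> X \<Longrightarrow> q y \<le> q x"
    using continuous_attains_sup by metis
  define l where "l = q x"
  have x0: "x v \<ge> 0" for v using x by (auto simp: X_def PiE_iff split: if_splits dest!: spec[of _ v])
  have x1: "(\<Sum>v\<in>V. (x v)\<^sup>2) = 1" using x by (simp add: X_def)
  \<comment> \<open>By homogeneity the maximum over \<open>X\<close> bounds the form at every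
    vector: normalize and take absolute values.\<close>
  have upper: "q y \<le> l * (\<Sum>v\<in>V. (y v)\<^sup>2)" for y
  proof (cases "(\<Sum>v\<in>V. (y v)\<^sup>2) = 0")
    case True
    then have "\<forall>v\<in>V. y v = 0" using fin by (simp add: sum_nonneg_eq_0_iff)
    then have "q y = 0" unfolding q_def by simp
    then show ?thesis using True by simp
  next
    case False
    define s where "s = sqrt (\<Sum>v\<in>V. (y v)\<^sup>2)"
    have nn: "(\<Sum>v\<in>V. (y v)\<^sup>2) \<ge> 0" by (simp add: sum_nonneg)
    then have s: "s > 0" "s\<^sup>2 = (\<Sum>v\<in>V. (y v)\<^sup>2)" using False by (auto simp: s_def)
    define z where "z = (\<lambda>v. if v \<in> V then \<bar>y v\<bar> / s else 0)"
    have zz: "(\<Sum>v\<in>V. (z v)\<^sup>2) = 1"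
    proof -
      have "(\<Sum>v\<in>V. (z v)\<^sup>2) = (\<Sum>v\<in>V. (y v)\<^sup>2 / s\<^sup>2)"
        by (intro sum.cong) (auto simp: z_def power_divide)
      also have "\<dots> = 1" using s False by (simp add: sum_divide_distrib[symmetric])
      finally show ?thesis .
    qed
    have "z v \<le> 1" if "v \<in> V" for v
    proof -
      have "(z v)\<^sup>2 \<le> (\<Sum>v\<in>V. (z v)\<^sup>2)" by (rule member_le_sum[OF that]) (auto simp: fin)
      then show ?thesis using zz by (simp add: power_le_one_iff abs_square_le_1)
    qed
    then have "z \<in> X" unfolding X_def using zz s by (auto simp: PiE_iff) (auto simp: z_def)
    then have "q z \<le> l" using max l_def by simp
    moreover have "q y \<le> s\<^sup>2 * q z"
    proof -
      have "s\<^sup>2 * q z = (\<Sum>a\<in>V. \<Sum>b\<in>V. s\<^sup>2 * (M a b * z a * z b))"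
        unfolding q_def by (simp add: sum_distrib_left)
      moreover have "q y \<le> (\<Sum>a\<in>V. \<Sum>b\<in>V. s\<^sup>2 * (M a b * z a * z b))"
        unfolding q_def
      proof (intro sum_mono)
        fix a b assume "a \<in> V" "b \<in> V"
        then have "s\<^sup>2 * (M a b * z a * z b) = M a b * \<bar>y a * y b\<bar>"
          using s(1) by (simp add: z_def power2_eq_square abs_mult)
        then show "M a b * y a * y b \<le> s\<^sup>2 * (M a b * z a * z b)"
          by (auto simp: M_def)
      qed
      ultimately show ?thesis by simp
    qed
    moreover have "s\<^sup>2 * q z \<le> s\<^sup>2 * l"
      using calculation(1) by (intro mult_left_mono) auto
    ultimately show ?thesis using s by (simp add: mult.commute)
  qed
  have "nsum E x v = l * x v" if v: "v \<in> V" for v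
  proof -
    \<comment> \<open>Perturbing \<open>x\<close> along the unit vector at \<open>v\<close> turns
      \<open>upper\<close> into a quadratic inequality in t without constant term, whose linear
      coefficient must vanish.\<close>
    define e :: "'a \<Rightarrow> real" where "e = (\<lambda>w. of_bool (w = v))"
    have sume: "(\<Sum>a\<in>V. e a * f a) = f v" for f :: "'a \<Rightarrow> real"
    proof -
      have "(\<Sum>a\<in>V. e a * f a) = (\<Sum>a\<in>V. if a = v then f a else 0)"
        by (intro sum.cong) (auto simp: e_def)
      then show ?thesis using fin v by simp
    qed
    have "2 * t * (l * x v - nsum E x v) + t\<^sup>2 * l \<ge> 0" for t
    proof -
      have "q (\<lambda>w. x w + t * e w) = (\<Sum>a\<in>V. \<Sum>b\<in>V. M a b * x a * x b + t * (e a * (M a b * x b))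
          + t * (e b * (M b a * x a)) + t\<^sup>2 * (e a * (e b * M a b)))"
        unfolding q_def
        by (intro sum.cong refl, subst (3) Msym) (simp add: algebra_simps power2_eq_square Msym)
      also have "\<dots> = q x + t * (\<Sum>a\<in>V. e a * (\<Sum>b\<in>V. M a b * x b))
          + t * (\<Sum>a\<in>V. \<Sum>b\<in>V. e b * (M b a * x a)) + t\<^sup>2 * (\<Sum>a\<in>V. e a * (\<Sum>b\<in>V. e b * M a b))"
        by (simp add: sum.distrib sum_distrib_left q_def algebra_simps)
      also have "\<dots> = q x + 2 * t * nsum E x v"
        by (simp add: sume nsum Mirr)
      finally have 1: "q (\<lambda>w. x w + t * e w) = l + 2 * t * nsum E x v" by (simp add: l_def)
      have "(\<Sum>w\<in>V. (x w + t * e w)\<^sup>2) = (\<Sum>w\<in>V. (x w)\<^sup>2 + 2 * t * (e w * x w) + t\<^sup>2 * (e w * e w))"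
        by (intro sum.cong) (auto simp: power2_eq_square algebra_simps)
      also have "\<dots> = (\<Sum>w\<in>V. (x w)\<^sup>2) + 2 * t * (\<Sum>w\<in>V. e w * x w) + t\<^sup>2 * (\<Sum>w\<in>V. e w * e w)"
        by (simp add: sum.distrib sum_distrib_left)
      also have "\<dots> = 1 + 2 * t * x v + t\<^sup>2"
        by (simp add: sume x1) (simp add: e_def)
      finally have 2: "(\<Sum>w\<in>V. (x w + t * e w)\<^sup>2) = 1 + 2 * t * x v + t\<^sup>2" .
      show ?thesis using upper[of "\<lambda>w. x w + t * e w"] unfolding 1 2 by (simp add: algebra_simps)
    qed
    then show ?thesis using linear_coefficient_zero[of "l * x v - nsum E x v" l] by auto
  qed
  moreover have "\<exists>v\<in>V. x v > 0"
  proof (rule ccontr)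
    assume "\<not> (\<exists>v\<in>V. x v > 0)"
    then have "\<forall>v\<in>V. x v = 0" using x0 by (meson antisym not_le)
    then show False using x1 by simp
  qed
  ultimately show ?thesis using x0 by blast
qed

section \<open>Comparison with positive supersolutions\<close>

lemma conn_induct:
  assumes "conn V E" "u \<in> V" "P u" and "\<And>v w. P v \<Longrightarrow> (v, w) \<in> E \<Longrightarrow> P w" and "w \<in> V"
  shows "P w"
proof -
  have "(u, w) \<in> E\<^sup>*" using assms by (auto simp: conn_def)
  then show ?thesis by (induction rule: rtrancl_induct) (use assms in auto)
qed

text \<open>Scale \<open>z\<close> by the largest ratio \<open>c\<close> of
  \<open>\<bar>y v\<bar>\<close> to \<open>z v\<close>: then \<open>c * z\<close> dominates
  \<open>\<bar>y\<bar>\<close> and touches it at some \<open>m\<close>, and the row of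
  \<open>m\<close> gives the bound. If \<open>k = r\<close>, touching passes from a vertex to all
  its neighbours, hence to all of \<open>V\<close>, and then no row can be strict.\<close>

lemma eigenvalue_le_supersolution:
  assumes G: "simple_graph V E" and z: "\<And>v. v \<in> V \<Longrightarrow> z v > 0"
    and sup: "\<And>v. v \<in> V \<Longrightarrow> nsum E z v \<le> r * z v"
    and y: "\<exists>v\<in>V. y v \<noteq> 0" "\<And>v. v \<in> V \<Longrightarrow> nsum E y v = k * y v"
  shows "k \<le> r"
    and "conn V E \<Longrightarrow> \<exists>v\<in>V. nsum E z v < r * z v \<Longrightarrow> k < r"
proof -
  have fin: "finite V" and E: "E \<subseteq> V \<times> V"
    using G by (auto simp: simple_graph_def)
  have finN: "finite (E `` {v})" for v using fin E by (meson Image_singleton_iff SigmaD2 finite_subset subsetI subsetD)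
  have "V \<noteq> {}" using y(1) by auto
  define c where "c = Max ((\<lambda>v. \<bar>y v\<bar> / z v) ` V)"
  have cge: "\<bar>y v\<bar> \<le> c * z v" if "v \<in> V" for v
  proof -
    have "\<bar>y v\<bar> / z v \<le> c" unfolding c_def using fin that by (intro Max_ge) auto
    then show ?thesis using z[OF that] by (simp add: field_simps)
  qed
  obtain m where m: "m \<in> V" "\<bar>y m\<bar> = c * z m"
  proof -
    have "c \<in> (\<lambda>v. \<bar>y v\<bar> / z v) ` V" unfolding c_def using fin \<open>V \<noteq> {}\<close> by (intro Max_in) auto
    then obtain v where "v \<in> V" "c = \<bar>y v\<bar> / z v" by auto
    then show ?thesis using that[of v] z[of v] by (simp add: field_simps)
  qed
  obtain w where w: "w \<in> V" "y w \<noteq> 0" using y(1) by blast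
  have c: "c > 0"
  proof -
    have "0 < c * z w" using cge[OF w(1)] w(2) by linarith
    then show ?thesis using z[OF w(1)] by (simp add: zero_less_mult_iff)
  qed
  have chain: "k * \<bar>y v\<bar> \<le> nsum E (\<lambda>w. \<bar>y w\<bar>) v" "nsum E (\<lambda>w. \<bar>y w\<bar>) v \<le> c * nsum E z v" "c * nsum E z v \<le> c * (r * z v)"
    if v: "v \<in> V" for v
  proof -
    have "k * \<bar>y v\<bar> \<le> \<bar>k * y v\<bar>" by (simp add: abs_mult mult_right_mono)
    also have "\<dots> \<le> nsum E (\<lambda>w. \<bar>y w\<bar>) v" using y(2)[OF v] sum_abs[of y "E `` {v}"] by simp
    finally show "k * \<bar>y v\<bar> \<le> nsum E (\<lambda>w. \<bar>y w\<bar>) v" .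
    have "nsum E (\<lambda>w. \<bar>y w\<bar>) v \<le> nsum E (\<lambda>w. c * z w) v"
      using E by (intro sum_mono cge) auto
    then show "nsum E (\<lambda>w. \<bar>y w\<bar>) v \<le> c * nsum E z v" by (simp add: sum_distrib_left)
    show "c * nsum E z v \<le> c * (r * z v)" using sup[OF v] c by simp
  qed
  have "k * (c * z m) \<le> r * (c * z m)" using chain[OF m(1)] m(2) by (simp add: mult_ac)
  then show le: "k \<le> r" using c z[OF m(1)] by simp
  show "k < r" if con: "conn V E" and strict: "\<exists>v\<in>V. nsum E z v < r * z v"
  proof (rule ccontr)
    assume "\<not> k < r"
    then have kr: "k = r" using le by simp
    have tight: "nsum E z v = r * z v \<and> (\<forall>w\<in>E `` {v}. \<bar>y w\<bar> = c * z w)"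
      if v: "v \<in> V" and eq: "\<bar>y v\<bar> = c * z v" for v
    proof -
      have 1: "c * nsum E z v = c * (r * z v)" "nsum E (\<lambda>w. \<bar>y w\<bar>) v = c * nsum E z v"
        using chain[OF v] eq kr by (simp_all only: mult.left_commute[of r c])
      have "(\<Sum>w\<in>E `` {v}. c * z w - \<bar>y w\<bar>) = 0"
        using 1(2) by (simp add: sum_subtractf sum_distrib_left)
      then have "\<forall>w\<in>E `` {v}. c * z w - \<bar>y w\<bar> = 0"
        using E cge by (subst (asm) sum_nonneg_eq_0_iff[OF finN]) auto
      then show ?thesis using 1(1) c by auto
    qed
    have "\<bar>y v\<bar> = c * z v \<and> v \<in> V" if "v \<in> V" for v
      by (rule conn_induct[OF con m(1) _ _ that]) (use m tight E in auto)
    then have "\<forall>v\<in>V. nsum E z v = r * z v" using tight by blast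
    then show False using strict by auto
  qed
qed

text \<open>Positivity of the nonnegative eigenvector spreads along edges, because a positive
  neighbour makes the neighbour sum positive. Once positive everywhere, the vector is a
  supersolution for its own eigenvalue and so bounds all other eigenvalues.\<close>

lemma spectral_radius_perron:
  assumes G: "simple_graph V E" and con: "conn V E" and ne: "V \<noteq> {}"
  obtains x where "\<And>v. v \<in> V \<Longrightarrow> x v > 0"
    and "\<And>v. v \<in> V \<Longrightarrow> nsum E x v = adj_spectral_radius (mk_graph V E) * x v"
proof -
  have fin: "finite V" and E: "E \<subseteq> V \<times> V" and sym: "sym E"
    using G by (auto simp: simple_graph_def)
  obtain x r where x: "\<forall>v\<in>V. x v \<ge> 0" "\<exists>v\<in>V. x v > 0" "\<forall>v\<in>V. nsum E x v = r * x v"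
    using perron_vector_nonneg[OF G ne] by blast
  then obtain m where m: "m \<in> V" "x m > 0" by blast
  have finN: "finite (E `` {v})" for v using fin E by (meson Image_singleton_iff SigmaD2 finite_subset subsetI subsetD)
  have step: "x w > 0 \<and> w \<in> V" if v: "x v > 0 \<and> v \<in> V" and vw: "(v, w) \<in> E" for v w
  proof -
    have w: "w \<in> V" and wv: "v \<in> E `` {w}" using vw E sym by (auto simp: sym_def)
    have "nsum E x w > 0"
      using x(1) E v by (intro sum_pos2[OF finN wv]) auto
    then have "x w \<noteq> 0" using x(3) w by auto
    then show ?thesis using x(1) w by (metis less_eq_real_def)
  qed
  have pos: "x v > 0" if "v \<in> V" for v
    using conn_induct[OF con m(1), of "\<lambda>v. x v > 0 \<and> v \<in> V"] step m that by blast
  have "\<exists>v\<in>V. x v \<noteq> 0" using m by (intro bexI[of _ m]) simp_all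
  then have ev: "adjacency_eigenvalue (mk_graph V E) r"
    unfolding adjacency_eigenvalue_iff[OF fin E] using x(3) by (intro exI[of _ x] conjI)
  moreover have "k \<le> r" if k: "adjacency_eigenvalue (mk_graph V E) k" for k
  proof -
    obtain y where y: "\<exists>v\<in>V. y v \<noteq> 0" "\<forall>v\<in>V. nsum E y v = k * y v"
      using k unfolding adjacency_eigenvalue_iff[OF fin E] by blast
    show ?thesis
      by (rule eigenvalue_le_supersolution(1)[OF G, of x r y k]) (use pos x(3) y in auto)
  qed
  ultimately have "adj_spectral_radius (mk_graph V E) = r"
    unfolding adj_spectral_radius_def
    using finite_adjacency_eigenvalues[OF fin E] by (intro Max_eqI) auto
  then show ?thesis using that[of x] pos x(3) by auto
qed

lemma spectral_radius_less_supersolution: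
  assumes G: "simple_graph V E" and con: "conn V E" and z: "\<And>v. v \<in> V \<Longrightarrow> z v > 0"
    and sup: "\<And>v. v \<in> V \<Longrightarrow> nsum E z v \<le> r * z v"
    and strict: "s \<in> V" "nsum E z s < r * z s"
  shows "adj_spectral_radius (mk_graph V E) < r"
proof -
  obtain x where x: "\<And>v. v \<in> V \<Longrightarrow> x v > 0"
    "\<And>v. v \<in> V \<Longrightarrow> nsum E x v = adj_spectral_radius (mk_graph V E) * x v"
    using spectral_radius_perron[OF G con] strict by (metis empty_iff)
  have "\<exists>v\<in>V. x v \<noteq> 0" using x(1)[OF strict(1)] strict(1) by (metis less_irrefl)
  then show ?thesis
    using eigenvalue_le_supersolution(2)[OF G z sup _ x(2) con] strict by blast
qed

section \<open>Bridges and rewiring\<close>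

definition cut :: "('a \<times> 'a) set \<Rightarrow> 'a \<Rightarrow> 'a \<Rightarrow> ('a \<times> 'a) set" where
  "cut E u v = E - {(u, v), (v, u)}"

text \<open>When every edge is a bridge, the two orientations of an edge give disjoint sides, so
  Perron weights can be rescaled on one side at the cost of the rows at the two ends only.\<close>

definition side :: "('a \<times> 'a) set \<Rightarrow> 'a \<Rightarrow> 'a \<Rightarrow> 'a set" where
  "side E u v = {w. (u, w) \<in> (cut E u v)\<^sup>*}"

lemma sym_cut: "sym E \<Longrightarrow> sym (cut E u v)"
  by (auto simp: sym_def cut_def)

text \<open>\<open>D\<close> is the piece that gets detached; in \<open>E\<close> it touches the
  rest only at \<open>w\<close>. A walk from \<open>r\<close> in \<open>E\<close> is shadowed in
  \<open>E'\<close>: while the walk is inside \<open>D\<close>, the shadow waits at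
  \<open>w\<close>, the only place where the walk can come out again.\<close>

lemma conn_reroute:
  assumes con: "conn V E" and sym: "sym E" and EV: "E \<subseteq> V \<times> V" and sym': "sym E'"
    and D: "\<And>d v. d \<in> D \<Longrightarrow> v \<notin> D \<Longrightarrow> (d, v) \<in> E \<Longrightarrow> v = w"
    and E': "\<And>u v. u \<notin> D \<Longrightarrow> v \<notin> D \<Longrightarrow> (u, v) \<in> E \<Longrightarrow> (u, v) \<in> E'\<^sup>*"
    and r: "r \<in> V" "r \<notin> D" and DE': "\<And>d. d \<in> D \<Longrightarrow> (r, d) \<in> E'\<^sup>*"
  shows "conn V E'"
proof -
  have "(v \<notin> D \<longrightarrow> (r, v) \<in> E'\<^sup>*) \<and> (v \<in> D \<longrightarrow> (r, w) \<in> E'\<^sup>*)" if "(r, v) \<in> E\<^sup>*" for v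
    using that
  proof (induction rule: rtrancl_induct)
    case base
    then show ?case using r by simp
  next
    case (step v v')
    show ?case
    proof (cases "v \<in> D")
      case True
      then show ?thesis using step D by blast
    next
      case False
      have "v = w" if "v' \<in> D" using D[OF that False] step(2) sym by (auto simp: sym_def)
      then show ?thesis using False step E'[of v v'] by (auto intro: rtrancl_trans)
    qed
  qed
  then have all: "(r, v) \<in> E'\<^sup>*" if "v \<in> V" for v
    using DE' con that r by (auto simp: conn_def)
  then have "(u, v) \<in> E'\<^sup>*" if "u \<in> V" "v \<in> V" for u v
    using that sym' by (meson rtrancl_trans sym_rtrancl symD)
  then show ?thesis by (auto simp: conn_def)
qed

lemma simple_graph_replace:
  assumes "simple_graph V E" "sym R" "sym A" "irrefl A" "A \<subseteq> V \<times> V"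
  shows "simple_graph V ((E - R) \<union> A)"
  using assms unfolding simple_graph_def irrefl_def sym_def by blast

section \<open>Connected graphs with a Perron vector\<close>

locale perron_graph =
  fixes V :: "'a set" and E :: "('a \<times> 'a) set" and x :: "'a \<Rightarrow> real" and r :: real
  assumes graph: "simple_graph V E" and con: "conn V E" and card2: "card V \<ge> 2"
    and pos: "v \<in> V \<Longrightarrow> x v > 0" and eig: "v \<in> V \<Longrightarrow> nsum E x v = r * x v"
begin

lemma fin: "finite V" and EV: "E \<subseteq> V \<times> V" and symE: "sym E" and irr: "(v, v) \<notin> E"
  using graph by (auto simp: simple_graph_def irrefl_def)

lemma Esym: "(u, v) \<in> E \<Longrightarrow> (v, u) \<in> E"
  using symE by (auto simp: sym_def)

lemma inV: "(u, v) \<in> E \<Longrightarrow> u \<in> V" "(u, v) \<in> E \<Longrightarrow> v \<in> V"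
  using EV by auto

lemma finN: "finite (E `` {v})"
  using fin EV by (meson Image_singleton_iff SigmaD2 finite_subset subsetI subsetD)

lemma finE: "finite E"
  using fin EV finite_subset by blast

lemma nbr_exists: "v \<in> V \<Longrightarrow> E `` {v} \<noteq> {}"
proof -
  assume v: "v \<in> V"
  have "\<not> V \<subseteq> {v}" using card2 card_mono[of "{v}" V] by auto
  then obtain w where "w \<in> V" "w \<noteq> v" by blast
  then have "(v, w) \<in> E\<^sup>*" "v \<noteq> w" using con v by (auto simp: conn_def)
  then show ?thesis by (auto elim: converse_rtranclE)
qed

lemma deg_pos: "v \<in> V \<Longrightarrow> deg E v \<ge> 1"
  using nbr_exists finN by (simp add: Suc_leI card_gt_0_iff)

lemma nsum_ge: "A \<subseteq> E `` {v} \<Longrightarrow> v \<in> V \<Longrightarrow> sum x A \<le> r * x v"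
  using eig[of v] sum_mono2[OF finN, of A v x] inV pos by (metis DiffD1 Image_singleton_iff less_imp_le)

lemma nbr_le: "(v, w) \<in> E \<Longrightarrow> x w \<le> r * x v"
  using nsum_ge[of "{w}" v] inV by auto

lemma rpos: "r > 0"
proof -
  obtain v where v: "v \<in> V" using card2 by fastforce
  then obtain w where "(v, w) \<in> E" using nbr_exists by blast
  then have "0 < r * x v" using nbr_le[of v w] pos[of w] inV by fastforce
  then show ?thesis using pos[OF v] by (simp add: zero_less_mult_iff)
qed

text \<open>The row of \<open>w\<close> after loss of the neighbours \<open>B\<close> and of the
  pendant vertex \<open>t\<close>. The \<open>if\<close> records that only the neighbour
  \<open>y\<close> of \<open>t\<close> has anything to lose.\<close>

lemma nbr_sum_diff_leaf:
  assumes t: "E `` {t} = {y}" and B: "B \<subseteq> E `` {w}" "t \<notin> B" and w: "w \<in> V"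
  shows "sum x (E `` {w} - B - {t}) = r * x w - sum x B - (if w = y then x t else 0)"
proof -
  have iff: "t \<in> E `` {w} \<longleftrightarrow> w = y" using t Esym by auto
  have "sum x (E `` {w} - B) = r * x w - sum x B"
    using sum_diff[OF finN B(1), of x] eig[OF w] by simp
  moreover have "sum x (E `` {w} - B - {t}) = sum x (E `` {w} - B) - (if w = y then x t else 0)"
    using sum_diff1[of "E `` {w} - B" x t] finN B(2) iff by auto
  ultimately show ?thesis by simp
qed

text \<open>The Perron vector itself serves as supersolution, since rows only lose summands; the row
  of \<open>u\<close> loses \<open>x v\<close>.\<close>

lemma edge_on_cycle_reduces:
  assumes uv: "(u, v) \<in> E" and cyc: "(u, v) \<in> (cut E u v)\<^sup>*"
  shows "simple_graph V (cut E u v) \<and> conn V (cut E u v) \<and>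
    adj_spectral_radius (mk_graph V (cut E u v)) < r"
proof -
  let ?F = "cut E u v"
  have G: "simple_graph V ?F" using graph sym_cut[of E u v]
    by (auto simp: simple_graph_def cut_def irrefl_def)
  have vu: "(v, u) \<in> ?F\<^sup>*" using cyc sym_cut[OF symE] by (meson sym_rtrancl symD)
  have "E \<subseteq> ?F\<^sup>*" using cyc vu by (auto simp: cut_def)
  then have "E\<^sup>* \<subseteq> ?F\<^sup>*" by (metis rtrancl_subset_rtrancl)
  then have C: "conn V ?F" using con by (auto simp: conn_def)
  have sub: "nsum ?F x w \<le> r * x w" if "w \<in> V" for w
    using that by (intro nsum_ge) (auto simp: cut_def)
  have u: "u \<in> V" "v \<in> V" using uv inV by auto
  have "nsum ?F x u < nsum E x u"
    by (rule sum_strict_mono2[OF finN, where b = v])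
      (use uv irr u pos inV in \<open>auto simp: cut_def less_imp_le\<close>)
  then have "nsum ?F x u < r * x u" using eig u by simp
  then have "adj_spectral_radius (mk_graph V ?F) < r"
    using spectral_radius_less_supersolution[OF G C pos sub u(1)] by blast
  then show ?thesis using G C by blast
qed

lemma sum_over_nbrs_eq:
  assumes "w \<in> V" "B \<subseteq> E `` {w}" "\<And>v. v \<in> E `` {w} - B \<Longrightarrow> z v = x v"
  shows "sum z (E `` {w} - B) = r * x w - sum x B"
proof -
  have "sum z (E `` {w} - B) = sum x (E `` {w} - B)" using assms by (intro sum.cong) auto
  then show ?thesis using sum_diff[OF finN assms(2), of x] eig[OF assms(1)] by simp
qed

text \<open>The pendant path \<open>a\<close>, \<open>b\<close> is moved to \<open>z0\<close>, and
  \<open>c1\<close>, \<open>c2\<close> move from \<open>z0\<close> to \<open>b\<close>, so that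
  \<open>z0\<close> is split into \<open>z0\<close> and \<open>b\<close> with \<open>a\<close>
  between. Both halves get weight \<open>x z0\<close>, and \<open>2 * x z0 / r\<close> makes the row
  of \<open>a\<close> an equality. Every neighbour of \<open>z0\<close> weighs at least
  \<open>x z0 / r\<close>: hence \<open>a\<close> weighs at most \<open>c1\<close> and
  \<open>c2\<close> together, which is the row of \<open>z0\<close>, and at most two further
  neighbours of \<open>z0\<close> together, which is the row of \<open>b\<close>. Degree 4 provides
  these two.\<close>

lemma split_vertex_reduces:
  assumes a: "E `` {a} = {b}" and b: "E `` {b} = {a, w}" and wa: "w \<noteq> a"
    and z0: "z0 \<in> V" "deg E z0 \<ge> 4" "z0 \<noteq> w"
    and c: "c1 \<noteq> c2" "(z0, c1) \<in> E" "(z0, c2) \<in> E" "c1 \<noteq> w" "c2 \<noteq> w"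
    and E'_def: "E' = (E - {(b, w), (w, b), (z0, c1), (c1, z0), (z0, c2), (c2, z0)})
      \<union> {(z0, a), (a, z0), (b, c1), (c1, b), (b, c2), (c2, b)}"
  shows "simple_graph V E' \<and> conn V E' \<and> adj_spectral_radius (mk_graph V E') < r"
proof -
  have arcs: "(a, b) \<in> E" "(b, a) \<in> E" "(b, w) \<in> E" "(w, b) \<in> E" "(c1, z0) \<in> E" "(c2, z0) \<in> E"
    using a b c Esym by blast+
  have av: "a \<in> V" "b \<in> V" "w \<in> V" "c1 \<in> V" "c2 \<in> V" using arcs inV by blast+
  have ab: "a \<noteq> b" "b \<noteq> w" using arcs irr by blast+
  have za: "z0 \<noteq> a" "z0 \<noteq> b"
    using z0(2) a b wa by auto
  have zn: "(z0, a) \<notin> E" "(z0, b) \<notin> E" using a b za z0(3) Esym by blast+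
  have an: "(v, a) \<in> E \<Longrightarrow> v = b" "(v, b) \<in> E \<Longrightarrow> v = a \<or> v = w" for v
    using a b Esym by blast+
  have c': "c1 \<noteq> a" "c2 \<noteq> a" "c1 \<noteq> b" "c2 \<noteq> b" "c1 \<noteq> z0" "c2 \<noteq> z0"
    using zn c irr by blast+
  have G: "simple_graph V E'"
    unfolding E'_def using av z0(1) za c'
    by (intro simple_graph_replace[OF graph]) (auto simp: sym_def irrefl_def)
  have C: "conn V E'"
  proof (rule conn_reroute[OF con symE EV, where D = "{a, b}" and w = w and r = z0])
    show "sym E'" using G by (simp add: simple_graph_def)
    show "v = w" if "d \<in> {a, b}" "v \<notin> {a, b}" "(d, v) \<in> E" for d v
      using that a b by auto
    have 1: "(z0, a) \<in> E'" "(a, b) \<in> E'" "(b, c1) \<in> E'" "(b, c2) \<in> E'"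
      "(a, z0) \<in> E'" "(b, a) \<in> E'" "(c1, b) \<in> E'" "(c2, b) \<in> E'"
      using arcs ab za c' c wa unfolding E'_def by auto
    then have 2: "(z0, b) \<in> E'\<^sup>*" "(b, z0) \<in> E'\<^sup>*"
      by (meson r_into_rtrancl rtrancl_into_rtrancl)+
    then show "(z0, d) \<in> E'\<^sup>*" if "d \<in> {a, b}" for d using that 1 by auto
    have 3: "(z0, c1) \<in> E'\<^sup>*" "(z0, c2) \<in> E'\<^sup>*" "(c1, z0) \<in> E'\<^sup>*" "(c2, z0) \<in> E'\<^sup>*"
      using 1 2 by (meson rtrancl_into_rtrancl converse_rtrancl_into_rtrancl)+
    show "(u, v) \<in> E'\<^sup>*" if "u \<notin> {a, b}" "v \<notin> {a, b}" "(u, v) \<in> E" for u v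
    proof (cases "(u, v) \<in> E'")
      case False
      then have "(u, v) \<in> {(z0, c1), (c1, z0), (z0, c2), (c2, z0)}"
        using that unfolding E'_def by auto
      then show ?thesis using 3 by auto
    qed auto
  qed (use z0 za in auto)
  define z where "z = (\<lambda>v. if v = a then 2 * x z0 / r else if v = b then x z0 else x v)"
  have zx: "z v = x v" if "v \<noteq> a" "v \<noteq> b" for v using that by (simp add: z_def)
  have zpos: "z v > 0" if "v \<in> V" for v
    using pos[OF that] pos[OF z0(1)] rpos by (simp add: z_def)
  have lb: "x z0 / r \<le> x v" if "(z0, v) \<in> E" for v
    using nbr_le[OF Esym[OF that]] rpos by (simp add: field_simps)
  \<comment> \<open>The margin is recorded at \<open>w\<close>, which loses the neighbour
    \<open>b\<close>; all other rows may be tight.\<close>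
  have row: "nsum E' z v \<le> r * z v - (if v = w then x b else 0)" if v: "v \<in> V" for v
  proof -
    consider "v = a" | "v = b" | "v = z0" | "v = c1" | "v = c2" | "v = w" |
      "v \<notin> {a, b, z0, c1, c2, w}" by blast
    then show ?thesis
    proof cases
      case 1
      have "E' `` {a} = {b, z0}" using a ab za c' wa unfolding E'_def by auto
      then show ?thesis using 1 ab za wa rpos by (simp add: z_def)
    next
      case 2
      have "E' `` {b} = {a, c1, c2}" using b ab za c' c wa unfolding E'_def by auto
      then have s: "nsum E' z b = 2 * x z0 / r + x c1 + x c2" using c c' by (simp add: z_def)
      have "2 \<le> card (E `` {z0} - {c1, c2})"
        using z0(2) c by (simp add: card_Diff_subset)
      then obtain d1 d2 where d: "d1 \<noteq> d2" "{d1, d2} \<subseteq> E `` {z0} - {c1, c2}"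
        by (metis card_2_iff obtain_subset_with_card_n)
      have "x c1 + x c2 + x d1 + x d2 \<le> r * x z0"
        using nsum_ge[of "{c1, c2, d1, d2}" z0] c d z0(1) by auto
      moreover have "2 * x z0 / r \<le> x d1 + x d2" using lb[of d1] lb[of d2] d by auto
      ultimately show ?thesis using 2 ab s by (simp add: z_def)
    next
      case 3
      have "E' `` {z0} = insert a (E `` {z0} - {c1, c2})"
        using za zn z0(3) c c' unfolding E'_def by auto
      then have "nsum E' z z0 = 2 * x z0 / r + sum z (E `` {z0} - {c1, c2})"
        using zn finN by (simp add: z_def)
      also have "sum z (E `` {z0} - {c1, c2}) = r * x z0 - sum x {c1, c2}"
        using z0(1) c zn by (intro sum_over_nbrs_eq) (auto simp: z_def)
      finally have "nsum E' z z0 = 2 * x z0 / r + (r * x z0 - (x c1 + x c2))"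
        using c by simp
      moreover have "2 * x z0 / r \<le> x c1 + x c2" using lb[of c1] lb[of c2] c by auto
      ultimately show ?thesis using 3 za z0(3) by (simp add: z_def)
    next
      case 4
      have n: "(c1, a) \<notin> E" "(c1, b) \<notin> E" using an c' c by blast+
      have "E' `` {c1} = insert b (E `` {c1} - {z0})"
        using za c c' unfolding E'_def by auto
      then have "nsum E' z c1 = x z0 + sum z (E `` {c1} - {z0})"
        using n finN ab by (simp add: z_def)
      also have "sum z (E `` {c1} - {z0}) = r * x c1 - sum x {z0}"
        using av arcs n by (intro sum_over_nbrs_eq) (auto simp: z_def)
      finally show ?thesis using 4 c c' by (simp add: z_def)
    next
      case 5
      have n: "(c2, a) \<notin> E" "(c2, b) \<notin> E" using an c' c by blast+
      have "E' `` {c2} = insert b (E `` {c2} - {z0})"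
        using za c c' unfolding E'_def by auto
      then have "nsum E' z c2 = x z0 + sum z (E `` {c2} - {z0})"
        using n finN ab by (simp add: z_def)
      also have "sum z (E `` {c2} - {z0}) = r * x c2 - sum x {z0}"
        using av arcs n by (intro sum_over_nbrs_eq) (auto simp: z_def)
      finally show ?thesis using 5 c c' by (simp add: z_def)
    next
      case 6
      have n: "(w, a) \<notin> E" using an ab by blast
      have "E' `` {w} = E `` {w} - {b}"
        using z0 wa ab c c' unfolding E'_def by auto
      also have "sum z (E `` {w} - {b}) = r * x w - sum x {b}"
        using av arcs n by (intro sum_over_nbrs_eq) (auto simp: z_def)
      finally show ?thesis using 6 wa ab by (simp add: z_def)
    next
      case 7
      have n: "(v, a) \<notin> E" "(v, b) \<notin> E" using an 7 by blast+
      have "E' `` {v} = E `` {v} - {}"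
        using 7 unfolding E'_def by auto
      also have "sum z (E `` {v} - {}) = r * x v - sum x {}"
        using v n by (intro sum_over_nbrs_eq) (auto simp: z_def)
      finally show ?thesis using 7 by (simp add: z_def)
    qed
  qed
  have "nsum E' z v \<le> r * z v" if "v \<in> V" for v
    using row[OF that] pos[OF av(2)] by (auto split: if_splits)
  moreover have "nsum E' z w < r * z w" using row[OF av(3)] pos[OF av(2)] by simp
  ultimately have "adj_spectral_radius (mk_graph V E') < r"
    using spectral_radius_less_supersolution[OF G C, of z r w] zpos av(3) by blast
  then show ?thesis using G C by blast
qed

end

section \<open>Trees and the sides of their edges\<close>

locale perron_tree = perron_graph +
  assumes bridge: "(u, v) \<in> E \<Longrightarrow> (u, v) \<notin> (cut E u v)\<^sup>*"
begin

lemma side_self: "u \<in> side E u v"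
  by (simp add: side_def)

lemma side_subset: "u \<in> V \<Longrightarrow> side E u v \<subseteq> V"
proof
  fix w assume u: "u \<in> V" and "w \<in> side E u v"
  then have "(u, w) \<in> (cut E u v)\<^sup>*" by (simp add: side_def)
  then show "w \<in> V" by (induction rule: rtrancl_induct) (use u EV in \<open>auto simp: cut_def\<close>)
qed

lemma side_step:
  assumes "w \<in> side E u v" "(w, w') \<in> E" "\<not> (w = u \<and> w' = v)"
  shows "w' \<in> side E u v"
proof (cases "(w, w') = (v, u)")
  case False
  then have "(w, w') \<in> cut E u v" using assms by (auto simp: cut_def)
  then show ?thesis using assms(1) by (auto simp: side_def)
qed (use side_self in auto)

lemma side_not: "(u, v) \<in> E \<Longrightarrow> v \<notin> side E u v"
  using bridge by (simp add: side_def)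

lemma side_step_back:
  assumes "w' \<in> side E u v" "(w, w') \<in> E" "\<not> (w = v \<and> w' = u)"
  shows "w \<in> side E u v"
  using side_step[OF assms(1) Esym[OF assms(2)]] assms(3) by auto

lemma side_cover:
  assumes "(u, v) \<in> E" "w \<in> V"
  shows "w \<in> side E u v \<or> w \<in> side E v u"
proof (rule conn_induct[OF con inV(1)[OF assms(1)] _ _ assms(2)])
  fix w w' assume w: "w \<in> side E u v \<or> w \<in> side E v u" and e: "(w, w') \<in> E"
  show "w' \<in> side E u v \<or> w' \<in> side E v u"
    using w side_step[OF _ e] side_self by blast
qed (simp add: side_self)

text \<open>Removing \<open>u\<close> splits its side of the edge into the sides of the other
  neighbours of \<open>u\<close>; inductions along the tree descend into one of them.\<close>

lemma side_decomp:
  assumes "w \<in> side E u v" "w \<noteq> u"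
  obtains u' where "(u, u') \<in> E" "u' \<noteq> v" "w \<in> side E u' u"
proof -
  have "(u, w) \<in> (cut E u v)\<^sup>*" using assms by (simp add: side_def)
  then have "w = u \<or> (\<exists>u'. (u, u') \<in> E \<and> u' \<noteq> v \<and> w \<in> side E u' u)"
  proof (induction rule: rtrancl_induct)
    case (step y y')
    have e: "(y, y') \<in> E" using step(2) by (simp add: cut_def)
    show ?case
    proof (cases "y = u")
      case True
      then have "y' \<noteq> v" using step(2) by (auto simp: cut_def)
      then show ?thesis using e True side_self by blast
    next
      case False
      then obtain u' where u': "(u, u') \<in> E" "u' \<noteq> v" "y \<in> side E u' u" using step by blast
      then show ?thesis using side_step[OF u'(3) e] by blast
    qed
  qed simp
  then show ?thesis using assms that by blast
qed

lemma side_psubset: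
  assumes "(u, v) \<in> E" "(u, u') \<in> E" "u' \<noteq> v"
  shows "side E u' u \<subset> side E u v"
proof -
  have nu: "u \<notin> side E u' u" using side_not[OF Esym[OF assms(2)]] .
  have "w \<in> side E u v" if "w \<in> side E u' u" for w
  proof -
    have "(u', w) \<in> (cut E u' u)\<^sup>*" using that by (simp add: side_def)
    then have "w \<in> side E u v \<and> w \<in> side E u' u"
    proof (induction rule: rtrancl_induct)
      case base
      then show ?case using side_step[OF side_self assms(2)] assms(3) side_self by blast
    next
      case (step y y')
      then have e: "(y, y') \<in> E" by (simp add: cut_def)
      have "y' \<in> side E u' u" using step(2,3) by (auto simp: side_def)
      moreover have "y \<noteq> u" using step nu by blast
      ultimately show ?case using side_step[of y u v y'] e step by blast
    qed
    then show ?thesis by simp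
  qed
  then show ?thesis using nu side_self by blast
qed

text \<open>The decreasing measure for inductions that walk away from \<open>v\<close>.\<close>

lemma card_side_less:
  assumes "(u, v) \<in> E" "(u, u') \<in> E" "u' \<noteq> v"
  shows "card (side E u' u) < card (side E u v)"
  using side_psubset[OF assms] side_subset[of u v] inV[OF assms(1)] fin
  by (meson finite_subset psubset_card_mono)

end


section \<open>Rewirings of trees\<close>

context perron_tree
begin

text \<open>Doubling the Perron weights on the side of \<open>q\<close> pays for the new neighbour of \<open>q\<close>.\<close>

lemma shift_branch_reduces:
  assumes s: "s \<in> V" "deg E s \<ge> 3" and t: "E `` {t} = {y}" "t \<noteq> s"
    and q: "(s, q) \<in> E" "\<And>v. (s, v) \<in> E \<Longrightarrow> x q \<le> x v" "q \<noteq> t"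
    and b: "(s, b) \<in> E" "b \<noteq> q" "b \<noteq> t"
    and E'_def: "E' = (E - {(t, y), (y, t), (s, b), (b, s)}) \<union> {(t, b), (b, t), (t, q), (q, t)}"
  shows "simple_graph V E' \<and> conn V E' \<and> adj_spectral_radius (mk_graph V E') < r"
proof -
  have arcs: "(t, y) \<in> E" "(y, t) \<in> E" "(b, s) \<in> E" "(q, s) \<in> E" using t q b Esym by blast+
  have av: "t \<in> V" "y \<in> V" "b \<in> V" "q \<in> V" using arcs inV by blast+
  have ne: "t \<noteq> y" "s \<noteq> b" "s \<noteq> q" using arcs irr b q by blast+
  have tn: "(v, t) \<in> E \<longleftrightarrow> v = y" "(t, v) \<in> E \<longleftrightarrow> v = y" for v using t arcs Esym by blast+
  have G: "simple_graph V E'"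
    unfolding E'_def using av q b
    by (intro simple_graph_replace[OF graph]) (auto simp: sym_def irrefl_def)
  have C: "conn V E'"
  proof (rule conn_reroute[OF con symE EV, where D = "{t}" and w = y and r = s])
    show sym': "sym E'" using G by (simp add: simple_graph_def)
    show "v = y" if "d \<in> {t}" "v \<notin> {t}" "(d, v) \<in> E" for d v using that t by auto
    have "(s, q) \<in> E'" "(q, t) \<in> E'" "(t, b) \<in> E'"
      using q b t ne unfolding E'_def by auto
    then have 1: "(s, t) \<in> E'\<^sup>*" "(s, b) \<in> E'\<^sup>*"
      by (meson r_into_rtrancl rtrancl_into_rtrancl)+
    then show "(s, d) \<in> E'\<^sup>*" if "d \<in> {t}" for d using that by simp
    have 2: "(b, s) \<in> E'\<^sup>*" using 1(2) sym' by (meson sym_rtrancl symD)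
    show "(u, v) \<in> E'\<^sup>*" if "u \<notin> {t}" "v \<notin> {t}" "(u, v) \<in> E" for u v
    proof (cases "(u, v) \<in> E'")
      case False
      then have "(u, v) \<in> {(s, b), (b, s)}" using that unfolding E'_def by auto
      then show ?thesis using 1 2 by auto
    qed auto
  qed (use s t in auto)
  let ?U = "side E q s"
  have sU: "s \<notin> ?U" using side_not[OF arcs(4)] .
  have qU: "q \<in> ?U" by (rule side_self)
  have nU: "v \<notin> ?U" if "(s, v) \<in> E" "v \<noteq> q" for v
    using side_step[of v q s s] Esym[OF that(1)] that(2) sU by blast
  \<comment> \<open>The values at \<open>t\<close> and \<open>s\<close> solve their own new rows:
    \<open>t\<close> sees \<open>b\<close> and the doubled \<open>q\<close>, while \<open>s\<close>
    loses \<open>b\<close> and sees \<open>q\<close> doubled.\<close>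
  define z where "z = (\<lambda>v. if v = t then (2 * x q + x b) / r
     else if v = s then x s + (x q - x b) / r else if v \<in> ?U then 2 * x v else x v)"
  have bU: "b \<notin> ?U" using nU b by simp
  have zt: "r * z t = 2 * x q + x b" using rpos by (simp add: z_def)
  have zs: "r * z s = r * x s + x q - x b" using rpos t(2) by (simp add: z_def field_simps)
  \<comment> \<open>A third neighbour \<open>a\<close> of \<open>s\<close>, at least as heavy as
    \<open>q\<close>, pays for the doubled \<open>q\<close> in the row of \<open>s\<close>, which
    bounds \<open>z t\<close> by \<open>x s\<close>.\<close>
  have "\<not> E `` {s} \<subseteq> {q, b}"
    using s(2) card_mono[of "{q, b}" "E `` {s}"] by (auto simp: card_insert_if split: if_splits)
  then obtain a where a: "(s, a) \<in> E" "a \<noteq> q" "a \<noteq> b" by blast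
  have sum3: "x a + x q + x b \<le> r * x s"
    using nsum_ge[of "{a, q, b}" s] a q b s by (auto simp: add.assoc)
  have xa: "x q \<le> x a" "x q \<le> x b" using q a b by auto
  have xq: "x q > 0" "x b > 0" "x t > 0" "x a > 0" using av pos inV(2)[OF a(1)] by blast+
  have z_s_le: "z s \<le> x s" using t(2) xa rpos by (simp add: z_def divide_nonpos_pos)
  have z_t_le: "z t \<le> x s"
  proof -
    have "r * z t \<le> r * x s" using zt sum3 xa by linarith
    then show ?thesis using rpos by simp
  qed
  have zpos: "z v > 0" if "v \<in> V" for v
  proof -
    have "r * z s > 0" using zs sum3 xq by linarith
    then have "z s > 0" using rpos by (simp add: zero_less_mult_iff)
    moreover have "r * z t > 0" using zt xq by linarith
    then have "z t > 0" using rpos by (simp add: zero_less_mult_iff)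
    ultimately show ?thesis using pos[OF that] by (cases "v = s"; cases "v = t"; simp add: z_def)
  qed
  have sumz: "sum z (E `` {v} - B - {t}) = c * (r * x v - sum x B - (if v = y then x t else 0))"
    if "v \<in> V" "B \<subseteq> E `` {v}" "t \<notin> B" "\<And>w. (v, w) \<in> E \<Longrightarrow> w \<notin> B \<Longrightarrow> w \<noteq> t \<Longrightarrow> z w = c * x w" for v B c
  proof -
    have "sum z (E `` {v} - B - {t}) = (\<Sum>w\<in>E `` {v} - B - {t}. c * x w)"
      using that by (intro sum.cong) auto
    also have "\<dots> = c * sum x (E `` {v} - B - {t})" by (rule sum_distrib_left[symmetric])
    finally show ?thesis using nbr_sum_diff_leaf[OF t(1) that(2,3,1)] by simp
  qed
  have row: "nsum E' z v \<le> r * z v - (if v = y then x t else 0)" if v: "v \<in> V" for v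
  proof -
    consider "v = t" | "v = s" | "v = b" | "v = q" |
      "v \<notin> {t, s, b, q}" "(v, s) \<in> E" | "v \<notin> {t, s, b, q}" "(v, s) \<notin> E" "v \<in> ?U" |
      "v \<notin> {t, s, b, q}" "(v, s) \<notin> E" "v \<notin> ?U" by blast
    then show ?thesis
    proof cases
      case 1
      have "E' `` {t} = {b, q}" using t ne tn b q unfolding E'_def by auto
      then have "nsum E' z t = x b + 2 * x q"
        using b bU qU ne q by (simp add: z_def)
      then show ?thesis using 1 zt ne by simp
    next
      case 2
      have "E' `` {s} = insert q (E `` {s} - {b, q} - {t})"
        using t q b ne tn unfolding E'_def by auto
      then have "nsum E' z s = z q + sum z (E `` {s} - {b, q} - {t})"
        using finN by simp
      also have "sum z (E `` {s} - {b, q} - {t}) = 1 * (r * x s - sum x {b, q} - (if s = y then x t else 0))"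
        using b q s nU irr by (intro sumz) (auto simp: z_def)
      finally show ?thesis using 2 zs b qU ne q by (simp add: z_def)
    next
      case 3
      have "E' `` {b} = insert t (E `` {b} - {s} - {t})"
        using t q b ne tn unfolding E'_def by auto
      then have "nsum E' z b = z t + sum z (E `` {b} - {s} - {t})"
        using finN by (simp add: sum.insert_remove)
      also have "sum z (E `` {b} - {s} - {t}) = 1 * (r * x b - sum x {s} - (if b = y then x t else 0))"
        using arcs av t(2) bU side_step_back[of _ q s b] ne
        by (intro sumz) (auto simp: z_def)
      finally show ?thesis using 3 z_t_le b ne bU by (simp add: z_def)
    next
      case 4
      have "E' `` {q} = {s, t} \<union> (E `` {q} - {s} - {t})"
        using t q b ne tn arcs unfolding E'_def by auto
      then have "nsum E' z q = z s + z t + sum z (E `` {q} - {s} - {t})"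
        using finN t(2) by (subst \<open>E' `` {q} = _\<close>, subst sum.union_disjoint) auto
      also have "sum z (E `` {q} - {s} - {t}) = 2 * (r * x q - sum x {s} - (if q = y then x t else 0))"
        using arcs av t(2) side_step[OF qU] by (intro sumz) (auto simp: z_def)
      finally have "nsum E' z q = z s + z t + 2 * (r * x q - x s - (if q = y then x t else 0))"
        by simp
      \<comment> \<open>After multiplication by \<open>r\<close> the left side is
        \<open>r * x s + 3 * x q\<close>, and three times the lightest neighbour of \<open>s\<close>
        is at most \<open>r * x s\<close>.\<close>
      moreover have "z s + z t \<le> 2 * x s"
      proof -
        have "r * (z s + z t) \<le> r * (2 * x s)"
          unfolding distrib_left zt zs using sum3 xa by linarith
        then show ?thesis using rpos by simp
      qed
      moreover have "z q = 2 * x q" using q ne qU by (simp add: z_def)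
      ultimately show ?thesis using 4 xq by (auto simp: algebra_simps)
    next
      case 5
      have vU: "v \<notin> ?U" using nU 5 Esym by blast
      have "E' `` {v} = insert s (E `` {v} - {s} - {t})"
        using 5 tn t unfolding E'_def by auto
      then have "nsum E' z v = z s + sum z (E `` {v} - {s} - {t})"
        using finN by simp
      also have "sum z (E `` {v} - {s} - {t}) = 1 * (r * x v - sum x {s} - (if v = y then x t else 0))"
        using 5 v t(2) vU side_step_back[of _ q s v]
        by (intro sumz) (auto simp: z_def)
      finally show ?thesis using 5 z_s_le vU by (simp add: z_def)
    next
      case 6
      have "E' `` {v} = E `` {v} - {} - {t}"
        using 6 tn t unfolding E'_def by auto
      then have "nsum E' z v = sum z (E `` {v} - {} - {t})" by simp
      also have "sum z (E `` {v} - {} - {t}) = 2 * (r * x v - sum x {} - (if v = y then x t else 0))"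
        using 6 v side_step[of v q s] by (intro sumz) (auto simp: z_def)
      finally show ?thesis using 6 xq by (auto simp: z_def)
    next
      case 7
      have "E' `` {v} = E `` {v} - {} - {t}"
        using 7 tn t unfolding E'_def by auto
      then have "nsum E' z v = sum z (E `` {v} - {} - {t})" by simp
      also have "sum z (E `` {v} - {} - {t}) = 1 * (r * x v - sum x {} - (if v = y then x t else 0))"
        using 7 v side_step_back[of _ q s v] by (intro sumz) (auto simp: z_def)
      finally show ?thesis using 7 by (simp add: z_def)
    qed
  qed
  have "nsum E' z v \<le> r * z v" if "v \<in> V" for v
    using row[OF that] xq by (auto split: if_splits)
  moreover have "nsum E' z y < r * z y" using row[OF av(2)] xq by simp
  ultimately have "adj_spectral_radius (mk_graph V E') < r"
    using spectral_radius_less_supersolution[OF G C, of z r y] zpos av by blast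
  then show ?thesis using G C by blast
qed

abbreviation Q :: "'a \<Rightarrow> 'a \<Rightarrow> real" where
  "Q u v \<equiv> (x u)\<^sup>2 + (x v)\<^sup>2 - r * x u * x v"

text \<open>
  The sign of \<open>Q u v\<close> decides whether subdividing \<open>u v\<close> can be compensated by rescaling one side,
  and \<open>Q\<close> is constant along a path through vertices of degree 2.
\<close>

lemma branch_beyond_edge:
  assumes "(u, v) \<in> E" "w \<in> side E u v" "deg E w \<ge> 3"
  shows "(r < 2 \<longrightarrow> x v < x u) \<and> (r \<ge> 2 \<longrightarrow> Q u v \<le> 0 \<or> x v < x u)"
  using assms
proof (induction "card (side E u v)" arbitrary: u v rule: less_induct)
  case less
  have uV: "u \<in> V" "v \<in> V" using less inV by blast+
  have xp: "x u > 0" "x v > 0" using pos uV by auto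
  show ?case
  proof (cases "deg E u \<ge> 3")
    case True
    have "2 \<le> card (E `` {u} - {v})" using True less(2) by (simp add: card_Diff_singleton)
    then obtain a b where ab: "a \<noteq> b" "{a, b} \<subseteq> E `` {u} - {v}"
      by (metis card_2_iff obtain_subset_with_card_n)
    have s: "x a + x b + x v \<le> r * x u"
      using nsum_ge[of "{a, b, v}" u] ab less(2) uV by auto
    \<comment> \<open>Each neighbour of \<open>u\<close> has \<open>u\<close> among its own
      neighbours, which bounds its weight from below; two such neighbours limit what is left for
      \<open>v\<close>.\<close>
    have "x u / r \<le> x a" "x u / r \<le> x b"
      using nbr_le[of a u] nbr_le[of b u] ab Esym rpos by (auto simp: field_simps)
    then have "2 * (x u / r) \<le> x a + x b" by linarith
    then have h: "x v \<le> (r - 2 / r) * x u" using s by (simp add: left_diff_distrib)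
    have 1: "x v < x u" if "r < 2"
    proof -
      have "r * r < 2 * r" using that rpos by simp
      then have "r * (r - 1) < 2" using that by (auto simp: algebra_simps)
      then have "r - 2 / r < 1" using rpos by (simp add: field_simps)
      then have "(r - 2 / r) * x u < 1 * x u" using xp by (intro mult_strict_right_mono)
      then show ?thesis using h by simp
    qed
    have 2: "Q u v \<le> 0 \<or> x v < x u" if r2: "r \<ge> 2"
    proof (rule disjCI)
      assume "\<not> x v < x u"
      then have ge: "x u \<le> x v" by simp
      \<comment> \<open>\<open>Q u v\<close> is convex in \<open>x v\<close>, so it suffices to look at the ends of its range.\<close>
      define t where "t = r - 2 / r"
      have t1: "t \<ge> 1"
      proof -
        have "(r - 2) * (r + 1) \<ge> 0" using r2 by simp
        then show ?thesis unfolding t_def using rpos by (simp add: field_simps)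
      qed
      have 1: "(x v - x u) * (x v - t * x u) \<le> 0"
        using ge h t_def by (intro mult_nonneg_nonpos) auto
      then have "(x v)\<^sup>2 \<le> (1 + t) * x u * x v - t * (x u)\<^sup>2"
        by (simp add: algebra_simps power2_eq_square)
      then have "Q u v \<le> (1 + t - r) * (x u * x v) - (t - 1) * (x u)\<^sup>2"
        by (simp add: algebra_simps power2_eq_square)
      also have "\<dots> = (1 - 2 / r) * (x u * x v) - (t - 1) * (x u)\<^sup>2" by (simp add: t_def)
      also have "\<dots> \<le> (1 - 2 / r) * (x u * (t * x u)) - (t - 1) * (x u)\<^sup>2"
      proof -
        have "1 - 2 / r \<ge> 0" using r2 by (simp add: field_simps)
        then have "(1 - 2 / r) * (x u * x v) \<le> (1 - 2 / r) * (x u * (t * x u))"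
          using h xp by (intro mult_left_mono) (auto simp: t_def)
        then show ?thesis by simp
      qed
      also have "\<dots> = (1 - 2 / r * t) * (x u)\<^sup>2" by (simp add: algebra_simps power2_eq_square)
      also have "\<dots> \<le> 0"
      proof -
        have "4 \<le> r * r" using r2 mult_mono[of 2 r 2 r] by simp
        then have "1 - 2 / r * t \<le> 0" unfolding t_def using rpos by (simp add: field_simps)
        then show ?thesis by (simp add: mult_nonpos_nonneg)
      qed
      finally show "Q u v \<le> 0" .
    qed
    show ?thesis using 1 2 by blast
  next
    case False
    then have "w \<noteq> u" using less by auto
    then obtain u' where u': "(u, u') \<in> E" "u' \<noteq> v" "w \<in> side E u' u"
      using side_decomp less by metis
    note IH = less(1)[OF card_side_less[OF less(2) u'(1,2)] Esym[OF u'(1)] u'(3) less(4)]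
    have "card {u', v} \<le> deg E u" using u' less(2) finN by (intro card_mono) auto
    then have "deg E u = card {u', v}" using False u' by simp
    then have N: "{u', v} = E `` {u}"
      using card_subset_eq[OF finN, of "{u', v}" u] u' less(2) by auto
    \<comment> \<open>The row at a vertex of degree 2 rewrites both \<open>Q u v\<close> and
      \<open>Q u' u\<close> to \<open>(x u)\<^sup>2 - x u' * x v\<close>; this is the invariance of
      \<open>Q\<close>.\<close>
    have eq: "x u' + x v = r * x u" using eig[OF uV(1)] u'(2) unfolding N[symmetric] by simp
    have u'p: "x u' > 0" using pos inV u' by blast
    have Q1: "Q u v = (x u)\<^sup>2 - x u' * x v"
    proof -
      have "r * x u * x v = (x u' + x v) * x v" using eq by simp
      then show ?thesis by (simp add: algebra_simps power2_eq_square)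
    qed
    have Q2: "Q u' u = (x u)\<^sup>2 - x u' * x v"
    proof -
      have "r * x u' * x u = x u' * (x u' + x v)" using eq by (simp add: mult_ac)
      then show ?thesis by (simp add: algebra_simps power2_eq_square)
    qed
    \<comment> \<open>For \<open>r < 2\<close> the weights are strictly concave along the path: once
      they fall on the way from the branch vertex, they go on falling.\<close>
    have "x v < x u" if "r < 2"
    proof -
      have "r * x u < 2 * x u" using that xp by simp
      then show ?thesis using IH that eq by linarith
    qed
    moreover have "Q u v \<le> 0 \<or> x v < x u" if "x u < x u'"
    proof (rule disjCI)
      assume "\<not> x v < x u"
      then have "x u * x u \<le> x u' * x v" using that xp by (intro mult_mono) auto
      then show "Q u v \<le> 0" using Q1 by (simp add: power2_eq_square)
    qed
    ultimately show ?thesis using IH Q1 Q2 by auto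
  qed
qed

text \<open>Seen from its two ends, an edge between branch vertices would have to satisfy both
  \<open>x v < x u\<close> and \<open>x u < x v\<close> unless \<open>Q u v\<close> is nonpositive;
  for \<open>r < 2\<close> the situation cannot arise at all.\<close>

lemma internal_edge:
  assumes uv: "(u, v) \<in> E" and w: "w \<in> side E u v" "deg E w \<ge> 3" and w': "w' \<in> side E v u" "deg E w' \<ge> 3"
  shows "Q u v \<le> 0"
proof -
  note 1 = branch_beyond_edge[OF uv w] and 2 = branch_beyond_edge[OF Esym[OF uv] w']
  have "Q v u = Q u v" by (simp add: mult_ac)
  then show ?thesis using 1 2 by linarith
qed

text \<open>The new vertex \<open>t\<close> gets weight \<open>x u\<close>, so the row of
  \<open>v\<close> sees what it saw before. The side of \<open>u\<close> is multiplied by the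
  \<open>c\<close> with \<open>c * x u + x v = r * x u\<close>, which makes the row of
  \<open>t\<close> an equality. The row of \<open>u\<close> then asks for
  \<open>x u \<le> c * x v\<close>, and this is the inequality \<open>Q u v \<le> 0\<close>.\<close>

lemma subdivide_reduces:
  assumes uv: "(u, v) \<in> E" and Q: "Q u v \<le> 0" and t: "E `` {t} = {y}" "t \<noteq> u" "t \<noteq> v"
    and E'_def: "E' = (E - {(t, y), (y, t), (u, v), (v, u)}) \<union> {(u, t), (t, u), (t, v), (v, t)}"
  shows "simple_graph V E' \<and> conn V E' \<and> adj_spectral_radius (mk_graph V E') < r"
proof -
  have arcs: "(t, y) \<in> E" "(y, t) \<in> E" "(v, u) \<in> E" using t uv Esym by blast+
  have av: "t \<in> V" "y \<in> V" "u \<in> V" "v \<in> V" using arcs inV by blast+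
  have ne: "t \<noteq> y" "u \<noteq> v" using arcs irr by blast+
  have tn: "(v, t) \<in> E \<longleftrightarrow> v = y" "(t, v) \<in> E \<longleftrightarrow> v = y" for v using t arcs Esym by blast+
  have G: "simple_graph V E'"
    unfolding E'_def using av t
    by (intro simple_graph_replace[OF graph]) (auto simp: sym_def irrefl_def)
  have C: "conn V E'"
  proof (rule conn_reroute[OF con symE EV, where D = "{t}" and w = y and r = u])
    show sym': "sym E'" using G by (simp add: simple_graph_def)
    show "w = y" if "d \<in> {t}" "w \<notin> {t}" "(d, w) \<in> E" for d w using that t by auto
    have "(u, t) \<in> E'" "(t, v) \<in> E'" unfolding E'_def by auto
    then have 1: "(u, t) \<in> E'\<^sup>*" "(u, v) \<in> E'\<^sup>*"
      by (meson r_into_rtrancl rtrancl_into_rtrancl)+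
    then show "(u, d) \<in> E'\<^sup>*" if "d \<in> {t}" for d using that by simp
    have 2: "(v, u) \<in> E'\<^sup>*" using 1(2) sym' by (meson sym_rtrancl symD)
    show "(a, b) \<in> E'\<^sup>*" if "a \<notin> {t}" "b \<notin> {t}" "(a, b) \<in> E" for a b
    proof (cases "(a, b) \<in> E'")
      case False
      then have "(a, b) \<in> {(u, v), (v, u)}" using that unfolding E'_def by auto
      then show ?thesis using 1 2 by auto
    qed auto
  qed (use av t in auto)
  let ?U = "side E u v"
  have vU: "v \<notin> ?U" using side_not[OF uv] .
  have uU: "u \<in> ?U" by (rule side_self)
  have xp: "x u > 0" "x v > 0" "x t > 0" using pos av by auto
  define c where "c = r - x v / x u"
  have cx: "c * x u = r * x u - x v" using xp by (simp add: c_def field_simps)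
  have ratio: "x v * (r * x u - x v) \<ge> (x u)\<^sup>2"
    using Q by (simp add: algebra_simps power2_eq_square)
  have cpos: "c > 0"
  proof -
    have "0 < x v * (r * x u - x v)" using ratio xp by (simp add: less_le_trans[of 0 "(x u)\<^sup>2"])
    then have "0 < c * x u" using cx xp by (simp add: zero_less_mult_iff)
    then show ?thesis using xp by (simp add: zero_less_mult_iff)
  qed
  have cv: "x u \<le> c * x v"
  proof -
    have "(c * x v) * x u = x v * (r * x u - x v)" unfolding cx[symmetric] by (simp add: mult_ac)
    then have "x u * x u \<le> (c * x v) * x u" using ratio unfolding power2_eq_square by linarith
    then show ?thesis using xp by simp
  qed
  \<comment> \<open>The old neighbour \<open>y\<close> of \<open>t\<close> may lie on the scaled or
    on the unscaled side; \<open>m\<close> is a factor by which its loss is bounded below in both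
    cases.\<close>
  define m where "m = min c 1"
  have m: "m \<le> c" "m \<le> 1" "m > 0" using cpos by (auto simp: m_def)
  define z where "z = (\<lambda>w. if w = t then x u else if w \<in> ?U then c * x w else x w)"
  have zpos: "z w > 0" if "w \<in> V" for w using pos[OF that] cpos xp by (simp add: z_def)
  have sumz: "sum z (E `` {w} - B - {t}) = k * (r * x w - sum x B - (if w = y then x t else 0))"
    if "w \<in> V" "B \<subseteq> E `` {w}" "t \<notin> B" "\<And>a. (w, a) \<in> E \<Longrightarrow> a \<notin> B \<Longrightarrow> a \<noteq> t \<Longrightarrow> z a = k * x a" for w B k
  proof -
    have "sum z (E `` {w} - B - {t}) = (\<Sum>a\<in>E `` {w} - B - {t}. k * x a)"
      using that by (intro sum.cong) auto
    also have "\<dots> = k * sum x (E `` {w} - B - {t})" by (rule sum_distrib_left[symmetric])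
    finally show ?thesis using nbr_sum_diff_leaf[OF t(1) that(2,3,1)] by simp
  qed
  have row: "nsum E' z w \<le> r * z w - (if w = y then m * x t else 0)" if w: "w \<in> V" for w
  proof -
    consider "w = t" | "w = u" | "w = v" | "w \<notin> {t, u, v}" "w \<in> ?U" | "w \<notin> {t, u, v}" "w \<notin> ?U" by blast
    then show ?thesis
    proof cases
      case 1
      have "E' `` {t} = {u, v}" using t ne tn unfolding E'_def by auto
      then have "nsum E' z t = r * x u" using t vU uU ne cx by (simp add: z_def)
      then show ?thesis using 1 ne by (simp add: z_def)
    next
      case 2
      have "E' `` {u} = insert t (E `` {u} - {v} - {t})" using t ne tn unfolding E'_def by auto
      then have "nsum E' z u = x u + sum z (E `` {u} - {v} - {t})"
        using finN by (simp add: sum.insert_remove) (simp add: z_def)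
      also have "sum z (E `` {u} - {v} - {t}) = c * (r * x u - sum x {v} - (if u = y then x t else 0))"
        using uv av t side_step[OF uU] by (intro sumz) (auto simp: z_def)
      finally have "nsum E' z u \<le> c * (r * x u) - (if u = y then c * x t else 0)"
        using cv by (cases "u = y") (simp_all add: algebra_simps)
      moreover have "m * x t \<le> c * x t" using xp m by (intro mult_right_mono) auto
      moreover have "z u = c * x u" using t uU by (simp add: z_def)
      ultimately show ?thesis using 2 by (cases "u = y") (simp_all add: mult.left_commute[of r c])
    next
      case 3
      have "E' `` {v} = insert t (E `` {v} - {u} - {t})" using t ne tn unfolding E'_def by auto
      then have "nsum E' z v = x u + sum z (E `` {v} - {u} - {t})"
        using finN by (simp add: sum.insert_remove) (simp add: z_def)
      also have "sum z (E `` {v} - {u} - {t}) = 1 * (r * x v - sum x {u} - (if v = y then x t else 0))"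
        using arcs av t side_step_back[of _ u v v] vU by (intro sumz) (auto simp: z_def)
      finally have "nsum E' z v = r * x v - (if v = y then x t else 0)" by simp
      moreover have "m * x t \<le> 1 * x t" using xp m by (intro mult_right_mono) auto
      ultimately show ?thesis using 3 t vU by (auto simp: z_def)
    next
      case 4
      have "E' `` {w} = E `` {w} - {} - {t}" using 4 tn t unfolding E'_def by auto
      then have "nsum E' z w = sum z (E `` {w} - {} - {t})" by simp
      also have "\<dots> = c * (r * x w - sum x {} - (if w = y then x t else 0))"
        using 4 w side_step[of w u v] by (intro sumz) (auto simp: z_def)
      finally have "nsum E' z w = c * (r * x w) - (if w = y then c * x t else 0)"
        by (cases "w = y") (simp_all add: algebra_simps)
      moreover have "m * x t \<le> c * x t" using xp m by (intro mult_right_mono) auto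
      moreover have "z w = c * x w" using 4 by (simp add: z_def)
      ultimately show ?thesis by (cases "w = y") (simp_all add: mult.left_commute[of r c])
    next
      case 5
      have "E' `` {w} = E `` {w} - {} - {t}" using 5 tn t unfolding E'_def by auto
      then have "nsum E' z w = sum z (E `` {w} - {} - {t})" by simp
      also have "\<dots> = 1 * (r * x w - sum x {} - (if w = y then x t else 0))"
        using 5 w side_step_back[of _ u v w] by (intro sumz) (auto simp: z_def)
      finally have "nsum E' z w = r * x w - (if w = y then x t else 0)" by simp
      moreover have "m * x t \<le> 1 * x t" using xp m by (intro mult_right_mono) auto
      ultimately show ?thesis using 5 by (auto simp: z_def)
    qed
  qed
  have mp: "m * x t > 0" using m xp by simp
  have "nsum E' z w \<le> r * z w" if "w \<in> V" for w
    using row[OF that] mp by (auto split: if_splits)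
  moreover have "nsum E' z y < r * z y" using row[OF av(2)] mp by simp
  ultimately have "adj_spectral_radius (mk_graph V E') < r"
    using spectral_radius_less_supersolution[OF G C, of z r y] zpos av by blast
  then show ?thesis using G C by blast
qed

text \<open>The path becomes \<open>u\<close>, \<open>a\<close>, \<open>b\<close>, \<open>v\<close>.
  With the side of \<open>u\<close> multiplied by \<open>c\<close>, the weights
  \<open>c * x v\<close> at \<open>a\<close> and \<open>x u\<close> at \<open>b\<close> leave the
  rows of \<open>u\<close> and \<open>v\<close> in balance. The row of \<open>b\<close> is an
  equality for \<open>c = r * x u / x v - 1\<close>, and the row of \<open>a\<close> is then
  equivalent to \<open>Q u v \<le> 0\<close>.\<close>

lemma subdivide_twice_reduces:
  assumes uv: "(u, v) \<in> E" and Q: "Q u v \<le> 0"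
    and a: "E `` {a} = {b}" and b: "E `` {b} = {a, w}" and wa: "w \<noteq> a"
    and ne: "u \<notin> {a, b, w}" "v \<notin> {a, b, w}"
    and E'_def: "E' = (E - {(b, w), (w, b), (u, v), (v, u)}) \<union> {(u, a), (a, u), (b, v), (v, b)}"
  shows "simple_graph V E' \<and> conn V E' \<and> adj_spectral_radius (mk_graph V E') < r"
proof -
  have arcs: "(a, b) \<in> E" "(b, a) \<in> E" "(b, w) \<in> E" "(w, b) \<in> E" "(v, u) \<in> E"
    using a b uv Esym by blast+
  have av: "a \<in> V" "b \<in> V" "w \<in> V" "u \<in> V" "v \<in> V" using arcs inV by blast+
  have ne': "a \<noteq> b" "u \<noteq> v" "b \<noteq> w" using arcs irr by blast+
  have an: "(v, a) \<in> E \<longleftrightarrow> v = b" "(v, b) \<in> E \<longleftrightarrow> v = a \<or> v = w" for v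
    using a b Esym by blast+
  have G: "simple_graph V E'"
    unfolding E'_def using av ne
    by (intro simple_graph_replace[OF graph]) (auto simp: sym_def irrefl_def)
  have C: "conn V E'"
  proof (rule conn_reroute[OF con symE EV, where D = "{a, b}" and w = w and r = u])
    show sym': "sym E'" using G by (simp add: simple_graph_def)
    show "v' = w" if "d \<in> {a, b}" "v' \<notin> {a, b}" "(d, v') \<in> E" for d v' using that a b by auto
    have "(u, a) \<in> E'" "(a, b) \<in> E'" "(b, v) \<in> E'" unfolding E'_def using arcs ne ne' wa by auto
    then have 1: "(u, a) \<in> E'\<^sup>*" "(u, b) \<in> E'\<^sup>*" "(u, v) \<in> E'\<^sup>*"
      by (meson r_into_rtrancl rtrancl_into_rtrancl)+
    then show "(u, d) \<in> E'\<^sup>*" if "d \<in> {a, b}" for d using that by auto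
    have 2: "(v, u) \<in> E'\<^sup>*" using 1(3) sym' by (meson sym_rtrancl symD)
    show "(c, d) \<in> E'\<^sup>*" if "c \<notin> {a, b}" "d \<notin> {a, b}" "(c, d) \<in> E" for c d
    proof (cases "(c, d) \<in> E'")
      case False
      then have "(c, d) \<in> {(u, v), (v, u)}" using that unfolding E'_def by auto
      then show ?thesis using 1 2 by auto
    qed auto
  qed (use av ne in auto)
  let ?U = "side E u v"
  have vU: "v \<notin> ?U" using side_not[OF uv] .
  have uU: "u \<in> ?U" by (rule side_self)
  have xp: "x u > 0" "x v > 0" "x b > 0" using pos av by auto
  define c where "c = r * x u / x v - 1"
  have cx: "c * x v = r * x u - x v" using xp by (simp add: c_def field_simps)
  have ratio: "x v * (r * x u - x v) \<ge> (x u)\<^sup>2"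
    using Q by (simp add: algebra_simps power2_eq_square)
  have cpos: "c > 0"
  proof -
    have "0 < x v * (r * x u - x v)" using ratio xp by (simp add: less_le_trans[of 0 "(x u)\<^sup>2"])
    then have "0 < c * x v" using cx xp by (simp add: zero_less_mult_iff)
    then show ?thesis using xp by (simp add: zero_less_mult_iff)
  qed
  have ca: "c * x u + x u \<le> r * (c * x v)"
  proof -
    have "(c * x u + x u) * x v = (c * x v + x v) * x u" by (simp add: algebra_simps)
    also have "\<dots> = r * (x u)\<^sup>2" using cx by (simp add: power2_eq_square)
    also have "\<dots> \<le> r * (x v * (r * x u - x v))" using ratio rpos by (intro mult_left_mono) auto
    also have "\<dots> = r * (c * x v) * x v" unfolding cx[symmetric] by (simp add: mult_ac)
    finally show ?thesis using xp by simp
  qed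
  define m where "m = min c 1"
  have m: "m \<le> c" "m \<le> 1" "m > 0" using cpos by (auto simp: m_def)
  define z where "z = (\<lambda>w. if w = a then c * x v else if w = b then x u else if w \<in> ?U then c * x w else x w)"
  have zpos: "z w > 0" if "w \<in> V" for w using pos[OF that] cpos xp by (simp add: z_def)
  have sumz: "sum z (E `` {w'} - B) = k * (r * x w' - sum x B)"
    if "w' \<in> V" "B \<subseteq> E `` {w'}" "\<And>d. (w', d) \<in> E \<Longrightarrow> d \<notin> B \<Longrightarrow> z d = k * x d" for w' B k
  proof -
    have "sum z (E `` {w'} - B) = (\<Sum>d\<in>E `` {w'} - B. k * x d)"
      using that by (intro sum.cong) auto
    also have "\<dots> = k * sum x (E `` {w'} - B)" by (rule sum_distrib_left[symmetric])
    finally show ?thesis using sum_diff[OF finN that(2), of x] eig[OF that(1)] by simp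
  qed
  have row: "nsum E' z w' \<le> r * z w' - (if w' = w then m * x b else 0)" if w': "w' \<in> V" for w'
  proof -
    consider "w' = a" | "w' = b" | "w' = u" | "w' = v" | "w' = w" "w \<in> ?U" | "w' = w" "w \<notin> ?U" |
      "w' \<notin> {a, b, u, v, w}" "w' \<in> ?U" | "w' \<notin> {a, b, u, v, w}" "w' \<notin> ?U" by blast
    then show ?thesis
    proof cases
      case 1
      have "E' `` {a} = {b, u}" using a ne ne' wa unfolding E'_def by auto
      moreover have "b \<noteq> u" "u \<noteq> a" "b \<noteq> a" using ne ne' by auto
      ultimately have "nsum E' z a = x u + c * x u" using uU by (simp add: z_def)
      then show ?thesis using 1 wa ca by (simp add: z_def)
    next
      case 2
      have "E' `` {b} = {a, v}" using b ne ne' wa unfolding E'_def by auto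
      moreover have "a \<noteq> v" "v \<noteq> b" "v \<noteq> a" using ne ne' by auto
      ultimately have "nsum E' z b = c * x v + x v" using vU by (simp add: z_def)
      then show ?thesis using 2 ne' cx by (simp add: z_def)
    next
      case 3
      have n: "(u, a) \<notin> E" "(u, b) \<notin> E" using an ne by auto
      have "E' `` {u} = insert a (E `` {u} - {v})" using ne ne' unfolding E'_def by auto
      then have "nsum E' z u = c * x v + sum z (E `` {u} - {v})" using finN n by (simp add: z_def)
      also have "sum z (E `` {u} - {v}) = c * (r * x u - sum x {v})"
        using uv av n side_step[OF uU] by (intro sumz) (auto simp: z_def)
      finally show ?thesis using 3 ne uU by (auto simp: z_def algebra_simps)
    next
      case 4
      have n: "(v, a) \<notin> E" "(v, b) \<notin> E" using an ne by auto
      have "E' `` {v} = insert b (E `` {v} - {u})" using ne ne' unfolding E'_def by auto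
      then have "nsum E' z v = x u + sum z (E `` {v} - {u})" using finN n ne' by (simp add: z_def)
      also have "sum z (E `` {v} - {u}) = 1 * (r * x v - sum x {u})"
        using arcs av n side_step_back[of _ u v v] vU by (intro sumz) (auto simp: z_def)
      finally show ?thesis using 4 ne vU by (auto simp: z_def)
    next
      case 5
      have n: "(w, a) \<notin> E" using an ne' by auto
      have "E' `` {w} = E `` {w} - {b}" using ne ne' wa unfolding E'_def by auto
      then have "nsum E' z w = sum z (E `` {w} - {b})" by simp
      also have "\<dots> = c * (r * x w - sum x {b})"
        using arcs av n 5 ne side_step[of w u v] by (intro sumz) (auto simp: z_def)
      finally have "nsum E' z w = c * (r * x w) - c * x b" by (simp add: algebra_simps)
      moreover have "m * x b \<le> c * x b" using xp m by (intro mult_right_mono) auto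
      moreover have "z w = c * x w" using 5 wa ne' by (simp add: z_def)
      ultimately show ?thesis using 5 by (simp add: mult.left_commute[of r c])
    next
      case 6
      have n: "(w, a) \<notin> E" using an ne' by auto
      have "E' `` {w} = E `` {w} - {b}" using ne ne' wa unfolding E'_def by auto
      then have "nsum E' z w = sum z (E `` {w} - {b})" by simp
      also have "\<dots> = 1 * (r * x w - sum x {b})"
        using arcs av n 6 ne side_step_back[of _ u v w] by (intro sumz) (auto simp: z_def)
      finally have "nsum E' z w = r * x w - x b" by simp
      moreover have "m * x b \<le> 1 * x b" using xp m by (intro mult_right_mono) auto
      ultimately show ?thesis using 6 wa ne' by (auto simp: z_def)
    next
      case 7
      have n: "(w', a) \<notin> E" "(w', b) \<notin> E" using an 7 by auto
      have "E' `` {w'} = E `` {w'} - {}" using 7 unfolding E'_def by auto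
      then have "nsum E' z w' = sum z (E `` {w'} - {})" by simp
      also have "\<dots> = c * (r * x w' - sum x {})"
        using 7 w' n side_step[of w' u v] by (intro sumz) (auto simp: z_def)
      finally show ?thesis using 7 by (auto simp: z_def)
    next
      case 8
      have n: "(w', a) \<notin> E" "(w', b) \<notin> E" using an 8 by auto
      have "E' `` {w'} = E `` {w'} - {}" using 8 unfolding E'_def by auto
      then have "nsum E' z w' = sum z (E `` {w'} - {})" by simp
      also have "\<dots> = 1 * (r * x w' - sum x {})"
        using 8 w' n side_step_back[of _ u v w'] by (intro sumz) (auto simp: z_def)
      finally show ?thesis using 8 by (auto simp: z_def)
    qed
  qed
  have mp: "m * x b > 0" using m xp by simp
  have "nsum E' z w' \<le> r * z w'" if "w' \<in> V" for w'
    using row[OF that] mp by (auto split: if_splits)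
  moreover have "nsum E' z w < r * z w" using row[OF av(3)] mp by simp
  ultimately have "adj_spectral_radius (mk_graph V E') < r"
    using spectral_radius_less_supersolution[OF G C, of z r w] zpos av by blast
  then show ?thesis using G C by blast
qed

end

section \<open>Rooted trees and independent sets\<close>

definition indep :: "('a \<times> 'a) set \<Rightarrow> 'a set \<Rightarrow> bool" where
  "indep E S \<longleftrightarrow> (\<forall>u\<in>S. \<forall>v\<in>S. (u, v) \<notin> E)"

text \<open>\<open>dep\<close> is the distance to the root and \<open>par\<close> picks a neighbour
  one step closer. An edge that is not of the form v, \<open>par v\<close> would be avoided by all
  parent chains, so its ends would be joined through the root without it. Stated for bare relations
  because it is applied both to the whole tree and to the main tree.\<close>

lemma rooted_tree:
  assumes sym: "sym E" and con: "conn V E" and EV: "E \<subseteq> V \<times> V"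
    and bridge: "\<And>u v. (u, v) \<in> E \<Longrightarrow> (u, v) \<notin> (cut E u v)\<^sup>*" and r: "r \<in> V"
  shows "\<exists>par dep. dep r = (0::nat) \<and>
    (\<forall>v\<in>V. v \<noteq> r \<longrightarrow> (v, par v) \<in> E \<and> dep v = Suc (dep (par v))) \<and>
    (\<forall>(u, v)\<in>E. u \<noteq> r \<and> par u = v \<or> v \<noteq> r \<and> par v = u)"
proof -
  define dep where "dep = (\<lambda>v. LEAST m. (v, r) \<in> E ^^ m)"
  have ex: "\<exists>m. (v, r) \<in> E ^^ m" if "v \<in> V" for v
    using con that r by (auto simp: conn_def rtrancl_power)
  have least: "(v, r) \<in> E ^^ (dep v)" if "v \<in> V" for v
    unfolding dep_def using LeastI_ex[OF ex[OF that]] .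
  have le: "dep v \<le> m" if "(v, r) \<in> E ^^ m" for v m
    unfolding dep_def using that by (rule Least_le)
  have "\<exists>w. (v, w) \<in> E \<and> dep v = Suc (dep w)" if v: "v \<in> V" "v \<noteq> r" for v
  proof -
    obtain k where k: "dep v = Suc k" using least[OF v(1)] v(2) by (cases "dep v") auto
    then obtain w where w: "(v, w) \<in> E" "(w, r) \<in> E ^^ k"
      using least[OF v(1)] by (metis relpow_Suc_D2)
    then have "w \<in> V" using EV by auto
    then have "dep v \<le> Suc (dep w)" using least w by (intro le relpow_Suc_I2) auto
    then show ?thesis using w le[OF w(2)] k by auto
  qed
  then obtain par where par: "(v, par v) \<in> E \<and> dep v = Suc (dep (par v))" if "v \<in> V" "v \<noteq> r" for v
    by metis
  have "u \<noteq> r \<and> par u = v \<or> v \<noteq> r \<and> par v = u" if uv: "(u, v) \<in> E" for u v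
  proof (rule ccontr)
    assume neg: "\<not> ?thesis"
    have chain: "(w, r) \<in> (cut E u v)\<^sup>*" if "w \<in> V" for w
      using that
    proof (induction "dep w" arbitrary: w rule: less_induct)
      case less
      show ?case
      proof (cases "w = r")
        case False
        note p = par[OF less(2) False]
        then have "par w \<in> V" using EV by auto
        then have "(par w, r) \<in> (cut E u v)\<^sup>*" using less(1) p by auto
        moreover have "(w, par w) \<in> cut E u v" using p neg False by (auto simp: cut_def)
        ultimately show ?thesis by (rule converse_rtrancl_into_rtrancl[rotated])
      qed simp
    qed
    have "u \<in> V" "v \<in> V" using uv EV by auto
    then have "(u, r) \<in> (cut E u v)\<^sup>*" "(r, v) \<in> (cut E u v)\<^sup>*"
      using chain sym_cut[OF sym] by (blast, meson sym_rtrancl symD)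
    then show False using bridge[OF uv] by (meson rtrancl_trans)
  qed
  moreover have "dep r = 0" using le[of r 0] by simp
  ultimately show ?thesis using par by (intro exI[of _ par] exI[of _ dep]) auto
qed

section \<open>Edge counts and independent sets in trees\<close>

context perron_tree
begin

lemma rooted:
  assumes "r0 \<in> V"
  shows "\<exists>par dep. dep r0 = (0::nat) \<and>
    (\<forall>v\<in>V. v \<noteq> r0 \<longrightarrow> (v, par v) \<in> E \<and> dep v = Suc (dep (par v))) \<and>
    (\<forall>(u, v)\<in>E. u \<noteq> r0 \<and> par u = v \<or> v \<noteq> r0 \<and> par v = u)"
  by (rule rooted_tree[OF symE con EV _ assms]) (rule bridge)

text \<open>Every vertex other than the root contributes the arc to its parent and the reverse arc,
  and depth tells the two kinds apart.\<close>

lemma card_edges: "card E = 2 * (card V - 1)"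
proof -
  obtain r0 where r0: "r0 \<in> V" using card2 by fastforce
  obtain par and dep :: "'a \<Rightarrow> nat" where pd: "dep r0 = 0"
    "\<forall>v\<in>V. v \<noteq> r0 \<longrightarrow> (v, par v) \<in> E \<and> dep v = Suc (dep (par v))"
    "\<forall>(u, v)\<in>E. u \<noteq> r0 \<and> par u = v \<or> v \<noteq> r0 \<and> par v = u"
    using rooted[OF r0] by (elim exE conjE) (rule that)
  let ?W = "V - {r0}"
  have "E = (\<lambda>v. (v, par v)) ` ?W \<union> (\<lambda>v. (par v, v)) ` ?W" (is "E = ?A \<union> ?B")
  proof
    show "E \<subseteq> ?A \<union> ?B"
    proof (rule subrelI)
      fix u v assume uv: "(u, v) \<in> E"
      then have "u \<in> V" "v \<in> V" using inV by auto
      then show "(u, v) \<in> ?A \<union> ?B" using pd(3) uv by (fastforce simp: image_iff)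
    qed
    show "?A \<union> ?B \<subseteq> E" using pd(2) Esym by auto
  qed
  moreover have "?A \<inter> ?B = {}"
  proof (rule ccontr)
    assume "?A \<inter> ?B \<noteq> {}"
    then obtain v w where vw: "v \<in> ?W" "w \<in> ?W" "v = par w" "par v = w" by auto
    have "dep v = Suc (dep (par v))" "dep w = Suc (dep (par w))" using pd(2) vw(1,2) by blast+
    then have "dep v = Suc (dep w)" "dep w = Suc (dep v)" unfolding vw(4) vw(3)[symmetric] by auto
    then show False by simp
  qed
  moreover have "card ?A = card V - 1" "card ?B = card V - 1"
    using r0 fin by (auto simp: card_image inj_on_def)
  moreover have "finite ?A" "finite ?B" using fin by auto
  ultimately show ?thesis by (simp add: card_Un_disjoint)
qed

lemma sum_deg: "A \<subseteq> V \<Longrightarrow> (\<Sum>v\<in>A. deg E v) = card (E \<inter> A \<times> UNIV)"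
proof -
  assume "A \<subseteq> V"
  then have "(\<Sum>v\<in>A. deg E v) = card (SIGMA v:A. E `` {v})"
    using fin finN by (intro card_SigmaI[symmetric]) (auto intro: finite_subset)
  also have "(SIGMA v:A. E `` {v}) = E \<inter> A \<times> UNIV" by auto
  finally show ?thesis .
qed

text \<open>Arcs leaving \<open>S\<close>, arcs entering \<open>S\<close> and arcs avoiding
  \<open>S\<close> partition \<open>E\<close>. The last kind is what has to be eliminated to make
  the complement of \<open>S\<close> independent.\<close>

lemma sum_deg_indep:
  assumes S: "S \<subseteq> V" "indep E S"
  shows "2 * (\<Sum>v\<in>S. deg E v) + card (E \<inter> (V - S) \<times> (V - S)) = 2 * (card V - 1)"
proof -
  let ?A = "E \<inter> S \<times> UNIV" and ?K = "E \<inter> (V - S) \<times> (V - S)"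
  have "E = (?A \<union> ?A\<inverse>) \<union> ?K" using EV Esym by auto
  moreover have "(?A \<union> ?A\<inverse>) \<inter> ?K = {}" by auto
  moreover have "?A \<inter> ?A\<inverse> = {}" using S(2) by (auto simp: indep_def)
  moreover have "finite ?A" "finite (?A\<inverse>)" "finite ?K" using finE by auto
  ultimately have "card E = card ?A + card (?A\<inverse>) + card ?K"
    by (metis card_Un_disjoint finite_Un)
  then show ?thesis using sum_deg[OF S(1)] card_edges by simp
qed

text \<open>Degrees of at least 2 throughout \<open>S\<close> would sum to at least the number of
  vertices, one more than the number of edges.\<close>

lemma indep_leaf:
  assumes S: "S \<subseteq> V" "indep E S" "card V \<le> 2 * card S"
  obtains t where "t \<in> S" "deg E t = 1"
proof (rule ccontr)
  assume "\<not> thesis"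
  then have "deg E t \<noteq> 1" if "t \<in> S" for t using that \<open>\<And>t. t \<in> S \<Longrightarrow> deg E t = 1 \<Longrightarrow> thesis\<close> by blast
  moreover have "deg E t \<ge> 1" if "t \<in> S" for t using that S(1) deg_pos by blast
  ultimately have "2 \<le> deg E t" if "t \<in> S" for t using that by (metis One_nat_def Suc_1 Suc_leI le_neq_implies_less)
  then have "(\<Sum>v\<in>S. 2) \<le> (\<Sum>v\<in>S. deg E v)" by (intro sum_mono)
  then have "2 * card S \<le> (\<Sum>v\<in>S. deg E v)" by simp
  then show False using sum_deg_indep[OF S(1,2)] S(3) card2 by linarith
qed

lemma side_eq_singleton:
  assumes "E `` {u} \<subseteq> {v}"
  shows "side E u v = {u}"
proof -
  have "a = u" if "a \<in> side E u v" for a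
  proof (rule ccontr)
    assume ne: "a \<noteq> u"
    obtain u' where "(u, u') \<in> E" "u' \<noteq> v" "a \<in> side E u' u"
      by (rule side_decomp[OF \<open>a \<in> side E u v\<close> ne])
    then show False using assms by auto
  qed
  then show ?thesis using side_self[of u v] by auto
qed

lemma side_eq_insert:
  assumes "(u, v) \<in> E" "E `` {u} = {u', v}" "u' \<noteq> v"
  shows "side E u v = insert u (side E u' u)"
proof
  show "side E u v \<subseteq> insert u (side E u' u)"
  proof
    fix a assume a: "a \<in> side E u v"
    show "a \<in> insert u (side E u' u)"
    proof (cases "a = u")
      case False
      obtain w where "(u, w) \<in> E" "w \<noteq> v" "a \<in> side E w u"
        by (rule side_decomp[OF a False])
      moreover from this have "w = u'" using assms(2) by auto
      ultimately show ?thesis by simp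
    qed simp
  qed
  have "(u, u') \<in> E" using assms(2) by auto
  then show "insert u (side E u' u) \<subseteq> side E u v"
    using side_psubset[OF assms(1) _ assms(3)] side_self by auto
qed

text \<open>The side is a path starting at \<open>u\<close>, and \<open>W\<close> takes every second
  vertex from \<open>u\<close> on. Two consecutive vertices hold at most one element of an
  independent set, so no independent set does better than \<open>W\<close> there; moreover
  \<open>W\<close> meets every edge of the path. The induction advances by two vertices.\<close>

lemma alternating_side:
  assumes "(u, v) \<in> E" "\<And>w. w \<in> side E u v \<Longrightarrow> deg E w \<le> 2"
  shows "\<exists>W. W \<subseteq> side E u v \<and> u \<in> W \<and> indep E W \<and>
    (\<forall>a\<in>side E u v. \<forall>b\<in>side E u v. (a, b) \<in> E \<longrightarrow> a \<in> W \<or> b \<in> W) \<and>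
    (\<forall>S\<subseteq>V. indep E S \<longrightarrow> card (S \<inter> side E u v) \<le> card W)"
  using assms
proof (induction "card (side E u v)" arbitrary: u v rule: less_induct)
  case less
  have uV: "u \<in> V" using less inV by blast
  have two: "E `` {a} = {b, c}" if "(a, b) \<in> E" "(a, c) \<in> E" "b \<noteq> c" "deg E a \<le> 2" for a b c
    using that card_seteq[OF finN, of "{b, c}" a] by auto
  show ?case
  proof (cases "\<exists>u'. (u, u') \<in> E \<and> u' \<noteq> v")
    case False
    then have "side E u v = {u}" by (intro side_eq_singleton) auto
    moreover have "card (S \<inter> {u}) \<le> 1" for S using card_mono[of "{u}" "S \<inter> {u}"] by simp
    ultimately show ?thesis using irr by (intro exI[of _ "{u}"]) (auto simp: indep_def)
  next
    case True
    then obtain u' where u': "(u, u') \<in> E" "u' \<noteq> v" by blast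
    have Nu: "E `` {u} = {u', v}" using two[OF u'(1) less(2) u'(2)] less(3)[OF side_self] .
    have sub1: "side E u' u \<subset> side E u v" using side_psubset[OF less(2) u'] .
    have s1: "side E u v = insert u (side E u' u)" using side_eq_insert[OF less(2) Nu u'(2)] .
    have cardS: "card (S \<inter> {u, u'}) \<le> 1" if "indep E S" for S
    proof -
      have "S \<inter> {u, u'} \<subseteq> {u} \<or> S \<inter> {u, u'} \<subseteq> {u'}" using that u' by (auto simp: indep_def)
      then show ?thesis using card_mono[of "{u}" "S \<inter> {u, u'}"] card_mono[of "{u'}" "S \<inter> {u, u'}"] by auto
    qed
    show ?thesis
    proof (cases "\<exists>w. (u', w) \<in> E \<and> w \<noteq> u")
      case False
      then have "side E u' u = {u'}" by (intro side_eq_singleton) auto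
      then have s: "side E u v = {u, u'}" using s1 by simp
      show ?thesis unfolding s using irr cardS
        by (intro exI[of _ "{u}"]) (auto simp: indep_def)
    next
      case True
      then obtain w where w: "(u', w) \<in> E" "w \<noteq> u" by blast
      have Nu': "E `` {u'} = {w, u}"
        using two[OF w(1) Esym[OF u'(1)] w(2)] less(3)[of u'] sub1 side_self by blast
      have sub2: "side E w u' \<subset> side E u' u" using side_psubset[OF Esym[OF u'(1)] w] .
      have s2: "side E u' u = insert u' (side E w u')"
        using side_eq_insert[OF Esym[OF u'(1)] Nu' w(2)] .
      have "card (side E w u') < card (side E u v)"
        using sub1 sub2 side_subset[OF uV] fin by (meson finite_subset psubset_card_mono psubset_trans)
      moreover have "deg E a \<le> 2" if "a \<in> side E w u'" for a using less(3) that sub1 sub2 by blast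
      ultimately have "\<exists>W. W \<subseteq> side E w u' \<and> w \<in> W \<and> indep E W \<and>
          (\<forall>a\<in>side E w u'. \<forall>b\<in>side E w u'. (a, b) \<in> E \<longrightarrow> a \<in> W \<or> b \<in> W) \<and>
          (\<forall>S\<subseteq>V. indep E S \<longrightarrow> card (S \<inter> side E w u') \<le> card W)"
        using Esym[OF w(1)] by (intro less(1))
      then obtain W where W: "W \<subseteq> side E w u'" "w \<in> W" "indep E W"
        "\<forall>a\<in>side E w u'. \<forall>b\<in>side E w u'. (a, b) \<in> E \<longrightarrow> a \<in> W \<or> b \<in> W"
        "\<forall>S\<subseteq>V. indep E S \<longrightarrow> card (S \<inter> side E w u') \<le> card W"
        by (elim exE conjE) (rule that)
      have nu: "u \<notin> side E u' u" "v \<notin> side E u v" "u' \<notin> side E w u'"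
        using side_not Esym u' less(2) w by blast+
      have nW: "u \<notin> W" "u' \<notin> W" "v \<notin> W" using nu W(1) sub1 sub2 by blast+
      have finW: "finite W" using W(1) sub1 sub2 side_subset[OF uV] fin by (meson finite_subset psubset_imp_subset)
      have "(u, a) \<notin> E \<and> (a, u) \<notin> E" if "a \<in> W" for a
        using Nu nW that Esym[of a u] by auto
      then have "indep E (insert u W)" using W(3) irr by (simp add: indep_def)
      moreover have "a \<in> insert u W \<or> b \<in> insert u W"
        if "a \<in> side E u v" "b \<in> side E u v" "(a, b) \<in> E" for a b
      proof -
        have "a = u \<or> a = u' \<or> a \<in> side E w u'" "b = u \<or> b = u' \<or> b \<in> side E w u'"
          using that s1 s2 by auto
        moreover have "b \<in> {w, u}" if "a = u'" using Nu' that \<open>(a, b) \<in> E\<close> by auto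
        moreover have "a \<in> {w, u}" if "b = u'" using Nu' that Esym[OF \<open>(a, b) \<in> E\<close>] by auto
        ultimately show ?thesis using W(2,4) that(3) by blast
      qed
      moreover have "card (S \<inter> side E u v) \<le> card (insert u W)" if S: "S \<subseteq> V" "indep E S" for S
      proof -
        have "S \<inter> side E u v = (S \<inter> {u, u'}) \<union> (S \<inter> side E w u')" using s1 s2 by auto
        then have "card (S \<inter> side E u v) \<le> card (S \<inter> {u, u'}) + card (S \<inter> side E w u')"
          by (metis card_Un_le)
        also have "\<dots> \<le> 1 + card W" using cardS[OF S(2)] W(5)[rule_format, OF S] by linarith
        finally show ?thesis using nW finW by simp
      qed
      moreover have "insert u W \<subseteq> side E u v" using W(1) sub1 sub2 side_self by blast
      ultimately show ?thesis by (intro exI[of _ "insert u W"]) blast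
    qed
  qed
qed

end

section \<open>Extremal graphs\<close>

text \<open>Minimality over all connected graphs with an independent set of size \<^emph>\<open>at least\<close> \<open>\<alpha>\<close>:
  this larger class makes it easy to recognise competitors.\<close>

locale extremal =
  fixes V :: "'a set" and E :: "('a \<times> 'a) set" and \<alpha> :: nat
  assumes graph: "simple_graph V E" and con: "conn V E" and card2: "card V \<ge> 2"
    and large: "card V \<le> 2 * \<alpha>"
    and ex_indep: "\<exists>S\<subseteq>V. indep E S \<and> \<alpha> \<le> card S"
    and minimal: "simple_graph V E' \<Longrightarrow> conn V E' \<Longrightarrow> S \<subseteq> V \<Longrightarrow> indep E' S \<Longrightarrow> \<alpha> \<le> card S \<Longrightarrow>
      adj_spectral_radius (mk_graph V E) \<le> adj_spectral_radius (mk_graph V E')"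
begin

definition \<rho> :: real where
  "\<rho> = adj_spectral_radius (mk_graph V E)"

text \<open>One Perron vector is fixed by choice, since the sublocales need it as a
  parameter.\<close>

definition x :: "'a \<Rightarrow> real" where
  "x = (SOME x. (\<forall>v\<in>V. x v > 0) \<and> (\<forall>v\<in>V. nsum E x v = \<rho> * x v))"

lemma x_perron: "(\<forall>v\<in>V. x v > 0) \<and> (\<forall>v\<in>V. nsum E x v = \<rho> * x v)"
proof -
  have "V \<noteq> {}" using card2 by auto
  then have "\<exists>x. (\<forall>v\<in>V. x v > 0) \<and> (\<forall>v\<in>V. nsum E x v = \<rho> * x v)"
    using spectral_radius_perron[OF graph con] unfolding \<rho>_def by metis
  then show ?thesis unfolding x_def by (rule someI_ex)
qed

sublocale perron_graph V E x \<rho>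
  using graph con card2 x_perron by unfold_locales auto

lemma no_improvement:
  assumes "simple_graph V E' \<and> conn V E' \<and> adj_spectral_radius (mk_graph V E') < \<rho>"
    "S \<subseteq> V" "indep E' S" "\<alpha> \<le> card S"
  shows False
  using minimal[of E' S] assms by (auto simp: \<rho>_def)

text \<open>Deleting an edge keeps independent sets independent, so an edge on a cycle would
  contradict minimality. Acyclicity is thus available in the form that every edge is a bridge;
  absence of cycles in the sense of \<open>is_tree\<close> is derived later.\<close>

sublocale perron_tree V E x \<rho>
proof
  fix u v assume uv: "(u, v) \<in> E"
  show "(u, v) \<notin> (cut E u v)\<^sup>*"
  proof
    assume "(u, v) \<in> (cut E u v)\<^sup>*"
    note edge_on_cycle_reduces[OF uv this]
    moreover obtain S where "S \<subseteq> V" "indep E S" "\<alpha> \<le> card S" using ex_indep by blast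
    moreover have "indep (cut E u v) S" using calculation by (auto simp: indep_def cut_def)
    ultimately show False using no_improvement by blast
  qed
qed

lemma leafE:
  assumes "deg E t = 1"
  obtains y where "E `` {t} = {y}"
  using assms by (auto simp: card_1_singleton_iff)

lemma other_nbr:
  assumes "deg E b = 2" "(b, a) \<in> E"
  obtains w where "E `` {b} = {a, w}" "w \<noteq> a"
proof -
  obtain c d where cd: "E `` {b} = {c, d}" "c \<noteq> d" using assms(1) by (auto simp: card_2_iff)
  then have "a = c \<or> a = d" using assms(2) by auto
  then show ?thesis using cd that[of c] that[of d] by (auto simp: insert_commute)
qed

section \<open>Degrees and bipartition of a minimizer\<close>

text \<open>The rewiring frees \<open>t\<close> from its old neighbour and joins it to two
  neighbours of \<open>s\<close>. Hence \<open>S\<close> only has to be independent apart from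
  \<open>t\<close>, and must avoid the neighbours of \<open>s\<close> if it contains
  \<open>t\<close>. This form serves a leaf inside \<open>S\<close>, one dropped from
  \<open>S\<close> and one outside \<open>S\<close>.\<close>

lemma no_branch_shift:
  assumes s: "s \<in> V" "deg E s \<ge> 3" and t: "deg E t = 1"
    and q: "(s, q) \<in> E" "\<And>v. (s, v) \<in> E \<Longrightarrow> x q \<le> x v" "q \<noteq> t"
    and S: "S \<subseteq> V" "\<alpha> \<le> card S" "indep E (S - {t})" "t \<in> S \<Longrightarrow> E `` {s} \<inter> S = {}"
  shows False
proof -
  obtain y where y: "E `` {t} = {y}" using t by (rule leafE)
  have ts: "t \<noteq> s" using s t by auto
  have "\<not> E `` {s} \<subseteq> {q, t}"
    using s(2) card_mono[of "{q, t}" "E `` {s}"] by (auto simp: card_insert_if split: if_splits)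
  then obtain b where b: "(s, b) \<in> E" "b \<noteq> q" "b \<noteq> t" by blast
  define E' where "E' = (E - {(t, y), (y, t), (s, b), (b, s)}) \<union> {(t, b), (b, t), (t, q), (q, t)}"
  have "indep E' S"
    unfolding indep_def
  proof (intro ballI notI)
    fix u v assume uv: "u \<in> S" "v \<in> S" "(u, v) \<in> E'"
    have "(t, v') \<in> E \<Longrightarrow> v' = y" "(v', t) \<in> E \<Longrightarrow> v' = y" for v' using y Esym by blast+
    then have "u \<noteq> t \<and> v \<noteq> t \<and> (u, v) \<in> E \<or> t \<in> S \<and> (b \<in> S \<or> q \<in> S)"
      using uv unfolding E'_def by auto
    then show False using uv S q b unfolding indep_def by blast
  qed
  then show False
    using no_improvement[OF shift_branch_reduces[OF s y ts q b E'_def]] S by blast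
qed

lemma min_nbr:
  assumes "v \<in> V"
  obtains q where "(v, q) \<in> E" "\<And>w. (v, w) \<in> E \<Longrightarrow> x q \<le> x w"
proof -
  obtain q where "is_arg_min x (\<lambda>w. w \<in> E `` {v}) q"
    using ex_is_arg_min_if_finite[OF finN nbr_exists[OF assms]] by blast
  then show ?thesis using that[of q] by (auto simp: is_arg_min_def not_less)
qed

text \<open>A leaf \<open>t\<close> of \<open>S\<close> can take over a branch at \<open>s\<close>:
  its new neighbours are neighbours of \<open>s\<close> and so lie outside \<open>S\<close>.\<close>

lemma indep_deg_le_2:
  assumes S: "S \<subseteq> V" "indep E S" "\<alpha> \<le> card S" and s: "s \<in> S"
  shows "deg E s \<le> 2"
proof (rule ccontr)
  assume "\<not> ?thesis"
  then have d: "deg E s \<ge> 3" by simp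
  obtain t where t: "t \<in> S" "deg E t = 1" using indep_leaf[OF S(1,2)] S(3) large by auto
  have sV: "s \<in> V" using S s by blast
  obtain q where q: "(s, q) \<in> E" "\<And>w. (s, w) \<in> E \<Longrightarrow> x q \<le> x w" by (rule min_nbr[OF sV]) blast
  have N: "E `` {s} \<inter> S = {}" using S(2) s by (auto simp: indep_def)
  then have "q \<noteq> t" using q t by auto
  moreover have "indep E (S - {t})" using S(2) by (auto simp: indep_def)
  ultimately show False using no_branch_shift[OF sV d t(2) q _ S(1,3)] N by blast
qed

text \<open>With branch vertices on both sides the edge could be subdivided by a leaf of
  \<open>S\<close>, whose new neighbours \<open>u\<close> and \<open>v\<close> are both outside
  \<open>S\<close>.\<close>

lemma uncovered_edge_side:
  assumes S: "S \<subseteq> V" "indep E S" "\<alpha> \<le> card S" and uv: "(u, v) \<in> E" "u \<notin> S" "v \<notin> S"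
  shows "(\<forall>w\<in>side E u v. deg E w \<le> 2) \<or> (\<forall>w\<in>side E v u. deg E w \<le> 2)"
proof (rule ccontr)
  assume "\<not> ?thesis"
  then obtain w w' where w: "w \<in> side E u v" "deg E w \<ge> 3" "w' \<in> side E v u" "deg E w' \<ge> 3"
    by (auto simp: not_le)
  have Q: "Q u v \<le> 0" using internal_edge[OF uv(1) w] .
  obtain t where t: "t \<in> S" "deg E t = 1" using indep_leaf[OF S(1,2)] S(3) large by auto
  obtain y where y: "E `` {t} = {y}" using t(2) by (rule leafE)
  have ne: "t \<noteq> u" "t \<noteq> v" using t uv by auto
  define E' where "E' = (E - {(t, y), (y, t), (u, v), (v, u)}) \<union> {(u, t), (t, u), (t, v), (v, t)}"
  have "indep E' S" using S(2) uv unfolding E'_def indep_def by auto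
  then show False using no_improvement[OF subdivide_reduces[OF uv(1) Q y ne E'_def]] S by blast
qed

text \<open>On a side that is a path, \<open>S\<close> is exchanged for the alternating set
  \<open>W\<close> that starts with \<open>u\<close>. Nothing clashes across the edge because
  \<open>v\<close> is not in \<open>S\<close>; the edge \<open>u v\<close> is now met by the set,
  and no other edge ceases to be met since \<open>W\<close> meets all edges of the side.\<close>

lemma flip_side:
  assumes S: "S \<subseteq> V" "indep E S" and uv: "(u, v) \<in> E" "u \<notin> S" "v \<notin> S"
    and d: "\<And>w. w \<in> side E u v \<Longrightarrow> deg E w \<le> 2"
  obtains S' where "S' \<subseteq> V" "indep E S'" "card S \<le> card S'"
    "E \<inter> (V - S') \<times> (V - S') \<subset> E \<inter> (V - S) \<times> (V - S)"
proof -
  let ?U = "side E u v"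
  have UV: "?U \<subseteq> V" using side_subset inV(1)[OF uv(1)] .
  have vU: "v \<notin> ?U" using side_not[OF uv(1)] .
  have "\<exists>W. W \<subseteq> ?U \<and> u \<in> W \<and> indep E W \<and>
    (\<forall>a\<in>?U. \<forall>b\<in>?U. (a, b) \<in> E \<longrightarrow> a \<in> W \<or> b \<in> W) \<and>
    (\<forall>S\<subseteq>V. indep E S \<longrightarrow> card (S \<inter> ?U) \<le> card W)"
    by (rule alternating_side[OF uv(1) d])
  then obtain W where W: "W \<subseteq> ?U" "u \<in> W" "indep E W"
    "\<forall>a\<in>?U. \<forall>b\<in>?U. (a, b) \<in> E \<longrightarrow> a \<in> W \<or> b \<in> W"
    "\<forall>S\<subseteq>V. indep E S \<longrightarrow> card (S \<inter> ?U) \<le> card W"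
    by (elim exE conjE) (rule that)
  have cross: "a = u \<and> b = v" if "a \<in> ?U" "b \<notin> ?U" "(a, b) \<in> E" for a b
    using side_step[OF that(1,3)] that(2) by blast
  define S' where "S' = (S - ?U) \<union> W"
  have cross': "a = u \<and> b = v" if "a \<in> ?U" "b \<notin> ?U" "(b, a) \<in> E" for a b
    using cross that Esym by blast
  have "S' \<subseteq> V" using S W UV by (auto simp: S'_def)
  moreover have "indep E S'"
    unfolding indep_def
  proof (intro ballI notI)
    fix a b assume ab: "a \<in> S'" "b \<in> S'" "(a, b) \<in> E"
    consider "a \<in> W" "b \<in> W" | "a \<in> S - ?U" "b \<in> S - ?U" | "a \<in> W" "b \<in> S - ?U" | "a \<in> S - ?U" "b \<in> W"
      using ab(1,2) by (auto simp: S'_def)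
    then show False
    proof cases
      case 1 then show ?thesis using W(3) ab(3) by (auto simp: indep_def)
    next
      case 2 then show ?thesis using S(2) ab(3) by (auto simp: indep_def)
    next
      case 3 then have "b = v" using cross[of a b] W(1) ab(3) by auto
      then show ?thesis using 3 uv by auto
    next
      case 4 then have "a = v" using cross'[of b a] W(1) ab(3) by auto
      then show ?thesis using 4 uv by auto
    qed
  qed
  moreover have "card S \<le> card S'"
  proof -
    have fS: "finite S" "finite W" using S UV W(1) fin by (meson finite_subset)+
    have "card S = card (S - ?U) + card (S \<inter> ?U)"
      using fS by (metis Int_commute card_Diff_subset_Int finite_Int le_add_diff_inverse2 card_mono inf_le1)
    also have "\<dots> \<le> card (S - ?U) + card W" using W(5) S by simp
    also have "\<dots> = card S'" unfolding S'_def using fS W(1) by (subst card_Un_disjoint) auto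
    finally show ?thesis .
  qed
  moreover have "E \<inter> (V - S') \<times> (V - S') \<subset> E \<inter> (V - S) \<times> (V - S)"
  proof
    show "E \<inter> (V - S') \<times> (V - S') \<subseteq> E \<inter> (V - S) \<times> (V - S)"
    proof (rule subrelI)
      fix a b assume "(a, b) \<in> E \<inter> (V - S') \<times> (V - S')"
      then have ab: "(a, b) \<in> E" "a \<in> V" "b \<in> V" "a \<notin> S'" "b \<notin> S'" by auto
      have nw: "a \<notin> W" "b \<notin> W" using ab by (auto simp: S'_def)
      have "\<not> (a \<in> ?U \<and> b \<in> ?U)" using W(4) ab nw by blast
      moreover have "\<not> (a \<in> ?U \<and> b \<notin> ?U)" using cross[of a b] ab nw W(2) by blast
      moreover have "\<not> (a \<notin> ?U \<and> b \<in> ?U)" using cross'[of b a] ab nw W(2) by blast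
      ultimately have "a \<notin> ?U" "b \<notin> ?U" by blast+
      then show "(a, b) \<in> E \<inter> (V - S) \<times> (V - S)" using ab by (auto simp: S'_def)
    qed
    show "E \<inter> (V - S') \<times> (V - S') \<noteq> E \<inter> (V - S) \<times> (V - S)"
    proof
      assume "E \<inter> (V - S') \<times> (V - S') = E \<inter> (V - S) \<times> (V - S)"
      moreover have "(u, v) \<in> E \<inter> (V - S) \<times> (V - S)" using uv inV by auto
      ultimately have "u \<notin> S'" by blast
      then show False using W(2) by (simp add: S'_def)
    qed
  qed
  ultimately show ?thesis by (rule that)
qed

text \<open>Among the maximum independent sets take one with the fewest arcs in its complement. A
  remaining arc would have a side that is a path, and flipping that side would reduce the
  count.\<close>

lemma max_indep_bipartition:
  obtains S where "S \<subseteq> V" "indep E S" "indep E (V - S)" "\<alpha> \<le> card S"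
    "\<And>S'. S' \<subseteq> V \<Longrightarrow> indep E S' \<Longrightarrow> card S' \<le> card S"
proof -
  let ?I = "{S. S \<subseteq> V \<and> indep E S}"
  have finI: "finite ?I" using fin by (auto intro: finite_subset[of _ "Pow V"])
  define m where "m = Max (card ` ?I)"
  have neI: "?I \<noteq> {}" by (auto simp: indep_def intro!: exI[of _ "{}"])
  have m: "card S \<le> m" if "S \<in> ?I" for S unfolding m_def using finI that by (intro Max_ge) auto
  obtain S0 where S0: "S0 \<in> ?I" "card S0 = m"
    using Max_in[of "card ` ?I"] finI neI unfolding m_def by (metis (no_types, lifting) finite_imageI imageE image_is_empty)
  obtain S1 where "S1 \<in> ?I" "\<alpha> \<le> card S1" using ex_indep by blast
  then have am: "\<alpha> \<le> m" using m[of S1] by linarith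
  let ?J = "{S \<in> ?I. card S = m}" and ?k = "\<lambda>S. card (E \<inter> (V - S) \<times> (V - S))"
  have "finite ?J" by (rule finite_subset[OF _ finI]) auto
  moreover have "?J \<noteq> {}" using S0 by auto
  ultimately obtain S where S: "is_arg_min ?k (\<lambda>S. S \<in> ?J) S" using ex_is_arg_min_if_finite by blast
  then have SJ: "S \<subseteq> V" "indep E S" "card S = m" by (auto simp: is_arg_min_def)
  have mink: "?k S \<le> ?k S'" if "S' \<subseteq> V" "indep E S'" "card S' = m" for S'
    using S that unfolding is_arg_min_def by (simp add: not_less)
  have no: False if uv: "(u, v) \<in> E" "u \<notin> S" "v \<notin> S" and d: "\<And>w. w \<in> side E u v \<Longrightarrow> deg E w \<le> 2" for u v
  proof -
    obtain S' where S': "S' \<subseteq> V" "indep E S'" "card S \<le> card S'"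
      "E \<inter> (V - S') \<times> (V - S') \<subset> E \<inter> (V - S) \<times> (V - S)"
      by (rule flip_side[OF SJ(1,2) uv d])
    have "?k S' < ?k S" using S'(4) finE by (intro psubset_card_mono) auto
    moreover have "card S' = m" using m[of S'] S' SJ(3) by auto
    ultimately show False using mink[OF S'(1,2)] by linarith
  qed
  have "indep E (V - S)"
    unfolding indep_def
  proof (intro ballI notI)
    fix u v assume uv: "u \<in> V - S" "v \<in> V - S" "(u, v) \<in> E"
    have "(\<forall>w\<in>side E u v. deg E w \<le> 2) \<or> (\<forall>w\<in>side E v u. deg E w \<le> 2)"
      using uncovered_edge_side[OF SJ(1,2) _ uv(3)] am SJ(3) uv by auto
    then show False using no[of u v] no[of v u] uv Esym by blast
  qed
  then show ?thesis using that[of S] SJ am m by auto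
qed

lemma sum_deg_bipartite:
  assumes S: "S \<subseteq> V" "indep E S" "indep E (V - S)"
  shows "(\<Sum>v\<in>S. deg E v) = card V - 1" "(\<Sum>v\<in>V - S. deg E v) = card V - 1"
proof -
  have e: "E \<inter> (V - S) \<times> (V - S) = {}" using S(3) by (auto simp: indep_def)
  have e': "E \<inter> (V - (V - S)) \<times> (V - (V - S)) = {}" using S(2) by (auto simp: indep_def)
  show "(\<Sum>v\<in>S. deg E v) = card V - 1" using sum_deg_indep[OF S(1,2)] e by simp
  show "(\<Sum>v\<in>V - S. deg E v) = card V - 1" using sum_deg_indep[OF _ S(3)] e' by simp
qed

text \<open>Degrees in \<open>S\<close> are 1 or 2 and sum to the number of edges; the deficit
  against \<open>2 * card S\<close> is the number of leaves.\<close>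

lemma card_leaves:
  assumes S: "S \<subseteq> V" "indep E S" "indep E (V - S)" "\<And>s. s \<in> S \<Longrightarrow> deg E s \<le> 2"
  shows "card {s \<in> S. deg E s = 1} + card V = 2 * card S + 1"
proof -
  have fS: "finite S" using S fin finite_subset by blast
  have "(\<Sum>v\<in>S. deg E v + (if deg E v = 1 then 1 else 0)) = (\<Sum>v\<in>S. 2)"
  proof (rule sum.cong)
    fix v assume v: "v \<in> S"
    then have "deg E v \<ge> 1" "deg E v \<le> 2" using deg_pos S by auto
    then show "deg E v + (if deg E v = 1 then 1 else 0) = 2" by auto
  qed simp
  then have "(\<Sum>v\<in>S. deg E v) + card {s \<in> S. deg E s = 1} = 2 * card S"
    using fS by (simp add: sum.distrib sum.If_cases Int_def)
  then show ?thesis using sum_deg_bipartite[OF S(1-3)] card2 by simp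
qed

text \<open>If \<open>S\<close> had more than \<alpha> elements, one leaf of \<open>S\<close> could
  be given up. There would be at least three such leaves and a branch vertex outside
  \<open>S\<close>, so some leaf different from the lightest neighbour could be used in a branch
  shift. A leaf outside \<open>S\<close> can be used in the same way without touching
  \<open>S\<close>, which gives the final alternative.\<close>

lemma extremal_bipartition:
  obtains S where "S \<subseteq> V" "indep E S" "indep E (V - S)" "card S = \<alpha>"
    "\<And>S'. S' \<subseteq> V \<Longrightarrow> indep E S' \<Longrightarrow> card S' \<le> \<alpha>"
    "\<And>s. s \<in> S \<Longrightarrow> deg E s \<le> 2"
    "(\<forall>v\<in>V. deg E v \<le> 2) \<or> (\<forall>v\<in>V - S. deg E v \<ge> 2)"
proof -
  obtain S where S: "S \<subseteq> V" "indep E S" "indep E (V - S)" "\<alpha> \<le> card S"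
    "\<And>S'. S' \<subseteq> V \<Longrightarrow> indep E S' \<Longrightarrow> card S' \<le> card S"
    by (rule max_indep_bipartition) blast
  have d2: "deg E s \<le> 2" if "s \<in> S" for s using indep_deg_le_2[OF S(1,2,4) that] .
  have fS: "finite S" using S fin finite_subset by blast
  have card: "card S = \<alpha>"
  proof (rule ccontr)
    assume "card S \<noteq> \<alpha>"
    then have gt: "\<alpha> + 1 \<le> card S" using S(4) by simp
    then have three: "3 \<le> card {s \<in> S. deg E s = 1}"
      using card_leaves[OF S(1-3) d2] large by linarith
    have "\<exists>k\<in>V - S. deg E k \<ge> 3"
    proof (rule ccontr)
      assume "\<not> ?thesis"
      then have "(\<Sum>v\<in>V - S. deg E v) \<le> (\<Sum>v\<in>V - S. 2)" by (intro sum_mono) (simp add: not_le numeral_3_eq_3 less_Suc_eq_le numeral_2_eq_2)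
      then have "card V - 1 \<le> 2 * card (V - S)" using sum_deg_bipartite[OF S(1-3)] by simp
      moreover have "card (V - S) = card V - card S" using S(1) fS by (simp add: card_Diff_subset)
      moreover have "card S \<le> card V" using S(1) fin by (simp add: card_mono)
      ultimately show False using gt large card2 by linarith
    qed
    then obtain k where k: "k \<in> V" "k \<notin> S" "deg E k \<ge> 3" by blast
    obtain q where q: "(k, q) \<in> E" "\<And>w. (k, w) \<in> E \<Longrightarrow> x q \<le> x w" by (rule min_nbr[OF k(1)]) blast
    have "\<not> {s \<in> S. deg E s = 1} \<subseteq> {q}" using three card_mono[of "{q}" "{s \<in> S. deg E s = 1}"] by auto
    then obtain t where t: "t \<in> S" "deg E t = 1" "q \<noteq> t" by blast
    have "S - {t} \<subseteq> V" "\<alpha> \<le> card (S - {t})" using S t gt fS by auto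
    moreover have "indep E (S - {t} - {t})" using S(2) by (auto simp: indep_def)
    ultimately show False using no_branch_shift[OF k(1,3) t(2) q t(3), of "S - {t}"] by blast
  qed
  have "deg E k \<ge> 2" if k: "k \<in> V - S" and b: "b \<in> V" "deg E b \<ge> 3" for k b
  proof (rule ccontr)
    assume "\<not> ?thesis"
    then have k1: "deg E k = 1" using deg_pos k by (metis DiffD1 One_nat_def Suc_1 le_antisym not_less_eq_eq)
    have bS: "b \<notin> S" using d2 b by fastforce
    obtain q where q: "(b, q) \<in> E" "\<And>w. (b, w) \<in> E \<Longrightarrow> x q \<le> x w" by (rule min_nbr[OF b(1)]) blast
    have "q \<noteq> k" using q(1) k b bS S(3) by (auto simp: indep_def)
    moreover have "S - {k} = S" using k by auto
    ultimately show False using no_branch_shift[OF b k1 q _ S(1)] S card k by auto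
  qed
  then have "(\<forall>v\<in>V. deg E v \<le> 2) \<or> (\<forall>v\<in>V - S. deg E v \<ge> 2)"
    by (metis not_less_eq_eq numeral_2_eq_2 numeral_3_eq_3)
  then show ?thesis using that[of S] S card d2 by auto
qed

section \<open>Pendant vertices in a minimizer\<close>

lemma nbr_towards:
  assumes "u \<in> V" "w \<in> V" "w \<noteq> u"
  obtains v where "(u, v) \<in> E" "w \<in> side E v u"
proof -
  obtain v' where v': "(u, v') \<in> E" using nbr_exists[OF assms(1)] by blast
  show ?thesis
  proof (cases "w \<in> side E v' u")
    case True
    then show ?thesis using that v' by blast
  next
    case False
    then have "w \<in> side E u v'" using side_cover[OF v' assms(2)] by blast
    then show ?thesis using that by (elim side_decomp[OF _ assms(3)])
  qed
qed

text \<open>The value of the excess, the sum of deg v - 2 over the complement of \<open>S\<close>,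
  written additively to stay within the naturals.\<close>

lemma sum_deg_cover:
  assumes S: "S \<subseteq> V" "indep E S" "indep E (V - S)" "card S = \<alpha>"
  shows "(\<Sum>v\<in>V - S. deg E v) + card V + 1 = 2 * card (V - S) + 2 * \<alpha>"
proof -
  have fS: "finite S" using S fin finite_subset by blast
  have "card (V - S) = card V - card S" using S(1) fS by (simp add: card_Diff_subset)
  moreover have "card S \<le> card V" using S(1) fin by (simp add: card_mono)
  ultimately show ?thesis using sum_deg_bipartite[OF S(1-3)] S(4) card2 by linarith
qed

lemma branch_exists:
  assumes S: "S \<subseteq> V" "indep E S" "indep E (V - S)" "card S = \<alpha>" and p: "card V + 2 \<le> 2 * \<alpha>"
  obtains z where "z \<in> V - S" "deg E z \<ge> 3"
proof (rule ccontr)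
  assume "\<not> thesis"
  then have "\<forall>z\<in>V - S. deg E z \<le> 2" using that by (metis not_less_eq_eq numeral_2_eq_2 numeral_3_eq_3)
  then have "(\<Sum>v\<in>V - S. deg E v) \<le> (\<Sum>v\<in>V - S. 2)" by (intro sum_mono) auto
  then show False using sum_deg_cover[OF S] p by simp
qed

text \<open>Otherwise \<open>a\<close>, \<open>b\<close> would be a pendant path on two vertices,
  free for reuse: excess at least 2 allows either splitting a vertex of degree 4 or subdividing
  twice an edge between two branch vertices. As \<open>a\<close> is in \<open>S\<close> and
  \<open>b\<close> is not, \<open>S\<close> stays independent in both cases.\<close>

lemma leaf_nbr_is_branch:
  assumes S: "S \<subseteq> V" "indep E S" "indep E (V - S)" "card S = \<alpha>" "\<And>s. s \<in> S \<Longrightarrow> deg E s \<le> 2"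
    and K2: "\<And>k. k \<in> V - S \<Longrightarrow> deg E k \<ge> 2"
    and p: "card V + 3 \<le> 2 * \<alpha>" and a: "E `` {a} = {b}"
  shows "deg E b \<ge> 3"
proof (rule ccontr)
  assume "\<not> ?thesis"
  then have b3: "deg E b < 3" by simp
  have finK: "finite (V - S)" using fin by simp
  have ab: "(a, b) \<in> E" "(b, a) \<in> E" using a Esym by blast+
  have abV: "a \<in> V" "b \<in> V" using ab inV by blast+
  have aS: "a \<in> S" using K2[of a] a abV by fastforce
  have bS: "b \<notin> S" using aS S(2) ab by (auto simp: indep_def)
  have b2: "deg E b = 2" using K2[of b] b3 bS abV by fastforce
  obtain w where w: "E `` {b} = {a, w}" "w \<noteq> a" by (rule other_nbr[OF b2 ab(2)])
  have wb: "(b, w) \<in> E" "(w, b) \<in> E" using w Esym by blast+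
  have wS: "w \<in> S" using wb bS S(3) inV unfolding indep_def by blast
  have w2: "deg E w \<le> 2" using S(5) wS .
  have kN: "v \<in> S" if "u \<in> V - S" "(u, v) \<in> E" for u v
    using that S(3) inV(2)[OF that(2)] unfolding indep_def by blast
  \<comment> \<open>A single branch vertex of degree 3 would give excess only 1.\<close>
  consider z where "z \<in> V - S" "deg E z \<ge> 4" |
    z1 z2 where "z1 \<in> V - S" "z2 \<in> V - S" "z1 \<noteq> z2" "deg E z1 \<ge> 3" "deg E z2 \<ge> 3"
  proof (rule ccontr)
    assume neg: "\<not> thesis"
    note two = that(2)
    have "card V + 2 \<le> 2 * \<alpha>" using p by simp
    then obtain z where z: "z \<in> V - S" "deg E z \<ge> 3" using branch_exists[OF S(1-4)] by blast
    have "deg E z \<le> 3"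
    proof (rule ccontr)
      assume "\<not> deg E z \<le> 3"
      then show False using neg z(1) that(1)[of z] by simp
    qed
    moreover have "deg E v \<le> 2" if v: "v \<in> V - S - {z}" for v
    proof (rule ccontr)
      assume "\<not> deg E v \<le> 2"
      then show False using neg v z two[of z v] by auto
    qed
    then have "(\<Sum>v\<in>V - S - {z}. deg E v) \<le> (\<Sum>v\<in>V - S - {z}. 2)" by (intro sum_mono) auto
    moreover have "(\<Sum>v\<in>V - S. deg E v) = deg E z + (\<Sum>v\<in>V - S - {z}. deg E v)"
      using finK z(1) by (rule sum.remove)
    moreover have "card (V - S) = Suc (card (V - S - {z}))" using finK z(1) by (metis card_Suc_Diff1)
    ultimately show False using sum_deg_cover[OF S(1-4)] p by simp
  qed
  then show False
  proof cases
    case 1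
    have z: "z \<in> V" "z \<noteq> w" using 1 wS by auto
    have "2 \<le> card (E `` {z} - {w})" using 1(2) diff_card_le_card_Diff[of "{w}" "E `` {z}"] by simp
    then obtain c1 c2 where c: "c1 \<noteq> c2" "{c1, c2} \<subseteq> E `` {z} - {w}"
      by (metis card_2_iff obtain_subset_with_card_n)
    then have c': "(z, c1) \<in> E" "(z, c2) \<in> E" "c1 \<noteq> w" "c2 \<noteq> w" by auto
    define E' where "E' = (E - {(b, w), (w, b), (z, c1), (c1, z), (z, c2), (c2, z)})
      \<union> {(z, a), (a, z), (b, c1), (c1, b), (b, c2), (c2, b)}"
    have "indep E' S" using S(2) bS 1(1) unfolding E'_def indep_def by auto
    then show False
      using no_improvement[OF split_vertex_reduces[OF a w z(1) 1(2) z(2) c(1) c' E'_def]] S by blast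
  next
    case (2 u z2)
    obtain v where v: "(u, v) \<in> E" "z2 \<in> side E v u" using nbr_towards[of u z2] 2 by blast
    have Q: "Q u v \<le> 0" using internal_edge[OF v(1) side_self 2(4) v(2) 2(5)] .
    have vS: "v \<in> S" using kN v 2(1) by blast
    have "u \<noteq> a" "u \<noteq> b" "u \<noteq> w" using 2 aS wS b3 by auto
    moreover have "v \<noteq> b" using vS bS by auto
    moreover have "v \<noteq> a" using v(1) Esym a \<open>u \<noteq> b\<close> by blast
    \<comment> \<open>Were \<open>v = w\<close>, the side of \<open>v\<close> seen from
      \<open>u\<close> would consist of \<open>w\<close>, \<open>b\<close>, \<open>a\<close> alone
      and could not contain the branch vertex \<open>z2\<close>.\<close>
    moreover have "v \<noteq> w"
    proof
      assume vw: "v = w"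
      have Nw: "E `` {w} = {b, u}"
        using card_seteq[OF finN, of "{b, u}" w] w2 wb Esym[OF v(1)] vw \<open>u \<noteq> b\<close> by auto
      have "side E w u = insert w (side E b w)"
        using side_eq_insert[of w u b] Nw \<open>u \<noteq> b\<close> by auto
      also have "side E b w = insert b (side E a b)"
        using side_eq_insert[of b w a] w wb by auto
      also have "side E a b = {a}" using side_eq_singleton[of a b] a by simp
      finally have "z2 \<in> {w, b, a}" using v(2) vw by auto
      then show False using 2 aS wS b3 by auto
    qed
    ultimately have ne: "u \<notin> {a, b, w}" "v \<notin> {a, b, w}" by auto
    define E' where "E' = (E - {(b, w), (w, b), (u, v), (v, u)}) \<union> {(u, a), (a, u), (b, v), (v, b)}"
    have "indep E' S" using S(2) bS 2(1) unfolding E'_def indep_def by auto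
    then show False
      using no_improvement[OF subdivide_twice_reduces[OF v(1) Q a w ne E'_def]] S by blast
  qed
qed

end

text \<open>The tree is \<open>D\<^sub>n\<close>; weight 1 on its two twin leaves and 2 elsewhere is a supersolution.\<close>

lemma D_tree_competitor:
  assumes fin: "finite V" and c4: "card V \<ge> 4" and ev: "even (card V)"
  obtains E S where "simple_graph V E" "conn V E" "adj_spectral_radius (mk_graph V E) < 2"
    "S \<subseteq> V" "indep E S" "2 * card S = card V + 2"
proof -
  let ?n = "card V"
  obtain f where f: "bij_betw f {0..<?n} V" using ex_bij_betw_nat_finite[OF fin] by blast
  have inj: "inj_on f {0..<?n}" and img: "f ` {0..<?n} = V" using f by (auto simp: bij_betw_def)
  have idx: thesis if "v \<in> V" "\<And>i. i < ?n \<Longrightarrow> v = f i \<Longrightarrow> thesis" for v thesis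
  proof -
    have "v \<in> f ` {0..<?n}" using that(1) img by simp
    then obtain i where "v = f i" "i \<in> {0..<?n}" by (rule imageE)
    then show thesis using that(2)[of i] by simp
  qed
  \<comment> \<open>Vertices 0 and 1 are the twin leaves at 2, and 1, 2, ..., n - 1 is a
    path.\<close>
  define D where "D = {(i, j). i < ?n \<and> j < ?n \<and>
    ((1 \<le> i \<and> j = Suc i) \<or> (1 \<le> j \<and> i = Suc j) \<or> (i = 0 \<and> j = 2) \<or> (i = 2 \<and> j = 0))}"
  define E where "E = map_prod f f ` D"
  have ED: "(f i, f j) \<in> E \<longleftrightarrow> (i, j) \<in> D" if "i < ?n" "j < ?n" for i j
  proof
    assume "(f i, f j) \<in> E"
    then obtain i' j' where "(i', j') \<in> D" "f i = f i'" "f j = f j'" by (auto simp: E_def)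
    moreover have "i' < ?n" "j' < ?n" using calculation by (auto simp: D_def)
    ultimately show "(i, j) \<in> D" using inj_onD[OF inj, of i i'] inj_onD[OF inj, of j j'] that by auto
  qed (auto simp: E_def)
  have G: "simple_graph V E"
  proof -
    have "E \<subseteq> V \<times> V" using img by (auto simp: E_def D_def)
    moreover have "sym D" by (auto simp: D_def sym_def)
    then have "sym E" unfolding E_def sym_def by fastforce
    moreover have "irrefl E"
    proof -
      have "(v, v) \<notin> E" for v
      proof
        assume "(v, v) \<in> E"
        then obtain i j where ij: "(i, j) \<in> D" "f i = v" "f j = v" by (auto simp: E_def)
        then have "i = j" using inj by (auto simp: inj_on_def D_def)
        then show False using ij by (auto simp: D_def)
      qed
      then show ?thesis by (simp add: irrefl_def)
    qed
    ultimately show ?thesis using fin by (simp add: simple_graph_def)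
  qed
  have symE: "sym E" using G by (simp add: simple_graph_def)
  have reach: "(f 2, f i) \<in> E\<^sup>*" if "i < ?n" for i
  proof -
    have "(f 2, f 0) \<in> E" "(f 2, f 1) \<in> E" using ED[of 2 0] ED[of 2 1] c4 by (auto simp: D_def)
    moreover have "(f 2, f i) \<in> E\<^sup>*" if "2 \<le> i" using that \<open>i < ?n\<close>
    proof (induction i rule: dec_induct)
      case (step k)
      then have "(f k, f (Suc k)) \<in> E" using ED[of k "Suc k"] by (auto simp: D_def)
      then show ?case using step by (auto intro: rtrancl_into_rtrancl)
    qed simp
    ultimately show ?thesis by (cases "i = 0"; cases "i = 1") auto
  qed
  have C: "conn V E"
    unfolding conn_def
  proof (intro ballI)
    fix u v assume "u \<in> V" "v \<in> V"
    then obtain i j where "i < ?n" "u = f i" "j < ?n" "v = f j" by (elim idx)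
    then have "(f 2, u) \<in> E\<^sup>*" "(f 2, v) \<in> E\<^sup>*" using reach by simp_all
    then show "(u, v) \<in> E\<^sup>*" using symE by (meson rtrancl_trans sym_rtrancl symD)
  qed
  define w where "w = (\<lambda>i::nat. if i < 2 then 1 else 2 :: real)"
  define z where "z = (\<lambda>v. w (inv_into {0..<?n} f v))"
  have zf: "z (f i) = w i" if "i < ?n" for i
    using that inj by (simp add: z_def inv_into_f_f)
  have Nf: "E `` {f i} = f ` (D `` {i})" if "i < ?n" for i
  proof
    show "E `` {f i} \<subseteq> f ` (D `` {i})"
    proof
      fix v assume v: "v \<in> E `` {f i}"
      then have "v \<in> V" using G by (auto simp: simple_graph_def)
      then obtain j where "j < ?n" "v = f j" by (rule idx)
      then show "v \<in> f ` (D `` {i})" using v ED[OF that] by auto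
    qed
  qed (auto simp: E_def)
  have ns: "nsum E z (f i) = (\<Sum>j\<in>D `` {i}. w j)" if "i < ?n" for i
  proof -
    have sub: "D `` {i} \<subseteq> {0..<?n}" by (auto simp: D_def)
    have "nsum E z (f i) = (\<Sum>j\<in>D `` {i}. z (f j))"
      unfolding Nf[OF that] using inj_on_subset[OF inj sub] by (simp add: sum.reindex)
    also have "\<dots> = (\<Sum>j\<in>D `` {i}. w j)" using sub zf by (intro sum.cong) auto
    finally show ?thesis .
  qed
  \<comment> \<open>All rows are equalities except the one at the far end n - 1 of the path, which
    has a single neighbour.\<close>
  have row: "nsum E z (f i) \<le> 2 * w i - (if i = ?n - 1 then 1 else 0)" if i: "i < ?n" for i
  proof -
    consider "i = 0" | "i = 1" | "i = 2" | "i > 2" "i < ?n - 1" | "i > 2" "i = ?n - 1" using i by linarith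
    then show ?thesis
    proof cases
      case 1
      have "D `` {0} = {2}" using c4 by (auto simp: D_def)
      then show ?thesis using ns[OF i] 1 c4 by (simp add: w_def)
    next
      case 2
      have "D `` {1} = {2}" using c4 by (auto simp: D_def)
      then show ?thesis using ns[OF i] 2 c4 by (simp add: w_def)
    next
      case 3
      have "D `` {2} = {0, 1, 3}" using c4 by (auto simp: D_def)
      then show ?thesis using ns[OF i] 3 c4 by (simp add: w_def)
    next
      case 4
      have "D `` {i} = {i - 1, Suc i}" using 4 by (auto simp: D_def)
      moreover have "i - 1 \<noteq> Suc i" by simp
      ultimately show ?thesis using ns[OF i] 4 by (simp add: w_def)
    next
      case 5
      have "D `` {i} = {i - 1}" using 5 by (auto simp: D_def)
      then show ?thesis using ns[OF i] 5 by (simp add: w_def)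
    qed
  qed
  have zpos: "z v > 0" for v by (simp add: z_def w_def)
  have sup: "nsum E z v \<le> 2 * z v" if "v \<in> V" for v
  proof -
    obtain i where i: "i < ?n" "v = f i" by (rule idx[OF \<open>v \<in> V\<close>])
    then show ?thesis using row[OF i(1)] zf by (simp split: if_splits)
  qed
  have last: "f (?n - 1) \<in> V" "nsum E z (f (?n - 1)) < 2 * z (f (?n - 1))"
    using row[of "?n - 1"] zf[of "?n - 1"] c4 img by auto
  have rho: "adj_spectral_radius (mk_graph V E) < 2"
    using spectral_radius_less_supersolution[OF G C, of z 2 "f (?n - 1)"] zpos sup last by blast
  \<comment> \<open>The odd numbers are every second vertex of the path, starting with the twin leaf
    1; the twin 0 can be added, since its only neighbour is 2.\<close>
  define I where "I = insert 0 {i. i < ?n \<and> odd i}"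
  have I: "I \<subseteq> {0..<?n}" using c4 by (auto simp: I_def)
  obtain m where m: "?n = 2 * m" using ev by (elim evenE)
  have "{i. i < ?n \<and> odd i} = (\<lambda>k. 2 * k + 1) ` {0..<m}" using m by (auto elim!: oddE)
  then have "card {i. i < ?n \<and> odd i} = m" by (simp add: card_image inj_on_def)
  then have cI: "card I = m + 1" unfolding I_def using m c4 by simp
  have "indep E (f ` I)"
  proof -
    have "(i, j) \<notin> D" if "i \<in> I" "j \<in> I" for i j using that by (auto simp: I_def D_def)
    moreover have "i < ?n" if "i \<in> I" for i using I that by auto
    ultimately show ?thesis using ED by (auto simp: indep_def)
  qed
  moreover have "2 * card (f ` I) = ?n + 2" using cI m inj_on_subset[OF inj I] by (simp add: card_image)
  moreover have "f ` I \<subseteq> V" using I img by auto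
  ultimately show ?thesis using that[of E "f ` I"] G C rho by blast
qed

context extremal
begin

text \<open>Excess 1 means exactly one branch vertex \<open>z\<close>, of degree 3. If two of its
  neighbours were not leaves, the arms through them would have length at least 3, because the next
  vertices have degree exactly 2. The tree would then contain the affine diagram of type E7, so its
  spectral radius would be at least 2 and D_n would do better.\<close>

lemma twin_leaves:
  assumes S: "S \<subseteq> V" "indep E S" "indep E (V - S)" "card S = \<alpha>" "\<And>s. s \<in> S \<Longrightarrow> deg E s \<le> 2"
    and K2: "\<And>k. k \<in> V - S \<Longrightarrow> deg E k \<ge> 2"
    and p: "card V + 2 = 2 * \<alpha>"
  shows "\<exists>z a b c. z \<in> V \<and> E `` {z} = {a, b, c} \<and> a \<noteq> b \<and> a \<noteq> c \<and> b \<noteq> c \<and>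
    E `` {a} = {z} \<and> E `` {b} = {z} \<and> (\<forall>v\<in>V - {z}. deg E v \<le> 2)"
proof -
  have finK: "finite (V - S)" using fin by simp
  obtain z where z: "z \<in> V - S" "deg E z \<ge> 3" using branch_exists[OF S(1-4)] p by auto
  have split: "(\<Sum>v\<in>V - S. deg E v) = deg E z + (\<Sum>v\<in>V - S - {z}. deg E v)"
    using finK z(1) by (rule sum.remove)
  have cK: "card (V - S) = Suc (card (V - S - {z}))" using finK z(1) by (metis card_Suc_Diff1)
  have "(\<Sum>v\<in>V - S - {z}. 2) \<le> (\<Sum>v\<in>V - S - {z}. deg E v)" using K2 by (intro sum_mono) auto
  then have ge: "2 * card (V - S - {z}) \<le> (\<Sum>v\<in>V - S - {z}. deg E v)" by simp
  then have z3: "deg E z = 3" and eq: "(\<Sum>v\<in>V - S - {z}. deg E v) = 2 * card (V - S - {z})"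
    using sum_deg_cover[OF S(1-4)] p z(2) split cK by linarith+
  have other: "deg E v \<le> 2" if "v \<in> V - {z}" for v
  proof (cases "v \<in> S")
    case False
    then have v: "v \<in> V - S - {z}" using that by auto
    have "(\<Sum>v\<in>V - S - {z}. deg E v - 2) = 0"
      using eq K2 by (subst sum_subtractf_nat) auto
    then show ?thesis using v finK by simp
  qed (use S(5) in auto)
  have zV: "z \<in> V" using z by auto
  have kN: "v \<in> S" if "u \<in> V - S" "(u, v) \<in> E" for u v
    using that S(3) inV(2)[OF that(2)] unfolding indep_def by blast
  have sN: "v \<in> V - S" if "u \<in> S" "(u, v) \<in> E" for u v
    using that S(2) inV(2)[OF that(2)] unfolding indep_def by blast
  show ?thesis
  proof (cases "\<exists>a b. (z, a) \<in> E \<and> (z, b) \<in> E \<and> a \<noteq> b \<and> deg E a = 1 \<and> deg E b = 1")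
    case True
    then obtain a b where ab: "(z, a) \<in> E" "(z, b) \<in> E" "a \<noteq> b" "deg E a = 1" "deg E b = 1" by blast
    have "card (E `` {z} - {a, b}) = 1" using z3 ab by (simp add: card_Diff_subset)
    then obtain c where "E `` {z} - {a, b} = {c}" by (auto simp: card_1_singleton_iff)
    then have c: "E `` {z} = {a, b, c}" "a \<noteq> c" "b \<noteq> c" using ab by auto
    have leaf: "E `` {v} = {z}" if v: "(z, v) \<in> E" "deg E v = 1" for v
    proof -
      obtain y where "E `` {v} = {y}" using v(2) by (rule leafE)
      then show ?thesis using Esym[OF v(1)] by auto
    qed
    note facts = zV c ab(3) leaf[OF ab(1,4)] leaf[OF ab(2,5)]
    show ?thesis
      by (intro exI[of _ z] exI[of _ a] exI[of _ b] exI[of _ c] conjI ballI) (rule facts other | assumption)+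
  next
    case False
    have "\<exists>n1 n2 n3. E `` {z} = {n1, n2, n3} \<and> n1 \<noteq> n2 \<and> n1 \<noteq> n3 \<and> n2 \<noteq> n3"
      using z3 by (auto simp: card_3_iff)
    then obtain m1 m2 m3 where m: "E `` {z} = {m1, m2, m3}" "m1 \<noteq> m2" "m1 \<noteq> m3" "m2 \<noteq> m3" by blast
    have "\<exists>n1 n2 n3. E `` {z} = {n1, n2, n3} \<and> n1 \<noteq> n2 \<and> n1 \<noteq> n3 \<and> n2 \<noteq> n3 \<and> deg E n1 \<noteq> 1 \<and> deg E n2 \<noteq> 1"
    proof -
      have F: "deg E a \<noteq> 1 \<or> deg E b \<noteq> 1" if "a \<in> {m1, m2, m3}" "b \<in> {m1, m2, m3}" "a \<noteq> b" for a b
        using False m(1) that by blast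
      consider "deg E m1 = 1" | "deg E m2 = 1" | "deg E m1 \<noteq> 1" "deg E m2 \<noteq> 1" by blast
      then show ?thesis
      proof cases
        case 1 then show ?thesis using F[of m1 m2] F[of m1 m3] m
          by (intro exI[of _ m2] exI[of _ m3] exI[of _ m1]) auto
      next
        case 2 then show ?thesis using F[of m1 m2] F[of m2 m3] m
          by (intro exI[of _ m1] exI[of _ m3] exI[of _ m2]) auto
      next
        case 3 then show ?thesis using m by blast
      qed
    qed
    then obtain n1 n2 n3 where n: "E `` {z} = {n1, n2, n3}" "n1 \<noteq> n2" "n1 \<noteq> n3" "n2 \<noteq> n3"
      "deg E n1 \<noteq> 1" "deg E n2 \<noteq> 1" by blast
    have arm: "\<exists>c e. c \<in> V \<and> e \<in> V \<and> \<rho> * x a = x z + x c \<and> \<rho> * x c = x a + x e \<and> x c \<le> \<rho> * x e"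
      if a: "a \<in> {n1, n2, n3}" "deg E a \<noteq> 1" for a
    proof -
      have za: "(z, a) \<in> E" "(a, z) \<in> E" using a n(1) Esym by blast+
      have aS: "a \<in> S" using kN[OF z(1) za(1)] .
      have aV: "a \<in> V" using za inV by blast
      have a2: "deg E a = 2" using S(5)[OF aS] a(2) deg_pos[OF aV] by linarith
      obtain c where c: "E `` {a} = {z, c}" "c \<noteq> z" by (rule other_nbr[OF a2 za(2)])
      have ac: "(a, c) \<in> E" "(c, a) \<in> E" using c Esym by blast+
      have cK: "c \<in> V - S" using sN[OF aS ac(1)] .
      have c2: "deg E c = 2" using K2[OF cK] other[of c] cK c(2) by fastforce
      obtain e where e: "E `` {c} = {a, e}" "e \<noteq> a" by (rule other_nbr[OF c2 ac(2)])
      have ce: "(c, e) \<in> E" "(e, c) \<in> E" using e Esym by blast+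
      have "\<rho> * x a = x z + x c" using eig[OF aV] c by simp
      moreover have "\<rho> * x c = x a + x e" using eig[of c] cK e by simp
      moreover have "x c \<le> \<rho> * x e" using nbr_le ce by blast
      ultimately show ?thesis using cK ce inV by blast
    qed
    obtain c1 e1 where 1: "c1 \<in> V" "e1 \<in> V" "\<rho> * x n1 = x z + x c1" "\<rho> * x c1 = x n1 + x e1" "x c1 \<le> \<rho> * x e1"
      using arm[of n1] n by auto
    obtain c2 e2 where 2: "c2 \<in> V" "e2 \<in> V" "\<rho> * x n2 = x z + x c2" "\<rho> * x c2 = x n2 + x e2" "x c2 \<le> \<rho> * x e2"
      using arm[of n2] n by auto
    have 3: "\<rho> * x z = x n1 + x n2 + x n3" using eig[OF zV] n by simp
    have nz: "(z, n1) \<in> E" "(z, n2) \<in> E" "(z, n3) \<in> E" using n(1) by auto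
    have 4: "x z \<le> \<rho> * x n3" using nbr_le[OF Esym[OF nz(3)]] .
    \<comment> \<open>The null vector of the affine diagram of type E7 as test vector.\<close>
    define W where "W = 4 * x z + 3 * x n1 + 3 * x n2 + 2 * x n3 + 2 * x c1 + 2 * x c2 + x e1 + x e2"
    have "W > 0" unfolding W_def using pos 1 2 zV nz inV by (intro add_pos_pos) auto
    moreover have "2 * W \<le> \<rho> * W" unfolding W_def using 1 2 3 4 by (simp add: distrib_left mult.left_commute[of \<rho>])
    ultimately have "2 \<le> \<rho>" by simp
    moreover have "even (card V)" using p by presburger
    moreover have "4 \<le> card V"
    proof -
      have "z \<noteq> n1" "z \<noteq> n2" "z \<noteq> n3" using nz irr by blast+
      then have "card {z, n1, n2, n3} = 4" using n by simp
      moreover have "{z, n1, n2, n3} \<subseteq> V" using nz inV by blast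
      ultimately show ?thesis using card_mono[OF fin] by metis
    qed
    ultimately obtain E' S' where "simple_graph V E'" "conn V E'" "adj_spectral_radius (mk_graph V E') < 2"
      "S' \<subseteq> V" "indep E' S'" "2 * card S' = card V + 2" using D_tree_competitor[OF fin] by blast
    then show ?thesis using no_improvement[of E' S'] p \<open>2 \<le> \<rho>\<close> by auto
  qed
qed

end

section \<open>Subdivided trees\<close>

lemma vwalk_mk_graph:
  "vwalk p (with_proj (mk_graph V E)) \<longleftrightarrow> set p \<subseteq> V \<and> set (vwalk_arcs p) \<subseteq> E \<and> p \<noteq> []"
  by (simp add: vwalk_def)

lemma relpow_vwalk:
  assumes "E \<subseteq> V \<times> V" "u \<in> V" "(u, w) \<in> E ^^ k"
  shows "\<exists>p. vwalk p (with_proj (mk_graph V E)) \<and> hd p = u \<and> last p = w \<and> vwalk_length p = k"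
  using assms(2,3)
proof (induction k arbitrary: u)
  case 0
  then show ?case by (intro exI[of _ "[u]"]) (auto simp: vwalk_mk_graph)
next
  case (Suc k)
  then obtain u' where u': "(u, u') \<in> E" "(u', w) \<in> E ^^ k" by (metis relpow_Suc_D2)
  then have "u' \<in> V" using assms(1) by auto
  then obtain p where p: "vwalk p (with_proj (mk_graph V E))" "hd p = u'" "last p = w" "vwalk_length p = k"
    using Suc.IH u' by blast
  then obtain q where q: "p = u' # q" by (cases p) (auto simp: vwalk_mk_graph)
  show ?case using p u' Suc.prems unfolding q
    by (intro exI[of _ "u # u' # q"]) (auto simp: vwalk_mk_graph)
qed

lemma vwalk_lipschitz:
  fixes \<phi> :: "'a \<Rightarrow> nat"
  assumes "\<And>u v. (u, v) \<in> E \<Longrightarrow> \<phi> v \<le> Suc (\<phi> u)" "vwalk p (with_proj (mk_graph V E))"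
  shows "\<phi> (last p) \<le> \<phi> (hd p) + vwalk_length p"
  using assms(2)
proof (induction p rule: vwalk_arcs.induct)
  case (3 u v p)
  then have "\<phi> (last (v # p)) \<le> \<phi> v + vwalk_length (v # p)" "(u, v) \<in> E"
    by (auto simp: vwalk_mk_graph)
  then show ?case using assms(1)[of u v] by auto
qed (auto simp: vwalk_mk_graph)

lemma graph_dist_le:
  assumes "E \<subseteq> V \<times> V" "u \<in> V" "(u, w) \<in> E ^^ k"
  shows "graph_dist (mk_graph V E) u w \<le> k"
  unfolding graph_dist_def by (rule Least_le) (rule relpow_vwalk[OF assms])

text \<open>A potential that grows by at most 1 along each edge bounds distances from below without
  any knowledge of shortest walks.\<close>

lemma graph_dist_ge:
  fixes \<phi> :: "'a \<Rightarrow> nat"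
  assumes "\<And>u v. (u, v) \<in> E \<Longrightarrow> \<phi> v \<le> Suc (\<phi> u)"
    and E: "E \<subseteq> V \<times> V" "conn V E" "u \<in> V" "w \<in> V"
  shows "\<phi> w \<le> \<phi> u + graph_dist (mk_graph V E) u w"
proof -
  have "(u, w) \<in> E\<^sup>*" using E by (auto simp: conn_def)
  then obtain k where k: "(u, w) \<in> E ^^ k" by (auto simp: rtrancl_power)
  have "\<exists>p. vwalk p (with_proj (mk_graph V E)) \<and> hd p = u \<and> last p = w \<and>
    vwalk_length p = graph_dist (mk_graph V E) u w"
    unfolding graph_dist_def using relpow_vwalk[OF E(1,3) k] by (rule LeastI)
  then obtain p where p: "vwalk p (with_proj (mk_graph V E))" "hd p = u" "last p = w"
    "vwalk_length p = graph_dist (mk_graph V E) u w" by blast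
  show ?thesis using vwalk_lipschitz[OF assms(1) p(1)] p by simp
qed

text \<open>
  \<open>K\<close> and \<open>W\<close> are going to be the even and the odd vertices, and \<open>L\<close> is $L(T)$; the main tree is
  \<open>(V', E')\<close> below.
\<close>

locale subdivided_tree = perron_tree +
  fixes K W L :: "'a set"
  assumes V_eq: "V = K \<union> W \<union> L" and KW: "K \<inter> W = {}" and KL: "K \<inter> L = {}" and WL: "W \<inter> L = {}"
    and W_nbrs: "w \<in> W \<Longrightarrow> E `` {w} \<subseteq> K" and W_deg: "w \<in> W \<Longrightarrow> deg E w = 2"
    and L_nbrs: "l \<in> L \<Longrightarrow> E `` {l} \<subseteq> K" and L_deg: "l \<in> L \<Longrightarrow> deg E l = 1"
    and K_nbrs: "k \<in> K \<Longrightarrow> E `` {k} \<subseteq> W \<union> L" and K_ne: "K \<noteq> {}"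
begin

lemma K_nbr: "k \<in> K \<Longrightarrow> (k, u) \<in> E \<Longrightarrow> u \<in> W \<union> L"
  and W_nbr: "w \<in> W \<Longrightarrow> (w, u) \<in> E \<Longrightarrow> u \<in> K"
  and L_nbr_K: "l \<in> L \<Longrightarrow> (l, u) \<in> E \<Longrightarrow> u \<in> K"
  using K_nbrs W_nbrs L_nbrs by blast+

definition V' :: "'a set" where "V' = K \<union> W"

definition E' :: "('a \<times> 'a) set" where "E' = E \<inter> V' \<times> V'"

lemma E'V': "E' \<subseteq> V' \<times> V'" by (auto simp: E'_def)

lemma symE': "sym E'" using Esym by (auto simp: E'_def sym_def)

lemma finK: "finite K" and finW: "finite W" and finL: "finite L" and finV': "finite V'"
  using fin V_eq by (auto simp: V'_def)

lemma edge_KW: "(u, v) \<in> E' \<Longrightarrow> u \<in> K \<and> v \<in> W \<or> u \<in> W \<and> v \<in> K"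
  using K_nbr[of u v] W_nbr[of u v] KL WL KW by (auto simp: E'_def V'_def)

lemma W_nbrs': "w \<in> W \<Longrightarrow> E' `` {w} = E `` {w}"
  using W_nbrs by (auto simp: E'_def V'_def)

lemma L_nbr: "l \<in> L \<Longrightarrow> \<exists>u\<in>K. E `` {l} = {u}"
  using L_deg L_nbrs by (fastforce simp: card_1_singleton_iff)

lemma W_not_three:
  assumes "w \<in> W" "(w, a) \<in> E" "(w, b) \<in> E" "(w, c) \<in> E"
  shows "a = b \<or> a = c \<or> b = c"
proof (rule ccontr)
  assume "\<not> ?thesis"
  then have "card {a, b, c} = 3" by auto
  moreover have "card {a, b, c} \<le> deg E w" using assms finN by (intro card_mono) auto
  ultimately show False using W_deg[OF assms(1)] by simp
qed

text \<open>A walk in the whole tree must leave a vertex of \<open>L\<close> through the neighbour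
  by which it came. The invariant for such a vertex therefore speaks of its neighbours, and the
  detour can be cut out.\<close>

lemma conn': "conn V' E'"
  unfolding conn_def
proof (intro ballI)
  fix u v assume uv: "u \<in> V'" "v \<in> V'"
  have "(u, v) \<in> E\<^sup>*" using con uv V_eq by (auto simp: conn_def V'_def)
  then have "(v \<notin> L \<longrightarrow> (u, v) \<in> E'\<^sup>*) \<and> (v \<in> L \<longrightarrow> (\<forall>y. (v, y) \<in> E \<longrightarrow> (u, y) \<in> E'\<^sup>*))"
  proof (induction rule: rtrancl_induct)
    case base
    then show ?case using uv KL WL by (auto simp: V'_def)
  next
    case (step y y')
    have yy: "y \<in> V" "y' \<in> V" "(y', y) \<in> E" using step inV Esym by blast+
    show ?case
    proof (cases "y \<in> L")
      case True
      then have "y' \<in> K" using L_nbrs step by auto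
      then show ?thesis using True step KL by auto
    next
      case False
      then have uy: "(u, y) \<in> E'\<^sup>*" using step by simp
      show ?thesis
      proof (cases "y' \<in> L")
        case True
        then obtain u' where "E `` {y'} = {u'}" using L_nbr by blast
        then have "z = y" if "(y', z) \<in> E" for z using that yy(3) by (metis Image_singleton_iff singletonD)
        then show ?thesis using True uy by blast
      next
        case False
        then have "(y, y') \<in> E'" using \<open>y \<notin> L\<close> yy step V_eq by (auto simp: E'_def V'_def)
        then show ?thesis using False uy by (auto intro: rtrancl_into_rtrancl)
      qed
    qed
  qed
  then show "(u, v) \<in> E'\<^sup>*" using uv KL WL by (auto simp: V'_def)
qed

lemma bridge': "(u, v) \<in> E' \<Longrightarrow> (u, v) \<notin> (cut E' u v)\<^sup>*"
proof
  assume uv: "(u, v) \<in> E'" and "(u, v) \<in> (cut E' u v)\<^sup>*"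
  moreover have "cut E' u v \<subseteq> cut E u v" by (auto simp: cut_def E'_def)
  ultimately have "(u, v) \<in> (cut E u v)\<^sup>*" using rtrancl_mono by blast
  then show False using bridge uv by (auto simp: E'_def)
qed

text \<open>Every edge has exactly one end in \<open>W \<union> L\<close>, so the number of edges is
  \<open>2 * card W + card L\<close>.\<close>

lemma card_W: "Suc (card W) = card K"
proof -
  have SV: "W \<union> L \<subseteq> V" "indep E (W \<union> L)" "indep E (V - (W \<union> L))"
  proof -
    show "W \<union> L \<subseteq> V" using V_eq by auto
    show "indep E (W \<union> L)" using W_nbr L_nbr_K KW KL unfolding indep_def by blast
    have "V - (W \<union> L) \<subseteq> K" using V_eq by auto
    then show "indep E (V - (W \<union> L))" using K_nbr unfolding indep_def by blast
  qed
  have "E \<inter> (V - (W \<union> L)) \<times> (V - (W \<union> L)) = {}" using SV(3) by (auto simp: indep_def)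
  then have "(\<Sum>v\<in>W \<union> L. deg E v) = card V - 1" using sum_deg_indep[OF SV(1,2)] by simp
  moreover have "(\<Sum>v\<in>W \<union> L. deg E v) = (\<Sum>v\<in>W. deg E v) + (\<Sum>v\<in>L. deg E v)"
    using finW finL WL by (simp add: sum.union_disjoint)
  moreover have "(\<Sum>v\<in>W. deg E v) = 2 * card W" using W_deg by simp
  moreover have "(\<Sum>v\<in>L. deg E v) = card L" using L_deg by simp
  moreover have "card V = card K + card W + card L"
    unfolding V_eq using finK finW finL KW KL WL
    by (subst card_Un_disjoint, auto)+
  moreover have "card K \<noteq> 0" using K_ne finK by simp
  ultimately show ?thesis by linarith
qed

end

text \<open>\<open>a\<close> and \<open>b\<close> will be two vertices at maximal distance
  \<open>d\<close>, and \<open>dep\<close> the distance to \<open>a\<close>. The assumptions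
  \<open>dist_b\<close> and \<open>dep_le\<close> say that neither end sees a vertex farther away
  than \<open>d\<close>.\<close>

locale rooted_main_tree = subdivided_tree +
  fixes a :: 'a and b :: 'a and par :: "'a \<Rightarrow> 'a" and dep :: "'a \<Rightarrow> nat" and d :: nat
  assumes a: "a \<in> V'" and b: "b \<in> V'" and d: "dep b = d"
    and dep_a: "dep a = 0"
    and par: "\<And>v. v \<in> V' \<Longrightarrow> v \<noteq> a \<Longrightarrow> (v, par v) \<in> E'"
    and dep: "\<And>v. v \<in> V' \<Longrightarrow> v \<noteq> a \<Longrightarrow> dep v = Suc (dep (par v))"
    and edge: "\<And>u v. (u, v) \<in> E' \<Longrightarrow> u \<noteq> a \<and> par u = v \<or> v \<noteq> a \<and> par v = u"
    and dist_b: "\<And>v. v \<in> V' \<Longrightarrow> graph_dist (mk_graph V' E') b v \<le> d"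
    and dep_le: "\<And>v. v \<in> V' \<Longrightarrow> dep v \<le> d"
begin

text \<open>Climbing from \<open>b\<close> to the root \<open>a\<close> and reversing the count
  makes the index on the diametral path equal to the depth.\<close>

definition v :: "nat \<Rightarrow> 'a" where "v i = (par ^^ (d - i)) b"

definition P :: "'a set" where "P = v ` {0..d}"

lemma par_V': "y \<in> V' \<Longrightarrow> y \<noteq> a \<Longrightarrow> par y \<in> V'"
  using par E'V' by blast

lemma dep_eq_0: "y \<in> V' \<Longrightarrow> dep y = 0 \<Longrightarrow> y = a"
  using dep by fastforce

lemma par_pow: "y \<in> V' \<Longrightarrow> k \<le> dep y \<Longrightarrow> (par ^^ k) y \<in> V' \<and> dep ((par ^^ k) y) = dep y - k"
proof (induction k)
  case (Suc k)
  then have IH: "(par ^^ k) y \<in> V'" "dep ((par ^^ k) y) = dep y - k" by auto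
  then have "(par ^^ k) y \<noteq> a" using Suc dep_a by auto
  then show ?case using IH par_V' dep[of "(par ^^ k) y"] Suc by auto
qed simp

lemma v_props: "i \<le> d \<Longrightarrow> v i \<in> V'" "i \<le> d \<Longrightarrow> dep (v i) = i"
  using par_pow[OF b, of "d - i"] d by (auto simp: v_def)

lemma v_d: "v d = b" by (simp add: v_def)

lemma v_0: "v 0 = a" using v_props[of 0] dep_eq_0 by simp

lemma v_inj: "inj_on v {0..d}"
  using v_props(2) by (intro inj_onI) (metis atLeastAtMost_iff)

lemma par_v: "i < d \<Longrightarrow> par (v (Suc i)) = v i"
proof -
  assume "i < d"
  then have "d - i = Suc (d - Suc i)" by simp
  then show ?thesis by (simp add: v_def)
qed

lemma P_V': "P \<subseteq> V'" using v_props by (auto simp: P_def)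

lemma in_P_iff: "y \<in> P \<longleftrightarrow> dep y \<le> d \<and> v (dep y) = y"
proof
  assume "y \<in> P"
  then obtain i where "i \<le> d" "y = v i" by (auto simp: P_def)
  then show "dep y \<le> d \<and> v (dep y) = y" using v_props by simp
next
  assume h: "dep y \<le> d \<and> v (dep y) = y"
  then show "y \<in> P" unfolding P_def by (intro image_eqI[of _ _ "dep y"]) auto
qed

lemma a_P: "a \<in> P" using v_0 unfolding P_def by (intro image_eqI[of _ _ 0]) auto

lemma par_P: "y \<in> P \<Longrightarrow> y \<noteq> a \<Longrightarrow> par y \<in> P"
proof -
  assume y: "y \<in> P" "y \<noteq> a"
  then have "dep y \<le> d" "v (dep y) = y" using in_P_iff by auto
  moreover obtain i where "dep y = Suc i" using y dep_eq_0 P_V' by (metis not0_implies_Suc subsetD)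
  ultimately show ?thesis using par_v[of i] by (auto simp: P_def)
qed

text \<open>A vertex at distance \<open>lev y\<close> from the diametral path hangs off its vertex number \<open>base y\<close>.\<close>

definition lev :: "'a \<Rightarrow> nat" where "lev y = (LEAST m. (par ^^ m) y \<in> P)"

definition base :: "'a \<Rightarrow> nat" where "base y = dep ((par ^^ lev y) y)"

lemma lev_ex: "y \<in> V' \<Longrightarrow> (par ^^ dep y) y \<in> P"
  using par_pow[of y "dep y"] dep_eq_0 a_P by auto

lemma lev_le: "y \<in> V' \<Longrightarrow> lev y \<le> dep y"
  unfolding lev_def using lev_ex by (rule Least_le)

lemma lev_att: "y \<in> V' \<Longrightarrow> (par ^^ lev y) y \<in> P"
  unfolding lev_def using lev_ex by (rule LeastI)

lemma lev_P: "y \<in> P \<Longrightarrow> lev y = 0"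
  unfolding lev_def by (rule Least_equality) auto

lemma lev_off:
  assumes y: "y \<in> V'" "y \<notin> P"
  shows "lev y = Suc (lev (par y))" "base (par y) = base y"
proof -
  have "lev y = Suc (LEAST m. (par ^^ Suc m) y \<in> P)"
    unfolding lev_def using lev_att[OF y(1)] y(2) by (intro Least_Suc[of _ "lev y"]) auto
  then show l: "lev y = Suc (lev (par y))" by (simp add: lev_def funpow_swap1)
  show "base (par y) = base y" by (simp add: base_def l funpow_swap1)
qed

lemma dep_eq: "y \<in> V' \<Longrightarrow> dep y = base y + lev y"
  using par_pow[OF _ lev_le] lev_le by (simp add: base_def)

lemma base_P: "y \<in> P \<Longrightarrow> base y = dep y"
  by (simp add: base_def lev_P)

lemma base_le: "y \<in> V' \<Longrightarrow> base y \<le> d"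
  using lev_att in_P_iff by (auto simp: base_def)

lemma lev_0_iff: "y \<in> V' \<Longrightarrow> lev y = 0 \<longleftrightarrow> y \<in> P"
  using lev_P lev_off by fastforce

text \<open>The distance to the other end \<open>b\<close> of the diametral path; only the lower bound is needed.\<close>

definition \<phi> :: "'a \<Rightarrow> nat" where "\<phi> y = d - base y + lev y"

lemma \<phi>_step:
  assumes y: "y \<in> V'" "y \<noteq> a"
  shows "\<phi> (par y) \<le> Suc (\<phi> y)" "\<phi> y \<le> Suc (\<phi> (par y))"
proof (atomize(full), cases "y \<in> P")
  case True
  then have "base y = Suc (base (par y))" "lev y = 0" "lev (par y) = 0"
    using par_P y base_P lev_P dep by auto
  then show "\<phi> (par y) \<le> Suc (\<phi> y) \<and> \<phi> y \<le> Suc (\<phi> (par y))" by (auto simp: \<phi>_def)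
next
  case False
  then show "\<phi> (par y) \<le> Suc (\<phi> y) \<and> \<phi> y \<le> Suc (\<phi> (par y))"
    using lev_off[OF y(1)] by (auto simp: \<phi>_def)
qed

text \<open>\<open>\<phi>\<close> bounds the distance to \<open>b\<close> from below, so it is at
  most \<open>d\<close>. In other words, a branch is no longer than the stretch of the diametral
  path from its foot back to \<open>a\<close>.\<close>

lemma lev_le_base: "y \<in> V' \<Longrightarrow> lev y \<le> base y"
proof -
  assume y: "y \<in> V'"
  have lip: "\<phi> w \<le> Suc (\<phi> u)" if "(u, w) \<in> E'" for u w
  proof -
    have "u \<in> V'" "w \<in> V'" using that E'V' by auto
    then show ?thesis using edge[OF that] \<phi>_step by blast
  qed
  have bP: "b \<in> P" using v_d unfolding P_def by (intro image_eqI[of _ _ d]) auto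
  then have "\<phi> b = 0" using base_P lev_P d by (simp add: \<phi>_def)
  then have "\<phi> y \<le> d"
    using graph_dist_ge[of E' \<phi> V' b y, OF lip E'V' conn' b y] dist_b[OF y] by simp
  then show ?thesis using base_le[OF y] by (simp add: \<phi>_def)
qed

lemma base_lev_le: "y \<in> V' \<Longrightarrow> base y + lev y \<le> d"
  using dep_le dep_eq by fastforce

lemma W_second_nbr:
  assumes "w \<in> W"
  obtains y where "(w, y) \<in> E'" "y \<noteq> u"
proof -
  have "\<not> E' `` {w} \<subseteq> {u}"
    using W_deg[OF assms] W_nbrs'[OF assms] card_mono[of "{u}" "E `` {w}"] by auto
  then show ?thesis using that by blast
qed

text \<open>A vertex of \<open>W\<close> has two neighbours in the main tree. At \<open>a\<close>
  the second one would hang off the end of the diametral path, at level 1 with base 0; at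
  \<open>b\<close>, in \<open>b_K\<close>, it would be deeper than \<open>d\<close>.\<close>

lemma a_K: "a \<in> K"
proof (rule ccontr)
  assume "a \<notin> K"
  then have aW: "a \<in> W" using a by (auto simp: V'_def)
  obtain y where y: "(a, y) \<in> E'" "y \<noteq> v 1" by (rule W_second_nbr[OF aW])
  have yV: "y \<in> V'" using y E'V' by auto
  have py: "y \<noteq> a" "par y = a" using edge[OF y(1)] by auto
  then have dy: "dep y = 1" using dep[OF yV] dep_a by simp
  then have "y \<notin> P" using y(2) in_P_iff by auto
  then have "lev y = 1" "base y = 0" using lev_off[OF yV] py lev_P[OF a_P] base_P[OF a_P] dep_a by auto
  then show False using lev_le_base[OF yV] by simp
qed

lemma K_iff_even: "y \<in> V' \<Longrightarrow> y \<in> K \<longleftrightarrow> even (dep y)"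
proof (induction "dep y" arbitrary: y)
  case 0
  then show ?case using dep_eq_0 a_K by auto
next
  case (Suc k)
  then have ya: "y \<noteq> a" using dep_a by auto
  have p: "par y \<in> V'" "dep y = Suc (dep (par y))" using Suc ya par_V' dep by auto
  have "y \<in> K \<longleftrightarrow> par y \<notin> K" using edge_KW[OF par[OF Suc(3) ya]] KW by auto
  then show ?case using Suc p by auto
qed

lemma b_K: "b \<in> K"
proof (rule ccontr)
  assume bK: "b \<notin> K"
  then have bW: "b \<in> W" using b by (auto simp: V'_def)
  have ba: "b \<noteq> a" using bK a_K by auto
  obtain y where y: "(b, y) \<in> E'" "y \<noteq> par b" by (rule W_second_nbr[OF bW])
  have yV: "y \<in> V'" using y E'V' by auto
  have "y \<noteq> a" "par y = b" using edge[OF y(1)] y(2) by auto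
  then have "dep y = Suc d" using dep[OF yV] d by simp
  then show False using dep_le[OF yV] by simp
qed

lemma even_d: "even d" using K_iff_even[OF b] b_K d by simp

text \<open>These become the vertices \<open>y s j\<close>; the vertices \<open>x s j\<close> are
  their parents, which are exactly the vertices of \<open>W\<close> off the diametral path.\<close>

definition Y :: "'a set" where "Y = K - P"

lemma Y_props:
  assumes y: "y \<in> Y"
  shows "y \<in> V'" "y \<noteq> a" "par y \<in> W" "par y \<notin> P" "par y \<noteq> a" "par (par y) \<in> K" "lev y = 2 + lev (par (par y))"
proof -
  show yV: "y \<in> V'" using y by (auto simp: Y_def V'_def)
  show ya: "y \<noteq> a" using y a_P by (auto simp: Y_def)
  have yK: "y \<in> K" "y \<notin> P" using y by (auto simp: Y_def)
  note e = par[OF yV ya]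
  show pW: "par y \<in> W" using edge_KW[OF e] yK KW by auto
  show pa: "par y \<noteq> a" using pW a_K KW by auto
  have pV: "par y \<in> V'" using par_V' yV ya by auto
  note e2 = par[OF pV pa]
  show ppK: "par (par y) \<in> K" using edge_KW[OF e2] pW KW by auto
  \<comment> \<open>A vertex of \<open>W\<close> on the path is no end of it, so both of its
    neighbours are path vertices and none is left for \<open>y\<close>.\<close>
  show pP: "par y \<notin> P"
  proof
    assume p: "par y \<in> P"
    define i where "i = dep (par y)"
    have i: "i \<le> d" "v i = par y" using p in_P_iff by (auto simp: i_def)
    have "v d \<noteq> par y" using v_d b_K pW KW by auto
    then have id: "i < d" using i by (metis le_neq_implies_less)
    have "v (Suc i) \<in> V'" "v (Suc i) \<noteq> a" using v_props[of "Suc i"] id dep_a by auto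
    then have "(v (Suc i), par y) \<in> E'" using par[of "v (Suc i)"] par_v[OF id] i by simp
    then have "(par y, v (Suc i)) \<in> E" "(par y, y) \<in> E" "(par y, par (par y)) \<in> E"
      using e e2 Esym by (auto simp: E'_def)
    then have "v (Suc i) = y \<or> v (Suc i) = par (par y) \<or> y = par (par y)"
      using W_not_three[OF pW] by blast
    moreover have "v (Suc i) \<noteq> y" using id yK by (auto simp: P_def)
    moreover have "dep (v (Suc i)) \<noteq> dep (par (par y))"
      using v_props[of "Suc i"] id dep[OF pV pa] i_def by auto
    moreover have "dep y \<noteq> dep (par (par y))" using dep[OF yV ya] dep[OF pV pa] by simp
    ultimately show False by auto
  qed
  show "lev y = 2 + lev (par (par y))" using lev_off(1)[OF yV yK(2)] lev_off(1)[OF pV pP] by simp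
qed

lemma par_inj_Y: "inj_on par Y"
proof (rule inj_onI)
  fix y z assume y: "y \<in> Y" and z: "z \<in> Y" and e: "par y = par z"
  note py = Y_props[OF y] and pz = Y_props[OF z]
  have pV: "par y \<in> V'" using par_V' py by auto
  have "(par y, y) \<in> E" "(par y, z) \<in> E" "(par y, par (par y)) \<in> E"
    using par[OF py(1,2)] par[OF pz(1,2)] par[OF pV py(5)] e Esym by (auto simp: E'_def)
  then have "y = z \<or> y = par (par y) \<or> z = par (par y)" using W_not_three[OF py(3)] by blast
  moreover have "dep y \<noteq> dep (par (par y))" "dep z \<noteq> dep (par (par y))"
    using dep[OF py(1,2)] dep[OF pz(1,2)] dep[OF pV py(5)] e by simp_all
  ultimately show "y = z" by auto
qed

lemma par_Y: "par ` Y = W - P"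
proof
  show "par ` Y \<subseteq> W - P" using Y_props by auto
  show "W - P \<subseteq> par ` Y"
  proof
    fix w assume w: "w \<in> W - P"
    obtain y where y: "(w, y) \<in> E'" "y \<noteq> par w" using W_second_nbr[of w "par w"] w by auto
    have wa: "w \<noteq> a" using w a_K KW by auto
    have yy: "y \<noteq> a" "par y = w" using edge[OF y(1)] y(2) by auto
    have "y \<in> K" using edge_KW[OF y(1)] w KW by auto
    moreover have "y \<notin> P" using par_P yy w by auto
    ultimately have "y \<in> Y" by (simp add: Y_def)
    then show "w \<in> par ` Y" using yy by auto
  qed
qed

lemma lev_Y_even: "y \<in> Y \<Longrightarrow> even (lev y) \<and> lev y \<ge> 2"
proof (induction "lev y" arbitrary: y rule: less_induct)
  case less
  note p = Y_props[OF less(2)]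
  show ?case
  proof (cases "par (par y) \<in> P")
    case True
    then show ?thesis using p(7) lev_P by simp
  next
    case False
    then have "par (par y) \<in> Y" using p by (simp add: Y_def)
    then show ?thesis using less(1)[of "par (par y)"] p(7) by simp
  qed
qed

definition Ys :: "nat \<Rightarrow> 'a set" where "Ys s = {y \<in> Y. lev y = 2 * s}"

text \<open>The inserted 0 gives \<open>h = 0\<close> when nothing hangs off the diametral
  path.\<close>

definition h :: nat where "h = Max (insert 0 (lev ` Y)) div 2"

definition t :: "nat \<Rightarrow> nat" where "t s = card (Ys s)"

lemma finY: "finite Y" using finK by (simp add: Y_def)

lemma Y_in_Ys: "y \<in> Y \<Longrightarrow> \<exists>s\<in>{1..h}. y \<in> Ys s"
proof -
  assume y: "y \<in> Y"
  then have "lev y \<le> Max (insert 0 (lev ` Y))" using finY by (intro Max_ge) auto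
  then have "lev y div 2 \<le> h" unfolding h_def by (rule div_le_mono)
  then show ?thesis using lev_Y_even[OF y] y by (intro bexI[of _ "lev y div 2"]) (auto simp: Ys_def)
qed

lemma Ys_h: "h \<ge> 1 \<Longrightarrow> Ys h \<noteq> {}"
proof -
  assume h1: "h \<ge> 1"
  have "Max (insert 0 (lev ` Y)) \<in> insert 0 (lev ` Y)" using finY by (intro Max_in) auto
  moreover have "Max (insert 0 (lev ` Y)) \<noteq> 0" using h1 by (auto simp: h_def)
  ultimately obtain y where y: "y \<in> Y" "Max (insert 0 (lev ` Y)) = lev y" by auto
  then have "lev y = 2 * h" using lev_Y_even[OF y(1)] by (simp add: h_def)
  then show ?thesis using y by (auto simp: Ys_def)
qed

lemma Ys_down: "y \<in> Ys (Suc s) \<Longrightarrow> s \<ge> 1 \<Longrightarrow> par (par y) \<in> Ys s"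
proof -
  assume y: "y \<in> Ys (Suc s)" and s: "s \<ge> 1"
  then have yY: "y \<in> Y" "lev y = 2 * Suc s" by (auto simp: Ys_def)
  note p = Y_props[OF yY(1)]
  have "lev (par (par y)) = 2 * s" using p(7) yY by simp
  moreover from this have "par (par y) \<notin> P" using lev_P s by fastforce
  ultimately show ?thesis using p by (simp add: Ys_def Y_def)
qed

text \<open>No layer is skipped: the grandparent of a vertex in one layer lies in the layer below,
  so nonemptiness descends from the topmost layer.\<close>

lemma Ys_ne: "1 \<le> s \<Longrightarrow> s \<le> h \<Longrightarrow> Ys s \<noteq> {}"
proof (induction "h - s" arbitrary: s)
  case 0
  then show ?case using Ys_h by simp
next
  case (Suc k)
  then have "Ys (Suc s) \<noteq> {}" by auto
  then show ?case using Ys_down Suc by blast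
qed

lemma Ys_1: "y \<in> Ys 1 \<Longrightarrow> par (par y) \<in> P"
proof -
  assume "y \<in> Ys 1"
  then have y: "y \<in> Y" "lev y = 2" by (auto simp: Ys_def)
  note p = Y_props[OF y(1)]
  have "lev (par (par y)) = 0" using p(7) y by simp
  moreover have "par (par y) \<in> V'" using p by (auto simp: V'_def)
  ultimately show ?thesis using lev_0_iff by blast
qed

text \<open>A vertex of the top layer has level \<open>2 * h\<close>, and its foot is at least that
  far from both ends of the diametral path.\<close>

lemma h_le: "4 * h \<le> d"
proof (cases "h = 0")
  case False
  then obtain y where "y \<in> Ys h" using Ys_h by auto
  then have y: "y \<in> Y" "lev y = 2 * h" by (auto simp: Ys_def)
  then have "y \<in> V'" using Y_props by blast
  then show ?thesis using lev_le_base[of y] base_lev_le[of y] y by linarith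
qed simp

text \<open>The path contributes its \<open>d div 2 + 1\<close> vertices of even index to
  \<open>K\<close>. With \<open>card K\<close> equal to n - \<alpha>, this is the equation for the
  sum of the t_s.\<close>

lemma card_Y: "card K = card Y + (d div 2 + 1)"
proof -
  have "K \<inter> P = v ` ((\<lambda>i. 2 * i) ` {0..d div 2})"
  proof
    show "K \<inter> P \<subseteq> v ` ((\<lambda>i. 2 * i) ` {0..d div 2})"
    proof
      fix y assume y: "y \<in> K \<inter> P"
      then have "even (dep y)" "dep y \<le> d" "v (dep y) = y"
        using K_iff_even in_P_iff by (auto simp: V'_def)
      then obtain k where "dep y = 2 * k" "v (2 * k) = y" "k \<le> d div 2" by auto
      then show "y \<in> v ` ((\<lambda>i. 2 * i) ` {0..d div 2})" by force
    qed
    show "v ` ((\<lambda>i. 2 * i) ` {0..d div 2}) \<subseteq> K \<inter> P"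
    proof
      fix y assume "y \<in> v ` ((\<lambda>i. 2 * i) ` {0..d div 2})"
      then obtain i where i: "y = v (2 * i)" "2 * i \<le> d" by auto
      then show "y \<in> K \<inter> P" using v_props[of "2 * i"] K_iff_even by (auto simp: P_def)
    qed
  qed
  moreover have "inj_on v ((\<lambda>i. 2 * i) ` {0..d div 2})" by (rule inj_on_subset[OF v_inj]) auto
  ultimately have "card (K \<inter> P) = d div 2 + 1" by (simp add: card_image inj_on_def)
  moreover have "card K = card (K - P) + card (K \<inter> P)"
    using finK by (metis Int_commute add.commute card_Int_Diff)
  ultimately show ?thesis by (simp add: Y_def)
qed

lemma main_tree_member:
  assumes n: "card K + \<alpha> = n" and diam: "graph_diameter (mk_graph V' E') = d"
  shows "mk_graph V' E' \<in> main_trees n \<alpha>"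
proof -
  have finYs: "finite (Ys s)" for s using finY by (simp add: Ys_def)
  have "\<forall>s. \<exists>f. bij_betw f {1..t s} (Ys s)"
    unfolding t_def using ex_bij_betw_nat_finite_1[OF finYs] by blast
  then obtain yy where yy: "\<And>s. bij_betw (yy s) {1..t s} (Ys s)" by metis
  define I where "I = (SIGMA s:{1..h}. {1..t s})"
  define xx where "xx = (\<lambda>s j. par (yy s j))"
  \<comment> \<open>For \<open>s = 1\<close> the foot is named by its depth, which is its index on
    the path; in higher layers by its position in the enumeration of the layer below.\<close>
  define p where "p = (\<lambda>s j. if s = 1 then dep (par (xx s j))
    else inv_into {1..t (s - 1)} (yy (s - 1)) (par (xx s j)))"
  have yI: "yy s j \<in> Ys s" if "(s, j) \<in> I" for s j
    using that bij_betwE[OF yy[of s]] by (auto simp: I_def)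
  have yY: "yy s j \<in> Y" if "(s, j) \<in> I" for s j using yI[OF that] by (simp add: Ys_def)
  have y_img: "case_prod yy ` I = Y"
  proof
    show "case_prod yy ` I \<subseteq> Y" using yY by auto
    show "Y \<subseteq> case_prod yy ` I"
    proof
      fix y assume "y \<in> Y"
      then obtain s where s: "s \<in> {1..h}" "y \<in> Ys s" using Y_in_Ys by blast
      then obtain j where "j \<in> {1..t s}" "yy s j = y" using yy[of s] by (metis bij_betw_imp_surj_on imageE)
      then show "y \<in> case_prod yy ` I" using s by (intro image_eqI[of _ _ "(s, j)"]) (auto simp: I_def)
    qed
  qed
  have y_inj: "inj_on (case_prod yy) I"
  proof (rule inj_onI)
    fix e f assume ef: "e \<in> I" "f \<in> I" "case_prod yy e = case_prod yy f"
    obtain s j s' j' where e: "e = (s, j)" "f = (s', j')" by (metis surj_pair)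
    have eq: "yy s j = yy s' j'" using ef e by simp
    have "yy s j \<in> Ys s" "yy s' j' \<in> Ys s'" using yI[of s j] yI[of s' j'] ef(1,2) e by simp_all
    then have ss: "s = s'" using eq by (simp add: Ys_def)
    have "j \<in> {1..t s}" "j' \<in> {1..t s}" using ef(1,2) e ss by (simp_all add: I_def)
    then have "j = j'" using inj_onD[OF bij_betw_imp_inj_on[OF yy[of s]], of j j'] eq ss by simp
    then show "e = f" using e ss by simp
  qed
  have x_img: "case_prod xx ` I = W - P"
  proof -
    have "case_prod xx ` I = par ` (case_prod yy ` I)" by (force simp: xx_def)
    then show ?thesis using y_img par_Y by simp
  qed
  have x_inj: "inj_on (case_prod xx) I"
  proof -
    have "case_prod xx = par \<circ> case_prod yy" by (auto simp: xx_def)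
    then show ?thesis using y_inj y_img par_inj_Y by (simp add: comp_inj_on)
  qed
  have v_img: "v ` {0..d} = P" by (simp add: P_def)
  have t1: "\<forall>s\<in>{1..h}. t s \<ge> 1"
    using Ys_ne finYs by (auto simp: t_def Suc_le_eq card_gt_0_iff)
  have disj: "v ` {0..d} \<inter> case_prod xx ` I = {}" "v ` {0..d} \<inter> case_prod yy ` I = {}"
    "case_prod xx ` I \<inter> case_prod yy ` I = {}"
    unfolding v_img x_img y_img using KW by (auto simp: Y_def)
  have p1: "p 1 j \<in> {0..d} - {0, d} \<and> even (p 1 j) \<and> v (p 1 j) = par (xx 1 j)" if "(1, j) \<in> I" for j
  proof -
    let ?y = "yy 1 j"
    have y: "?y \<in> Ys 1" "?y \<in> Y" using yI[OF that] yY[OF that] by auto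
    have l: "lev ?y = 2" using y by (simp add: Ys_def)
    note q = Y_props[OF y(2)]
    have P: "par (par ?y) \<in> P" using Ys_1[OF y(1)] .
    have pV: "par ?y \<in> V'" using par_V' q by auto
    have "dep ?y = dep (par (par ?y)) + 2" using dep[OF q(1,2)] dep[OF pV q(5)] by simp
    then have "base ?y = dep (par (par ?y))" using dep_eq[OF q(1)] l by simp
    then have "2 \<le> dep (par (par ?y))" "dep (par (par ?y)) + 2 \<le> d"
      using lev_le_base[OF q(1)] base_lev_le[OF q(1)] l by auto
    moreover have "even (dep (par (par ?y)))" using K_iff_even[of "par (par ?y)"] q(6) by (auto simp: V'_def)
    ultimately show ?thesis using P in_P_iff by (auto simp: p_def xx_def)
  qed
  have p2: "p s j \<in> {1..t (s - 1)} \<and> yy (s - 1) (p s j) = par (xx s j)" if "(s, j) \<in> I" "s \<ge> 2" for s j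
  proof -
    have "yy s j \<in> Ys (Suc (s - 1))" using yI[OF that(1)] that(2) by simp
    then have "par (xx s j) \<in> Ys (s - 1)" using Ys_down that(2) by (simp add: xx_def)
    then have m: "par (xx s j) \<in> yy (s - 1) ` {1..t (s - 1)}" using yy[of "s - 1"] by (simp add: bij_betw_def)
    have "p s j = inv_into {1..t (s - 1)} (yy (s - 1)) (par (xx s j))" using that(2) by (simp add: p_def)
    then show ?thesis using inv_into_into[OF m] f_inv_into_f[OF m] by simp
  qed
  define R where "R = {(v i, v (Suc i)) | i. i < d} \<union>
               {(xx s j, yy s j) | s j. (s, j) \<in> I} \<union>
               {(xx 1 j, v (p 1 j)) | j. (1, j) \<in> I} \<union>
               {(xx s j, yy (s - 1) (p s j)) | s j. (s, j) \<in> I \<and> s \<ge> 2}"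
  \<comment> \<open>Every edge joins a vertex to its parent, so it suffices to find these arcs, in
    either direction, in \<open>R\<close>.\<close>
  have up: "(c, par c) \<in> R \<union> R\<inverse>" if c: "c \<in> V'" "c \<noteq> a" for c
  proof -
    consider "c \<in> P" | "c \<in> Y" | "c \<in> W - P" using c by (auto simp: V'_def Y_def)
    then show ?thesis
    proof cases
      case 1
      obtain i where i: "dep c = Suc i" using dep[OF c] by simp
      then have "v (Suc i) = c" "i < d" using 1 in_P_iff[of c] by auto
      then have "(par c, c) \<in> R" using par_v[of i] unfolding R_def by auto
      then show ?thesis by auto
    next
      case 2
      then obtain s j where "(s, j) \<in> I" "c = yy s j" using y_img by force
      then have "(par c, c) \<in> R" unfolding R_def by (auto simp: xx_def)
      then show ?thesis by auto
    next
      case 3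
      then obtain s j where sj: "(s, j) \<in> I" "c = xx s j" using x_img by force
      show ?thesis
      proof (cases "s = 1")
        case True
        then show ?thesis using sj p1[of j] unfolding R_def by fastforce
      next
        case False
        then have "s \<ge> 2" using sj by (auto simp: I_def)
        then have "(xx s j, yy (s - 1) (p s j)) \<in> R" using sj unfolding R_def by blast
        then show ?thesis using p2[OF sj(1) \<open>s \<ge> 2\<close>] sj by auto
      qed
    qed
  qed
  have x_up: "(xx s j, par (xx s j)) \<in> E'" "(xx s j, yy s j) \<in> E'" if "(s, j) \<in> I" for s j
  proof -
    note q = Y_props[OF yY[OF that]]
    have "par (yy s j) \<in> V'" using par_V' q by auto
    then show "(xx s j, par (xx s j)) \<in> E'" using par q by (simp add: xx_def)
    show "(xx s j, yy s j) \<in> E'" using par[OF q(1,2)] symE' by (auto simp: xx_def sym_def)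
  qed
  have R_sub: "R \<subseteq> E'"
  proof (rule subrelI)
    fix u w assume "(u, w) \<in> R"
    then consider i where "i < d" "u = v i" "w = v (Suc i)" | s j where "(s, j) \<in> I" "u = xx s j" "w = yy s j"
      | j where "(1, j) \<in> I" "u = xx 1 j" "w = v (p 1 j)"
      | s j where "(s, j) \<in> I" "s \<ge> 2" "u = xx s j" "w = yy (s - 1) (p s j)"
      unfolding R_def by blast
    then show "(u, w) \<in> E'"
    proof cases
      case 1
      have "v (Suc i) \<in> V'" "v (Suc i) \<noteq> a" using v_props[of "Suc i"] 1 dep_a by auto
      then have "(w, u) \<in> E'" using par[of "v (Suc i)"] par_v[OF 1(1)] 1 by simp
      then show ?thesis using symE' by (auto simp: sym_def)
    next
      case 2 then show ?thesis using x_up by blast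
    next
      case 3 then show ?thesis using x_up(1)[OF 3(1)] p1[OF 3(1)] by simp
    next
      case 4 then show ?thesis using x_up(1)[OF 4(1)] p2[OF 4(1,2)] by simp
    qed
  qed
  have "E' = R \<union> R\<inverse>"
  proof
    show "E' \<subseteq> R \<union> R\<inverse>"
    proof (rule subrelI)
      fix u w assume uw: "(u, w) \<in> E'"
      then have "u \<in> V'" "w \<in> V'" using E'V' by auto
      then show "(u, w) \<in> R \<union> R\<inverse>" using edge[OF uw] up[of u] up[of w] by auto
    qed
    show "R \<union> R\<inverse> \<subseteq> E'" using R_sub symE' by (auto simp: sym_def)
  qed
  moreover have "V' = v ` {0..d} \<union> case_prod xx ` I \<union> case_prod yy ` I"
    unfolding v_img x_img y_img using P_V' by (auto simp: V'_def Y_def)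
  ultimately have T: "mk_graph V' E' = ugraph (v ` {0..d} \<union> case_prod xx ` I \<union> case_prod yy ` I) R"
    by (simp add: ugraph_def)
  have card_I: "card I = card Y" using y_inj y_img card_image by fastforce
  moreover have "card I = (\<Sum>s = 1..h. t s)" unfolding I_def by (subst card_SigmaI) auto
  ultimately have sum_t: "(\<Sum>s = 1..h. t s) = card Y" by simp
  have cK: "int n - int \<alpha> - 1 - int d div 2 = int (card Y)"
  proof -
    have "int d div 2 = int (d div 2)" by (simp add: zdiv_int)
    then show ?thesis using card_Y n by linarith
  qed
  have d_even: "d = 2 * (d div 2)" using even_d by simp
  have "h \<le> card Y"
  proof -
    have "(\<Sum>s = 1..h. 1) \<le> (\<Sum>s = 1..h. t s)" using t1 by (intro sum_mono) auto
    then show ?thesis using sum_t by simp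
  qed
  moreover have "int h \<le> \<lfloor>real d / 4\<rfloor>" using h_le by (simp add: le_floor_iff)
  ultimately have h_bound: "int h \<le> min (int n - int \<alpha> - 1 - int d div 2) \<lfloor>real d / 4\<rfloor>"
    unfolding cK by simp
  have big: "d \<ge> 4" if "card Y \<ge> 1"
  proof -
    have "Y \<noteq> {}" using that by auto
    then have "h \<ge> 1" using Y_in_Ys by fastforce
    then show ?thesis using h_le by simp
  qed
  have dK: "2 * card K = 2 * card Y + d + 2" using d_even card_Y by linarith
  have dK_int: "2 * (int n - int \<alpha>) = 2 * int (card Y) + int d + 2"
    unfolding n[symmetric] using arg_cong[OF dK, of int] by simp
  \<comment> \<open>Any vertex off the path forces \<open>d \<ge> 4\<close> and thereby
    \<open>card K \<ge> 4\<close>. Hence for \<open>card K \<le> 2\<close> the main tree is the path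
    itself.\<close>
  have D1: "int \<alpha> \<in> {int n - 2, int n - 1} \<longrightarrow> int d = 2 * (int n - int \<alpha>) - 2"
  proof
    assume "int \<alpha> \<in> {int n - 2, int n - 1}"
    then have k: "card K = 1 \<or> card K = 2" using n by auto
    have "card Y = 0"
    proof (rule ccontr)
      assume "card Y \<noteq> 0"
      then have "d \<ge> 4" using big by simp
      then show False using k dK by linarith
    qed
    then show "int d = 2 * (int n - int \<alpha>) - 2" using dK_int by simp
  qed
  have D2: "\<lceil>real n / 2\<rceil> \<le> int \<alpha> \<and> int \<alpha> \<le> int n - 3 \<longrightarrow> 4 \<le> int d \<and> int d \<le> 2 * (int n - int \<alpha>) - 2"
  proof
    assume "\<lceil>real n / 2\<rceil> \<le> int \<alpha> \<and> int \<alpha> \<le> int n - 3"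
    then have k: "card K \<ge> 3" using n by linarith
    have "4 \<le> d"
    proof (cases "card Y = 0")
      case True
      then show ?thesis using k dK by linarith
    next
      case False
      then show ?thesis using big by simp
    qed
    then show "4 \<le> int d \<and> int d \<le> 2 * (int n - int \<alpha>) - 2" using dK_int by simp
  qed
  have sum_int: "(\<Sum>s = 1..h. int (t s)) = int n - int \<alpha> - 1 - int d div 2"
    unfolding cK using sum_t by (metis of_nat_sum)
  have p1': "\<forall>j. (1, j) \<in> I \<longrightarrow> p 1 j \<in> {0..d} - {0, d} \<and> even (p 1 j)" using p1 by blast
  have p2': "\<forall>s j. (s, j) \<in> I \<and> s \<ge> 2 \<longrightarrow> p s j \<in> {1..t (s - 1)}" using p2 by blast
  show ?thesis
    unfolding main_trees_def
    by (intro CollectI exI[of _ d] exI[of _ h] exI[of _ t] exI[of _ v] exI[of _ xx] exI[of _ yy]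
        exI[of _ p] exI[of _ I] conjI)
      (fact I_def even_d t1 v_inj x_inj y_inj disj p1' p2' T[unfolded R_def] diam D1 D2 h_bound sum_int)+
qed

end

context subdivided_tree
begin

lemma main_tree_member:
  assumes n: "card K + \<alpha> = n"
  shows "mk_graph V' E' \<in> main_trees n \<alpha>"
proof -
  let ?G = "mk_graph V' E'"
  let ?D = "{graph_dist ?G u w | u w. u \<in> V' \<and> w \<in> V'}"
  have "?D = (\<lambda>(u, w). graph_dist ?G u w) ` (V' \<times> V')" by auto
  then have finD: "finite ?D" using finV' by simp
  have neD: "?D \<noteq> {}" using K_ne by (auto simp: V'_def)
  have diam: "graph_diameter ?G = Max ?D" by (simp add: graph_diameter_def)
  then have "graph_diameter ?G \<in> ?D" using Max_in[OF finD neD] by simp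
  then obtain a b where ab: "a \<in> V'" "b \<in> V'" "graph_dist ?G a b = graph_diameter ?G" by auto
  have le: "graph_dist ?G u w \<le> graph_diameter ?G" if "u \<in> V'" "w \<in> V'" for u w
    unfolding diam using that finD by (intro Max_ge) auto
  have "\<exists>par dep. dep a = (0::nat) \<and>
    (\<forall>v\<in>V'. v \<noteq> a \<longrightarrow> (v, par v) \<in> E' \<and> dep v = Suc (dep (par v))) \<and>
    (\<forall>(u, v)\<in>E'. u \<noteq> a \<and> par u = v \<or> v \<noteq> a \<and> par v = u)"
    by (rule rooted_tree[OF symE' conn' E'V' _ ab(1)]) (rule bridge')
  then obtain par and dep :: "'a \<Rightarrow> nat" where pd: "dep a = 0"
    "\<forall>v\<in>V'. v \<noteq> a \<longrightarrow> (v, par v) \<in> E' \<and> dep v = Suc (dep (par v))"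
    "\<forall>(u, v)\<in>E'. u \<noteq> a \<and> par u = v \<or> v \<noteq> a \<and> par v = u"
    by (elim exE conjE) (rule that)
  have lip: "dep w \<le> Suc (dep u)" if uw: "(u, w) \<in> E'" for u w
  proof -
    have "u \<in> V'" "w \<in> V'" using uw E'V' by auto
    moreover have "u \<noteq> a \<and> par u = w \<or> w \<noteq> a \<and> par w = u" using pd(3) uw by auto
    ultimately show ?thesis using pd(2) by fastforce
  qed
  have walk: "(a, y) \<in> E' ^^ (dep y)" if "y \<in> V'" for y
    using that
  proof (induction "dep y" arbitrary: y)
    case 0
    then have "y = a" using pd(2) by fastforce
    then show ?case using pd(1) by simp
  next
    case (Suc k)
    then have ya: "y \<noteq> a" using pd(1) by auto
    then have p: "(y, par y) \<in> E'" "dep y = Suc (dep (par y))" using pd(2) Suc by auto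
    then have "(a, par y) \<in> E' ^^ (dep (par y))" using Suc E'V' by auto
    then show ?case using p symE' by (auto simp: sym_def)
  qed
  have dist: "graph_dist ?G a y = dep y" if "y \<in> V'" for y
    using graph_dist_le[OF E'V' ab(1) walk[OF that]] graph_dist_ge[of E' dep V' a y, OF lip E'V' conn' ab(1) that] pd(1) by simp
  have dep_diam: "dep y \<le> graph_diameter ?G" if "y \<in> V'" for y
    using le[OF ab(1) that] dist[OF that] by simp
  interpret rooted_main_tree V E x r K W L a b par dep "graph_diameter ?G"
    by unfold_locales (use ab pd dist le dep_diam in \<open>auto split: prod.splits\<close>)
  show ?thesis by (rule main_tree_member[OF n refl])
qed

end

section \<open>Control paths and pendant vertices\<close>

lemma set_vwalk_arcs_nth:
  "set (vwalk_arcs p) = {(p ! i, p ! Suc i) | i. Suc i < length p}"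
proof (induction p rule: vwalk_arcs.induct)
  case (3 u v p)
  have "{((u # v # p) ! i, (u # v # p) ! Suc i) | i. Suc i < length (u # v # p)} =
      insert (u, v) {((v # p) ! i, (v # p) ! Suc i) | i. Suc i < length (v # p)}" (is "?A = ?B")
  proof
    show "?A \<subseteq> ?B"
    proof
      fix e assume "e \<in> ?A"
      then obtain i where i: "e = ((u # v # p) ! i, (u # v # p) ! Suc i)" "Suc i < length (u # v # p)" by blast
      then show "e \<in> ?B" by (cases i) auto
    qed
    show "?B \<subseteq> ?A"
    proof
      fix e assume "e \<in> ?B"
      then consider "e = (u, v)" | i where "e = ((v # p) ! i, (v # p) ! Suc i)" "Suc i < length (v # p)" by blast
      then show "e \<in> ?A"
      proof cases
        case 1 then show ?thesis by (intro CollectI exI[of _ 0]) auto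
      next
        case 2 then show ?thesis by (intro CollectI exI[of _ "Suc i"]) auto
      qed
    qed
  qed
  then show ?case using 3 by simp
qed auto

lemma vwalk_mk_graph_nth:
  "vwalk p (with_proj (mk_graph V E)) \<longleftrightarrow>
    p \<noteq> [] \<and> set p \<subseteq> V \<and> (\<forall>i. Suc i < length p \<longrightarrow> (p ! i, p ! Suc i) \<in> E)"
  unfolding vwalk_mk_graph set_vwalk_arcs_nth by blast

text \<open>Reachability in graphs is \<open>rtrancl_on\<close> relative to the vertex set; as arcs
  stay inside \<open>V\<close>, it agrees with \<open>rtrancl\<close> from any vertex.\<close>

lemma rtrancl_on_iff:
  assumes "E \<subseteq> V \<times> V" "u \<in> V"
  shows "(u, v) \<in> rtrancl_on V E \<longleftrightarrow> (u, v) \<in> E\<^sup>*"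
proof
  assume "(u, v) \<in> rtrancl_on V E"
  then show "(u, v) \<in> E\<^sup>*" by (induction rule: rtrancl_on_induct) (auto intro: rtrancl_into_rtrancl)
next
  assume "(u, v) \<in> E\<^sup>*"
  then show "(u, v) \<in> rtrancl_on V E"
    by (induction rule: rtrancl_induct) (use assms in \<open>auto intro: rtrancl_on_into_rtrancl_on\<close>)
qed

lemma pair_graph_iff: "pair_graph (mk_graph V E) \<longleftrightarrow> simple_graph V E"
proof
  assume "pair_graph (mk_graph V E)"
  then interpret G: pair_graph "mk_graph V E" .
  show "simple_graph V E"
    using G.pair_finite_verts G.arc_fst_in_verts G.arc_snd_in_verts G.pair_no_loops G.pair_sym_arcs
    by (fastforce simp: simple_graph_def irrefl_def symmetric_def)
next
  assume "simple_graph V E"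
  then show "pair_graph (mk_graph V E)"
    by unfold_locales (auto simp: simple_graph_def irrefl_def symmetric_def intro: finite_subset)
qed

lemma connected_iff:
  assumes "simple_graph V E"
  shows "Digraph_Component.connected (with_proj (mk_graph V E)) \<longleftrightarrow> V \<noteq> {} \<and> conn V E"
proof -
  have E: "E \<subseteq> V \<times> V" "sym E" using assms by (auto simp: simple_graph_def)
  let ?S = "mk_symmetric (with_proj (mk_graph V E))"
  have "verts ?S = V" by (simp add: mk_symmetric_def)
  moreover have "arcs_ends ?S = E"
    using E(2) by (force simp: mk_symmetric_def arcs_ends_def arc_to_ends_def sym_def)
  ultimately show ?thesis
    unfolding connected_def strongly_connected_def reachable_def conn_def
    using rtrancl_on_iff[OF E(1)] by simp
qed

lemma independent_set_iff: "independent_set (mk_graph V E) S \<longleftrightarrow> S \<subseteq> V \<and> indep E S"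
  by (simp add: independent_set_def indep_def)

lemma independence_number_eqI:
  assumes "finite V" "S \<subseteq> V" "indep E S" "\<And>S'. S' \<subseteq> V \<Longrightarrow> indep E S' \<Longrightarrow> card S' \<le> card S"
  shows "independence_number (mk_graph V E) = card S"
  unfolding independence_number_def independent_set_iff
  using assms by (intro Max_eqI) auto

lemma independence_number_attained:
  assumes "finite V"
  obtains S where "S \<subseteq> V" "indep E S" "card S = independence_number (mk_graph V E)"
proof -
  let ?I = "{S. S \<subseteq> V \<and> indep E S}"
  have "{} \<in> ?I" by (simp add: indep_def)
  then have "Max (card ` ?I) \<in> card ` ?I" using assms by (intro Max_in) auto
  then show ?thesis using that unfolding independence_number_def independent_set_iff by auto
qed

text \<open>
  A minimizer over the larger class has independence number exactly \<open>\<alpha>\<close>, so it competes with the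
  given graph, which is therefore minimal over the larger class as well.
\<close>

lemma minimizer_extremal:
  fixes V :: "'a set"
  assumes "minimizer_graph n \<alpha> (mk_graph V E)" "n \<ge> 2" "n \<le> 2 * \<alpha>"
  shows "extremal V E \<alpha>" "card V = n"
proof -
  let ?\<rho> = "\<lambda>E. adj_spectral_radius (mk_graph V E)"
  have G: "mk_graph V E \<in> graphs_with n \<alpha>"
    using assms(1) unfolding minimizer_graph_def is_arg_min_def by blast
  have least: "?\<rho> E \<le> adj_spectral_radius H" if "H \<in> graphs_with n \<alpha>" for H :: "'a pair_pre_digraph"
    using assms(1) that unfolding minimizer_graph_def is_arg_min_def by (metis not_less)
  from G have sg: "simple_graph V E" and n: "card V = n" and ind: "independence_number (mk_graph V E) = \<alpha>"
    by (auto simp: graphs_with_def pair_graph_iff)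
  have con: "conn V E" and neV: "V \<noteq> {}" using G connected_iff[OF sg] by (auto simp: graphs_with_def)
  have fin: "finite V" using sg by (simp add: simple_graph_def)
  show "card V = n" by fact
  have exE: "\<exists>S\<subseteq>V. indep E S \<and> \<alpha> \<le> card S"
    using independence_number_attained[OF fin, of E] ind by (metis order_refl)
  let ?C = "{F. simple_graph V F \<and> conn V F \<and> (\<exists>S\<subseteq>V. indep F S \<and> \<alpha> \<le> card S)}"
  have "?C \<subseteq> Pow (V \<times> V)" by (auto simp: simple_graph_def)
  then have "finite ?C" using fin by (meson finite_Pow_iff finite_SigmaI finite_subset)
  moreover have "E \<in> ?C" using sg con exE by blast
  ultimately obtain F where F: "is_arg_min ?\<rho> (\<lambda>F. F \<in> ?C) F"
    using ex_is_arg_min_if_finite[of ?C ?\<rho>] by blast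
  then have FC: "simple_graph V F" "conn V F" "\<exists>S\<subseteq>V. indep F S \<and> \<alpha> \<le> card S"
    by (auto simp: is_arg_min_def)
  have Fmin: "?\<rho> F \<le> ?\<rho> F'" if "simple_graph V F'" "conn V F'" "S \<subseteq> V" "indep F' S" "\<alpha> \<le> card S" for F' S
    using F that unfolding is_arg_min_def by (auto simp: not_less)
  interpret F: extremal V F \<alpha>
    using FC Fmin n assms(2,3) by unfold_locales auto
  obtain S where S: "S \<subseteq> V" "indep F S" "card S = \<alpha>"
    "\<And>S'. S' \<subseteq> V \<Longrightarrow> indep F S' \<Longrightarrow> card S' \<le> \<alpha>"
    by (rule F.extremal_bipartition) blast
  have "independence_number (mk_graph V F) = \<alpha>"
    using independence_number_eqI[OF fin S(1,2)] S(3,4) by simp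
  then have "mk_graph V F \<in> graphs_with n \<alpha>"
    using FC(1,2) n neV by (simp add: graphs_with_def pair_graph_iff connected_iff)
  then have EF: "?\<rho> E \<le> ?\<rho> F" by (rule least)
  show "extremal V E \<alpha>"
  proof
    show "?\<rho> E \<le> ?\<rho> E'" if "simple_graph V E'" "conn V E'" "S \<subseteq> V" "indep E' S" "\<alpha> \<le> card S" for E' S
      using Fmin[OF that] EF by linarith
  qed (use sg con n assms exE in auto)
qed

context perron_tree
begin

lemma walk_avoiding:
  assumes "pcas w p u" "set p \<subseteq> E" "v \<notin> set (pawalk_verts w p)"
  shows "(w, u) \<in> (cut E u v)\<^sup>*"
  using assms
proof (induction p arbitrary: w)
  case (Cons e p)
  obtain w' where e: "e = (w, w')" using Cons by (cases e) auto
  have "(w', u) \<in> (cut E u v)\<^sup>*" using Cons e by auto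
  moreover have "w' \<noteq> v" using Cons e by (cases p) auto
  then have "(w, w') \<in> cut E u v" using Cons e by (auto simp: cut_def)
  ultimately show ?case by (rule converse_rtrancl_into_rtrancl[rotated])
qed simp

text \<open>A cycle with at least three arcs, starting with the edge from \<open>u\<close> to
  \<open>v\<close>, returns from \<open>v\<close> to \<open>u\<close> without meeting
  \<open>v\<close> again and without turning back at once, so that edge is no bridge.\<close>

lemma tree: "is_tree (mk_graph V E)"
proof -
  have "V \<noteq> {}" using card2 by auto
  moreover have False if p: "pre_digraph.cycle (with_proj (mk_graph V E)) p" "length p \<ge> 3" for p
  proof -
    obtain u where u: "set p \<subseteq> E" "pcas u p u" "distinct (tl (pawalk_verts u p))"
      using p(1) unfolding pre_digraph.cycle_def pre_digraph.awalk_def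
      by (auto simp: cas_with_proj_eq awalk_verts_with_proj_eq)
    obtain e1 e2 e3 q where "p = e1 # e2 # e3 # q"
      using p(2) by (metis (no_types, opaque_lifting) One_nat_def Suc_le_length_iff numeral_3_eq_3)
    moreover obtain v w w' where "e1 = (u, v)" "e2 = (v, w)" "e3 = (w, w')"
      using u(2) calculation by (cases e1; cases e2; cases e3) auto
    ultimately have p: "p = (u, v) # (v, w) # (w, w') # q" by simp
    have last: "u \<in> set (pawalk_verts w' q)" if "pcas w' q u" for w' q
      using that by (induction q arbitrary: w') auto
    have q: "pcas w' q u" using u(2) p by auto
    have d: "distinct (v # w # pawalk_verts w' q)" using u(3) p by simp
    then have "w \<noteq> u" using last[OF q] by auto
    then have vw: "(v, w) \<in> cut E u v" using u(1) p irr by (auto simp: cut_def)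
    have "(w, u) \<in> (cut E u v)\<^sup>*"
      using walk_avoiding[of w "(w, w') # q" u v] u p d by auto
    then have "(v, u) \<in> (cut E u v)\<^sup>*" using vw by (rule converse_rtrancl_into_rtrancl[rotated])
    then have "(u, v) \<in> (cut E u v)\<^sup>*" using sym_cut[OF symE] by (meson sym_rtrancl symD)
    then show False using bridge u(1) p by auto
  qed
  ultimately show ?thesis
    unfolding is_tree_def using pair_graph_iff graph connected_iff[OF graph] con by blast
qed

end

section \<open>Parity along control paths and reattachment of pendant vertices\<close>

context subdivided_tree
begin

lemma edge_alternates: "(u, w) \<in> E \<Longrightarrow> u \<in> K \<longleftrightarrow> w \<notin> K"
proof -
  assume e: "(u, w) \<in> E"
  then have "u \<in> V" using inV by blast
  then show ?thesis using e K_nbr[of u w] W_nbr[of u w] L_nbr_K[of u w] V_eq KW KL by auto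
qed

text \<open>The class of a vertex determines its parity on every control path that starts in
  \<open>K\<close>; this is why the parity does not depend on the control path.\<close>

lemma walk_parity:
  assumes p: "vwalk p (with_proj (mk_graph V E))" "hd p \<in> K"
  shows "i < length p \<Longrightarrow> p ! i \<in> K \<longleftrightarrow> even i"
proof (induction i)
  case 0
  then show ?case using p by (simp add: hd_conv_nth)
next
  case (Suc i)
  then have "(p ! i, p ! Suc i) \<in> E" using p(1) by (simp add: vwalk_mk_graph_nth)
  then have "p ! i \<in> K \<longleftrightarrow> p ! Suc i \<notin> K" by (rule edge_alternates)
  moreover have "p ! i \<in> K \<longleftrightarrow> even i" using Suc by simp
  ultimately show ?case by auto
qed

text \<open>A second neighbour of the first vertex would either extend the path, still passing
  through \<open>y\<close>, or lie further along it and close a cycle against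
  \<open>bridge'\<close>.\<close>

lemma end_of_longest_path:
  assumes p: "vwalk p (with_proj (mk_graph V' E'))" "distinct p" "y \<in> set p"
    and max: "\<And>q. vwalk q (with_proj (mk_graph V' E')) \<Longrightarrow> distinct q \<Longrightarrow> y \<in> set q \<Longrightarrow> length q \<le> length p"
  shows "card (E' `` {hd p}) \<le> 1"
proof -
  have pw: "p \<noteq> []" "set p \<subseteq> V'" "\<And>i. Suc i < length p \<Longrightarrow> (p ! i, p ! Suc i) \<in> E'"
    using p(1) by (auto simp: vwalk_mk_graph_nth)
  have hd: "hd p = p ! 0" using pw(1) by (simp add: hd_conv_nth)
  have "w = p ! 1" if w: "(hd p, w) \<in> E'" for w
  proof (rule ccontr)
    assume ne: "w \<noteq> p ! 1"
    have wV: "w \<in> V'" using w E'V' by auto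
    have wp: "w \<in> set p"
    proof (rule ccontr)
      assume "w \<notin> set p"
      moreover have "vwalk (w # p) (with_proj (mk_graph V' E'))"
        using p(1) w wV symE' pw(1) by (cases p) (auto simp: vwalk_mk_graph sym_def)
      ultimately show False using max[of "w # p"] p by auto
    qed
    then obtain j where j: "j < length p" "p ! j = w" by (auto simp: in_set_conv_nth)
    have "w \<noteq> hd p" using w irr by (auto simp: E'_def)
    then have "j \<noteq> 0" using j(2) hd by metis
    moreover have "j \<noteq> 1" using j(2) ne by metis
    ultimately have j2: "j \<ge> 2" by simp
    have "(p ! 0, p ! k) \<in> (cut E' (p ! 0) w)\<^sup>*" if "k \<le> j" for k
      using that
    proof (induction k)
      case (Suc k)
      then have k: "Suc k < length p" using j by simp
      have inj: "p ! i = p ! i' \<longleftrightarrow> i = i'" if "i < length p" "i' < length p" for i i'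
        using p(2) that by (simp add: nth_eq_iff_index_eq)
      have l0: "0 < length p" using k by linarith
      have "p ! Suc k \<noteq> p ! 0" using inj[OF k l0] by simp
      moreover have "\<not> (p ! k = p ! 0 \<and> p ! Suc k = w)"
        using inj[OF _ l0, of k] inj[OF k j(1)] k j(2) j2 by auto
      ultimately have "(p ! k, p ! Suc k) \<in> cut E' (p ! 0) w" using pw(3)[OF k] by (auto simp: cut_def)
      then show ?case using Suc by (auto intro: rtrancl_into_rtrancl)
    qed simp
    then have "(p ! 0, w) \<in> (cut E' (p ! 0) w)\<^sup>*" using j by auto
    then show False using bridge' w hd by simp
  qed
  then have "E' `` {hd p} \<subseteq> {p ! 1}" by auto
  then show ?thesis using card_mono[of "{p ! 1}" "E' `` {hd p}"] by simp
qed

text \<open>A longest path of the main tree through \<open>y\<close> ends at vertices with at most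
  one neighbour there. Vertices of \<open>W\<close> have two, so both ends are in \<open>K\<close>
  and thus control vertices.\<close>

lemma on_control_path:
  assumes C: "C \<subseteq> K" "\<And>k. k \<in> K \<Longrightarrow> card (E' `` {k}) \<le> 1 \<Longrightarrow> k \<in> C" and y: "y \<in> V'"
  obtains p i where "control_path (mk_graph V E) C p" "i < length p" "p ! i = y"
proof -
  let ?G = "with_proj (mk_graph V' E')"
  let ?Q = "{p. vwalk p ?G \<and> distinct p \<and> y \<in> set p}"
  have "?Q \<subseteq> {p. set p \<subseteq> V' \<and> length p \<le> card V'}"
    using finV' by (auto simp: vwalk_mk_graph) (metis card_mono distinct_card)
  then have finQ: "finite ?Q" using finite_lists_length_le[OF finV'] by (meson finite_subset)
  have "[y] \<in> ?Q" using y by (simp add: vwalk_mk_graph)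
  then have "?Q \<noteq> {}" by blast
  then obtain p where "is_arg_min (\<lambda>p. - int (length p)) (\<lambda>p. p \<in> ?Q) p"
    using ex_is_arg_min_if_finite[OF finQ] by blast
  then have argmin: "p \<in> ?Q" "\<And>q. q \<in> ?Q \<Longrightarrow> length q \<le> length p"
    by (simp_all add: is_arg_min_def not_less)
  then have p: "vwalk p ?G" "distinct p" "y \<in> set p" by simp_all
  have max: "length q \<le> length p" if "vwalk q ?G" "distinct q" "y \<in> set q" for q
    using argmin(2) that by blast
  have pw: "p \<noteq> []" "set p \<subseteq> V'" "set (vwalk_arcs p) \<subseteq> E'"
    using p(1) by (auto simp: vwalk_mk_graph)
  have rev: "vwalk (rev p) ?G"
    unfolding vwalk_mk_graph_nth
  proof (intro conjI allI impI)
    fix i assume i: "Suc i < length (rev p)"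
    define j where "j = length p - Suc (Suc i)"
    have j: "Suc j < length p" "rev p ! i = p ! Suc j" "rev p ! Suc i = p ! j"
      using i by (auto simp: j_def rev_nth Suc_diff_Suc)
    then have "(p ! j, p ! Suc j) \<in> E'" using p(1) by (simp add: vwalk_mk_graph_nth)
    then show "(rev p ! i, rev p ! Suc i) \<in> E'" using symE' j by (auto simp: sym_def)
  qed (use pw in auto)
  have end1: "card (E' `` {hd p}) \<le> 1" by (rule end_of_longest_path[OF p max])
  have "card (E' `` {hd (rev p)}) \<le> 1"
    by (rule end_of_longest_path[of "rev p" y]) (use rev p max in auto)
  then have end2: "card (E' `` {last p}) \<le> 1" using pw(1) by (simp add: hd_rev)
  have inK: "k \<in> C" if "card (E' `` {k}) \<le> 1" "k \<in> V'" for k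
    using that C(2) W_deg W_nbrs' by (fastforce simp: V'_def)
  have hC: "hd p \<in> C" "last p \<in> C" using inK[OF end1] inK[OF end2] pw(1,2) by (meson hd_in_set last_in_set subsetD)+
  have vp: "vpath p (with_proj (mk_graph V E))"
    using p pw V_eq by (auto simp: vpath_def vwalk_mk_graph V'_def E'_def)
  \<comment> \<open>Equal ends occur only for the one-vertex path. Being longest, it shows that the
    main tree is a single vertex, which is then the only control vertex.\<close>
  have "hd p \<noteq> last p \<or> C = {hd p}"
  proof (cases "length p = 1")
    case True
    then have py: "p = [y]" using p(3) by (cases p) auto
    have "V' = {y}"
    proof -
      have "u = y" if u: "u \<in> V'" for u
      proof -
        have "(y, u) \<in> E'\<^sup>*" using conn' y u by (auto simp: conn_def)
        moreover have "E' `` {y} = {}"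
        proof (rule ccontr)
          assume "E' `` {y} \<noteq> {}"
          then obtain w where w: "(y, w) \<in> E'" by auto
          then have "w \<noteq> y" using irr by (auto simp: E'_def)
          moreover have "vwalk [y, w] ?G" using w E'V' by (auto simp: vwalk_mk_graph)
          ultimately show False using max[of "[y, w]"] py by auto
        qed
        ultimately show ?thesis by (metis Image_singleton_iff converse_rtranclE empty_iff)
      qed
      then show ?thesis using y by blast
    qed
    then have "C \<subseteq> {y}" using C(1) by (auto simp: V'_def)
    then show ?thesis using hC py by auto
  next
    case False
    then have "length p \<ge> 2" using pw(1) by (cases p) (auto simp: Suc_le_eq)
    then have "hd p \<noteq> last p" using p(2) pw(1)
      by (simp add: hd_conv_nth last_conv_nth nth_eq_iff_index_eq)
    then show ?thesis by simp
  qed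
  then have "control_path (mk_graph V E) C p" using vp hC by (simp add: control_path_def)
  moreover obtain i where "i < length p" "p ! i = y" using p(3) by (auto simp: in_set_conv_nth)
  ultimately show ?thesis by (rule that)
qed

lemma odd_even_verts:
  assumes C: "C \<subseteq> K" "\<And>k. k \<in> K \<Longrightarrow> card (E' `` {k}) \<le> 1 \<Longrightarrow> k \<in> C"
  shows "odd_verts (mk_graph V E) L C = W" "even_verts (mk_graph V E) L C = K"
proof -
  have parity: "p ! i \<in> K \<longleftrightarrow> even i" if "control_path (mk_graph V E) C p" "i < length p" for p i
    using walk_parity[of p i] that C(1) by (auto simp: control_path_def vpath_def)
  have VL: "V - L = V'" using V_eq KL WL by (auto simp: V'_def)
  have W_eq: "y \<in> W \<longleftrightarrow> y \<notin> K" if "y \<in> V'" for y using that KW by (auto simp: V'_def)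
  have ex: "\<exists>p i. control_path (mk_graph V E) C p \<and> i < length p \<and> p ! i = y" if "y \<in> V'" for y
    using on_control_path[OF C that] by blast
  show "odd_verts (mk_graph V E) L C = W"
  proof
    show "odd_verts (mk_graph V E) L C \<subseteq> W"
      unfolding odd_verts_def using parity W_eq by (auto simp: VL)
    show "W \<subseteq> odd_verts (mk_graph V E) L C"
    proof
      fix y assume y: "y \<in> W"
      then have yV: "y \<in> V'" by (simp add: V'_def)
      then obtain p i where p: "control_path (mk_graph V E) C p" "i < length p" "p ! i = y" using ex by blast
      then have "odd i" using parity W_eq[OF yV] y by blast
      then show "y \<in> odd_verts (mk_graph V E) L C" unfolding odd_verts_def using p yV VL by auto
    qed
  qed
  show "even_verts (mk_graph V E) L C = K"
  proof
    show "even_verts (mk_graph V E) L C \<subseteq> K"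
      unfolding even_verts_def using parity by auto
    show "K \<subseteq> even_verts (mk_graph V E) L C"
    proof
      fix y assume y: "y \<in> K"
      then have yV: "y \<in> V'" by (simp add: V'_def)
      then obtain p i where p: "control_path (mk_graph V E) C p" "i < length p" "p ! i = y" using ex by blast
      then have "even i" using parity y by blast
      then show "y \<in> even_verts (mk_graph V E) L C" unfolding even_verts_def using p yV VL by auto
    qed
  qed
qed

lemma main_tree_eq: "main_tree (mk_graph V E) L = mk_graph V' E'"
proof -
  have "V - L = V'" using V_eq KL WL by (auto simp: V'_def)
  then show ?thesis using V_eq by (auto simp: main_tree_def delete_verts_def induce_def E'_def V'_def)
qed

text \<open>The map is the identity on the main tree, and an arbitrary bijection \<open>g u\<close>
  numbers the vertices of \<open>L\<close> at each \<open>u\<close>.\<close>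

lemma attach_isomorphism:
  "\<exists>f. graph_isomorphism f (mk_graph V E)
      (attach_pendants (mk_graph V' E') K (pendant_count (mk_graph V E) L)) \<and>
     (\<forall>u\<in>V'. f u = Inl u)"
proof -
  let ?l = "pendant_count (mk_graph V E) L"
  define N where "N = (\<lambda>u. {w \<in> L. (u, w) \<in> E})"
  have "\<forall>u. \<exists>g. bij_betw g (N u) {0..<?l u}"
    using finL by (auto simp: N_def pendant_count_def intro!: ex_bij_betw_finite_nat)
  then obtain g where g: "\<And>u. bij_betw (g u) (N u) {0..<?l u}" by metis
  obtain nb where nb: "\<And>l. l \<in> L \<Longrightarrow> nb l \<in> K \<and> E `` {l} = {nb l}" using L_nbr by metis
  define f where "f = (\<lambda>u. if u \<in> V' then Inl u else Inr (nb u, g (nb u) u))"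
  have V: "V = V' \<union> L" "V' \<inter> L = {}" using V_eq KL WL by (auto simp: V'_def)
  have fL: "f l = Inr (nb l, g (nb l) l)" if "l \<in> L" for l using that V by (auto simp: f_def)
  have fV: "f u = Inl u" if "u \<in> V'" for u using that by (simp add: f_def)
  have EL: "(u, l) \<in> E \<longleftrightarrow> u = nb l" if "l \<in> L" for u l
  proof -
    have "(u, l) \<in> E \<longleftrightarrow> (l, u) \<in> E" using Esym[of u l] Esym[of l u] by blast
    also have "\<dots> \<longleftrightarrow> u \<in> E `` {l}" by simp
    finally show ?thesis using nb[OF that] by simp
  qed
  have inN: "l \<in> N u \<longleftrightarrow> l \<in> L \<and> nb l = u" for l u
    using EL by (auto simp: N_def)
  have inj: "inj_on f V"
  proof (rule inj_onI)
    fix u w assume uw: "u \<in> V" "w \<in> V" "f u = f w"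
    consider "u \<in> V'" "w \<in> V'" | "u \<in> L" "w \<in> L" | "u \<in> V'" "w \<in> L" | "u \<in> L" "w \<in> V'"
      using uw(1,2) V by blast
    then show "u = w"
    proof cases
      case 2
      then have e: "nb u = nb w" "g (nb u) u = g (nb w) w" using uw fL by auto
      have "u \<in> N (nb u)" "w \<in> N (nb u)" using 2 inN e by auto
      then show ?thesis using e g[of "nb u"] by (auto simp: bij_betw_def inj_on_def)
    qed (use uw(3) fV fL in auto)
  qed
  have img: "f ` V = Inl ` V' \<union> {Inr (u, i) | u i. u \<in> K \<and> i < ?l u}" (is "_ = ?A \<union> ?B")
  proof
    show "f ` V \<subseteq> ?A \<union> ?B"
    proof
      fix c assume "c \<in> f ` V"
      then obtain u where u: "u \<in> V" "c = f u" by blast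
      show "c \<in> ?A \<union> ?B"
      proof (cases "u \<in> V'")
        case False
        then have l: "u \<in> L" using u V by auto
        then have "u \<in> N (nb u)" using inN by auto
        then have "g (nb u) u < ?l (nb u)" using bij_betwE[OF g[of "nb u"]] by auto
        then show ?thesis using u fL[OF l] nb[OF l] by auto
      qed (use u fV in auto)
    qed
    show "?A \<union> ?B \<subseteq> f ` V"
    proof
      fix c assume "c \<in> ?A \<union> ?B"
      then consider u where "u \<in> V'" "c = Inl u" | u i where "c = Inr (u, i)" "u \<in> K" "i < ?l u" by blast
      then show "c \<in> f ` V"
      proof cases
        case 1 then show ?thesis using fV V by (intro image_eqI[of _ _ u]) auto
      next
        case 2
        then have "i \<in> g u ` N u" using g[of u] by (auto simp: bij_betw_def)
        then obtain l where l: "l \<in> N u" "i = g u l" by blast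
        then have "l \<in> L" "nb l = u" using inN by auto
        then show ?thesis using 2 l fL V by (intro image_eqI[of _ _ l]) auto
      qed
    qed
  qed
  let ?H = "attach_pendants (mk_graph V' E') K ?l"
  have arcs: "(u, w) \<in> E \<longleftrightarrow> (f u, f w) \<in> parcs ?H" if uw: "u \<in> V" "w \<in> V" for u w
  proof -
    have H: "parcs ?H = ({(Inl u, Inl v) | u v. (u, v) \<in> E'} \<union> {(Inl u, Inr (u, i)) | u i. u \<in> K \<and> i < ?l u}) \<union>
      ({(Inl u, Inl v) | u v. (u, v) \<in> E'} \<union> {(Inl u, Inr (u, i)) | u i. u \<in> K \<and> i < ?l u})\<inverse>"
      by (simp add: attach_pendants_def ugraph_def)
    have gl: "g (nb l) l < ?l (nb l) \<and> nb l \<in> K" if "l \<in> L" for l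
    proof -
      have "l \<in> N (nb l)" using that inN by auto
      then show ?thesis using bij_betwE[OF g[of "nb l"]] nb[OF that] by auto
    qed
    consider "u \<in> V'" "w \<in> V'" | "u \<in> V'" "w \<in> L" | "u \<in> L" "w \<in> V'" | "u \<in> L" "w \<in> L"
      using uw V by blast
    then show ?thesis
    proof cases
      case 1
      then have "(u, w) \<in> E \<longleftrightarrow> (u, w) \<in> E'" by (auto simp: E'_def)
      moreover have "(w, u) \<in> E' \<longleftrightarrow> (u, w) \<in> E'" using symE' by (auto simp: sym_def)
      ultimately show ?thesis unfolding H fV[OF 1(1)] fV[OF 1(2)] by auto
    next
      case 2
      show ?thesis unfolding H fV[OF 2(1)] fL[OF 2(2)] EL[OF 2(2)] using gl[OF 2(2)] by auto
    next
      case 3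
      have "(u, w) \<in> E \<longleftrightarrow> w = nb u" using EL[OF 3(1)] Esym by blast
      then show ?thesis unfolding H fV[OF 3(2)] fL[OF 3(1)] using gl[OF 3(1)] by auto
    next
      case 4
      have "(u, w) \<notin> E" using EL[OF 4(2)] nb[OF 4(2)] 4(1) KL by auto
      then show ?thesis unfolding H fL[OF 4(1)] fL[OF 4(2)] by auto
    qed
  qed
  have "pverts ?H = f ` V" unfolding img by (simp add: attach_pendants_def ugraph_def)
  then have "graph_isomorphism f (mk_graph V E) ?H"
    unfolding graph_isomorphism_def using inj arcs by (simp add: bij_betw_def)
  then show ?thesis using fV by blast
qed

lemma sum_pendant_count: "(\<Sum>u\<in>K. pendant_count (mk_graph V E) L u) = card L"
proof -
  have "(\<Sum>u\<in>K. pendant_count (mk_graph V E) L u) = card (SIGMA u:K. {w \<in> L. (u, w) \<in> E})"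
    unfolding pendant_count_def using finK finL by (subst card_SigmaI) auto
  also have "(SIGMA u:K. {w \<in> L. (u, w) \<in> E}) = (E \<inter> L \<times> UNIV)\<inverse>"
    using L_nbr_K Esym by auto
  also have "card \<dots> = (\<Sum>l\<in>L. deg E l)" using sum_deg[of L] V_eq by simp
  also have "\<dots> = card L" using L_deg by simp
  finally show ?thesis .
qed

text \<open>What remains to be checked for a given marking: control vertices lie in
  \<open>K\<close>, the ends of the main tree are among them, and \<open>K\<close> has n - \<alpha>
  elements.\<close>

lemma subdivided_tree_structure:
  assumes C: "C \<subseteq> K" "\<And>k. k \<in> K \<Longrightarrow> card (E' `` {k}) \<le> 1 \<Longrightarrow> k \<in> C" and n: "card K + \<alpha> = card V"
  shows "main_tree (mk_graph V E) L \<in> main_trees (card V) \<alpha> \<and>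
    bipartition (main_tree (mk_graph V E) L) (odd_verts (mk_graph V E) L C) (even_verts (mk_graph V E) L C) \<and>
    (\<exists>f. graph_isomorphism f (mk_graph V E)
       (attach_pendants (main_tree (mk_graph V E) L) (even_verts (mk_graph V E) L C) (pendant_count (mk_graph V E) L)) \<and>
       (\<forall>u\<in>pverts (main_tree (mk_graph V E) L). f u = Inl u)) \<and>
    (\<Sum>u\<in>even_verts (mk_graph V E) L C. pendant_count (mk_graph V E) L u) = card L \<and>
    int (card L) = 2 * int \<alpha> - int (card V) + 1"
proof -
  have "bipartition (mk_graph V' E') W K"
    unfolding bipartition_def using KW edge_KW by (auto simp: V'_def)
  moreover have "card V = card K + card W + card L"
    unfolding V_eq using finK finW finL KW KL WL by (subst card_Un_disjoint, auto)+
  then have "int (card L) = 2 * int \<alpha> - int (card V) + 1" using card_W n by linarith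
  moreover have "odd_verts (mk_graph V E) L C = W" "even_verts (mk_graph V E) L C = K"
    by (rule odd_even_verts; use C in blast)+
  ultimately show ?thesis
    unfolding main_tree_eq
    using main_tree_member[OF n] attach_isomorphism sum_pendant_count by simp
qed

end

section \<open>Markings of extremal trees\<close>

text \<open>If no vertex has two children, depth is injective, and climbing from the deepest vertex
  lists everything. This turns degree bounds into the lists required for paths and for D_m.\<close>

lemma linear_order_of_parents:
  fixes dep :: "'a \<Rightarrow> nat"
  assumes fin: "finite U" and r: "r \<in> U" "dep r = 0"
    and par: "\<And>v. v \<in> U \<Longrightarrow> v \<noteq> r \<Longrightarrow> par v \<in> U \<and> dep v = Suc (dep (par v))"
    and child: "\<And>u v. u \<in> U \<Longrightarrow> v \<in> U \<Longrightarrow> u \<noteq> r \<Longrightarrow> v \<noteq> r \<Longrightarrow> par u = par v \<Longrightarrow> u = v"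
  obtains vs where "distinct vs" "set vs = U" "vs \<noteq> []" "vs ! 0 = r"
    "\<And>i. Suc i < length vs \<Longrightarrow> par (vs ! Suc i) = vs ! i"
proof -
  have r_iff: "v = r \<longleftrightarrow> dep v = 0" if "v \<in> U" for v using par[OF that] r by fastforce
  have inj: "u = v" if "u \<in> U" "v \<in> U" "dep u = dep v" for u v
    using that
  proof (induction "dep u" arbitrary: u v)
    case 0
    then show ?case using r_iff by metis
  next
    case (Suc k)
    then have "u \<noteq> r" "v \<noteq> r" using r_iff by auto
    then have p: "par u \<in> U" "par v \<in> U" "dep u = Suc (dep (par u))" "dep v = Suc (dep (par v))"
      using par Suc by auto
    then have "par u = par v" using Suc by auto
    then show ?case using child Suc \<open>u \<noteq> r\<close> \<open>v \<noteq> r\<close> by blast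
  qed
  define M where "M = Max (dep ` U)"
  have "M \<in> dep ` U" unfolding M_def using fin r by (intro Max_in) auto
  then obtain c where c: "c \<in> U" "dep c = M" by auto
  have M: "dep v \<le> M" if "v \<in> U" for v unfolding M_def using fin that by (intro Max_ge) auto
  have pow: "k \<le> M \<Longrightarrow> (par ^^ k) c \<in> U \<and> dep ((par ^^ k) c) = M - k" for k
  proof (induction k)
    case (Suc k)
    then have IH: "(par ^^ k) c \<in> U" "dep ((par ^^ k) c) = M - k" by auto
    then have "(par ^^ k) c \<noteq> r" using Suc r by auto
    then show ?case using IH par[of "(par ^^ k) c"] Suc by auto
  qed (use c in simp)
  define f where "f = (\<lambda>i. (par ^^ (M - i)) c)"
  have f: "f i \<in> U" "dep (f i) = i" if "i \<le> M" for i using pow[of "M - i"] that by (auto simp: f_def)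
  define vs where "vs = map f [0..<Suc M]"
  have nth: "vs ! i = f i" if "i \<le> M" for i using that by (simp add: vs_def del: upt_Suc)
  have "inj_on f {0..<Suc M}" using f(2) by (intro inj_onI) (metis atLeastLessThan_iff less_Suc_eq_le)
  then have "distinct vs" by (simp add: vs_def distinct_map del: upt_Suc)
  moreover have "set vs = U"
  proof
    show "set vs \<subseteq> U" using f(1) by (auto simp: vs_def)
    show "U \<subseteq> set vs"
    proof
      fix u assume u: "u \<in> U"
      then have "u = f (dep u)" using inj[of u "f (dep u)"] f M by auto
      then show "u \<in> set vs" using M[OF u] by (auto simp: vs_def simp del: upt_Suc)
    qed
  qed
  moreover have "vs \<noteq> []" by (simp add: vs_def)
  moreover have "vs ! 0 = r" using nth[of 0] f[of 0] r_iff by auto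
  moreover have "par (vs ! Suc i) = vs ! i" if "Suc i < length vs" for i
  proof -
    have i: "Suc i \<le> M" using that by (simp add: vs_def del: upt_Suc)
    then have "M - i = Suc (M - Suc i)" by simp
    then show ?thesis using nth[of i] nth[of "Suc i"] i by (simp add: f_def)
  qed
  ultimately show ?thesis by (rule that)
qed

lemma vertex_degree_mk_graph: "vertex_degree (mk_graph V E) v = deg E v"
proof -
  have "out_arcs (with_proj (mk_graph V E)) v = Pair v ` (E `` {v})" by (auto simp: out_arcs_def)
  then show ?thesis by (simp add: out_degree_def card_image inj_on_def)
qed

lemma leaves_mk_graph: "leaves (mk_graph V E) = {v \<in> V. deg E v = 1}"
  by (simp add: leaves_def vertex_degree_mk_graph)

lemma card_two_le: "finite A \<Longrightarrow> u \<in> A \<Longrightarrow> w \<in> A \<Longrightarrow> u \<noteq> w \<Longrightarrow> 2 \<le> card A"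
  using card_mono[of A "{u, w}"] by simp

context extremal
begin

abbreviation T :: "'a pair_pre_digraph" where "T \<equiv> mk_graph V E"

abbreviation structured :: "'a set \<Rightarrow> 'a set \<Rightarrow> bool" where
  "structured L C \<equiv> main_tree T L \<in> main_trees (card V) \<alpha> \<and>
    bipartition (main_tree T L) (odd_verts T L C) (even_verts T L C) \<and>
    (\<exists>f. graph_isomorphism f T
       (attach_pendants (main_tree T L) (even_verts T L C) (pendant_count T L)) \<and>
       (\<forall>u\<in>pverts (main_tree T L). f u = Inl u)) \<and>
    (\<Sum>u\<in>even_verts T L C. pendant_count T L u) = card L \<and>
    int (card L) = 2 * int \<alpha> - int (card V) + 1"

lemma indep_bound: "S \<subseteq> V \<Longrightarrow> indep E S \<Longrightarrow> card S \<le> \<alpha>"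
  by (rule extremal_bipartition) blast

lemma leaf_bound: "2 * \<alpha> + 1 \<le> card V + card {v \<in> V. deg E v = 1}"
proof -
  obtain S where S: "S \<subseteq> V" "indep E S" "indep E (V - S)" "card S = \<alpha>" "\<And>s. s \<in> S \<Longrightarrow> deg E s \<le> 2"
    by (rule extremal_bipartition) blast
  have "card {s \<in> S. deg E s = 1} \<le> card {v \<in> V. deg E v = 1}" using S(1) fin by (intro card_mono) auto
  then show ?thesis using card_leaves[OF S(1-3,5)] S(4) by simp
qed

text \<open>The size of \<open>K\<close> is squeezed between two bounds. Independence of
  \<open>W \<union> L\<close> gives at least n - \<alpha>; \<open>leaf_bound\<close> and the
  assumption on leaves give \<open>2 * card K + 2 * \<alpha> \<le> 2 * n + 1\<close>, which parity
  sharpens. So the independence number of paths and of D_m need not be computed.\<close>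

lemma structuredI:
  assumes sub: "subdivided_tree V E x \<rho> K W L" and C: "C \<subseteq> K"
    and ends: "\<And>k. k \<in> K \<Longrightarrow> card (E `` {k} \<inter> W) \<le> 1 \<Longrightarrow> k \<in> C"
    and leaves: "card {v \<in> V. deg E v = 1} + 2 * card K \<le> card V + 2"
  shows "structured L C"
proof -
  interpret subdivided_tree V E x \<rho> K W L by fact
  have "indep E (W \<union> L)" unfolding indep_def using W_nbr L_nbr_K KW KL by blast
  then have "card (W \<union> L) \<le> \<alpha>" using V_eq by (intro indep_bound) auto
  moreover have "card V = card K + card (W \<union> L)"
    unfolding V_eq using finK finW finL KW KL by (subst Un_assoc, subst card_Un_disjoint) auto
  ultimately have n: "card K + \<alpha> = card V" using leaf_bound leaves by linarith
  have "E' `` {k} = E `` {k} \<inter> W" if "k \<in> K" for k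
    using K_nbr that KL KW by (auto simp: E'_def V'_def)
  then show ?thesis using ends C n by (intro subdivided_tree_structure) auto
qed

text \<open>Both path markings at once: in 0-based indexing the odd positions form \<open>K\<close>,
  the inner even positions \<open>W\<close>, and the first position together with a last even one
  forms \<open>L\<close>. For even length the last vertex is a leaf that belongs to \<open>K\<close>
  and is a control vertex.\<close>

lemma path_structured:
  assumes p: "is_path_graph T vs" and len: "length vs \<ge> 2"
    and L_def: "L = (!) vs ` {i. i < length vs \<and> (i = 0 \<or> i = length vs - 1 \<and> odd (length vs))}"
    and C_def: "C = {vs ! 1, vs ! (if odd (length vs) then length vs - 2 else length vs - 1)}"
  shows "structured L C" "odd (length vs) \<Longrightarrow> leaves T = L"
proof -
  let ?N = "length vs"
  have d: "distinct vs" and V: "V = set vs" and E: "E = set (vwalk_arcs vs) \<union> (set (vwalk_arcs vs))\<inverse>"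
    using p by (auto simp: is_path_graph_def ugraph_def)
  have eq: "vs ! i = vs ! j \<longleftrightarrow> i = j" if "i < ?N" "j < ?N" for i j
    using d that by (simp add: nth_eq_iff_index_eq)
  have Vi: "\<exists>i<?N. v = vs ! i" if "v \<in> V" for v using that V by (metis in_set_conv_nth)
  have adj: "(vs ! i, w) \<in> E \<longleftrightarrow> (\<exists>j<?N. w = vs ! j \<and> (j = Suc i \<or> i = Suc j))" if i: "i < ?N" for i w
  proof
    assume "(vs ! i, w) \<in> E"
    then consider j where "vs ! i = vs ! j" "w = vs ! Suc j" "Suc j < ?N" |
      j where "vs ! i = vs ! Suc j" "w = vs ! j" "Suc j < ?N"
      unfolding E set_vwalk_arcs_nth by auto
    then show "\<exists>j<?N. w = vs ! j \<and> (j = Suc i \<or> i = Suc j)"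
    proof cases
      case 1
      then have "i = j" using eq[OF i, of j] by simp
      then show ?thesis using 1 by auto
    next
      case 2
      then have "i = Suc j" using eq[OF i, of "Suc j"] by simp
      moreover have "j < ?N" using 2(3) by simp
      ultimately show ?thesis using 2(2) by blast
    qed
  next
    assume "\<exists>j<?N. w = vs ! j \<and> (j = Suc i \<or> i = Suc j)"
    then show "(vs ! i, w) \<in> E" unfolding E set_vwalk_arcs_nth using i by auto
  qed
  have nbrs: "E `` {vs ! i} = (!) vs ` {j. j < ?N \<and> (j = Suc i \<or> i = Suc j)}" if "i < ?N" for i
    using adj[OF that] by auto
  have inj: "inj_on ((!) vs) {j. j < ?N \<and> Q j}" for Q using eq by (auto simp: inj_on_def)
  have degi: "deg E (vs ! i) = card {j. j < ?N \<and> (j = Suc i \<or> i = Suc j)}" if "i < ?N" for i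
    unfolding nbrs[OF that] by (rule card_image[OF inj])
  have deg2: "deg E (vs ! i) = 2" if "0 < i" "Suc i < ?N" for i
  proof -
    have "{j. j < ?N \<and> (j = Suc i \<or> i = Suc j)} = {i - 1, Suc i}" using that by auto
    then show ?thesis using degi[of i] that by simp
  qed
  have deg1: "deg E (vs ! i) = 1" if "i = 0 \<or> i = ?N - 1" for i
  proof (cases "i = 0")
    case True
    then have "{j. j < ?N \<and> (j = Suc i \<or> i = Suc j)} = {1}" using len by auto
    moreover have "i < ?N" using True len by linarith
    ultimately show ?thesis using degi[of i] by simp
  next
    case False
    then have "{j. j < ?N \<and> (j = Suc i \<or> i = Suc j)} = {?N - 2}" using that len by auto
    moreover have "i < ?N" using that len by linarith
    ultimately show ?thesis using degi[of i] by simp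
  qed
  let ?KI = "{i. i < ?N \<and> odd i}" and ?WI = "{i. i < ?N \<and> (even i \<and> 0 < i \<and> i < ?N - 1)}"
    and ?LI = "{i. i < ?N \<and> (i = 0 \<or> i = ?N - 1 \<and> odd ?N)}"
  define K where "K = (!) vs ` ?KI"
  define W where "W = (!) vs ` ?WI"
  have inK: "vs ! i \<in> K \<longleftrightarrow> odd i" and inW: "vs ! i \<in> W \<longleftrightarrow> even i \<and> 0 < i \<and> i < ?N - 1"
    and inL: "vs ! i \<in> L \<longleftrightarrow> i = 0 \<or> i = ?N - 1 \<and> odd ?N" if "i < ?N" for i
    using eq[OF that] that unfolding K_def W_def L_def by (auto simp: image_iff)
  have cases: "even i \<Longrightarrow> i < ?N \<Longrightarrow> (even i \<and> 0 < i \<and> i < ?N - 1) \<or> i = 0 \<or> (i = ?N - 1 \<and> odd ?N)" for i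
    using len by presburger
  have sub: "subdivided_tree V E x \<rho> K W L"
  proof
    show "V = K \<union> W \<union> L"
    proof
      show "V \<subseteq> K \<union> W \<union> L"
      proof
        fix v assume "v \<in> V"
        then obtain i where i: "i < ?N" "v = vs ! i" using Vi by blast
        show "v \<in> K \<union> W \<union> L" using i inK[OF i(1)] inW[OF i(1)] inL[OF i(1)] cases[of i] by auto
      qed
      show "K \<union> W \<union> L \<subseteq> V" unfolding K_def W_def L_def V by auto
    qed
    show "K \<inter> W = {}" using inK inW by (auto simp: K_def)
    show "K \<inter> L = {}"
    proof -
      have "vs ! i \<notin> L" if "i < ?N" "odd i" for i using inL[OF that(1)] that by auto
      then show ?thesis by (auto simp: K_def)
    qed
    show "W \<inter> L = {}" using inL inW by (auto simp: W_def)
    show "E `` {w} \<subseteq> K" if mem: "w \<in> W" for w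
    proof -
      obtain i where i: "w = vs ! i" "i < ?N" "even i" using mem by (auto simp: W_def)
      show ?thesis unfolding i(1) nbrs[OF i(2)] using i(3) inK by auto
    qed
    show "deg E w = 2" if mem: "w \<in> W" for w using that deg2 by (auto simp: W_def)
    show "E `` {l} \<subseteq> K" if mem: "l \<in> L" for l
    proof -
      obtain i where i: "l = vs ! i" "i < ?N" "i = 0 \<or> i = ?N - 1 \<and> odd ?N" using mem by (auto simp: L_def)
      then have "even i" by auto
      then show ?thesis unfolding i(1) nbrs[OF i(2)] using inK by auto
    qed
    show "deg E l = 1" if mem: "l \<in> L" for l using that deg1 by (auto simp: L_def)
    show "E `` {k} \<subseteq> W \<union> L" if mem: "k \<in> K" for k
    proof -
      obtain i where i: "k = vs ! i" "i < ?N" "odd i" using mem by (auto simp: K_def)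
      have WL: "vs ! j \<in> W \<union> L" if "j < ?N" "even j" for j
        using inW[OF that(1)] inL[OF that(1)] cases[OF that(2,1)] by auto
      show ?thesis unfolding i(1) nbrs[OF i(2)]
      proof (rule image_subsetI)
        fix j assume "j \<in> {j. j < ?N \<and> (j = Suc i \<or> i = Suc j)}"
        then have "j < ?N" "even j" using i(3) by auto
        then show "vs ! j \<in> W \<union> L" by (rule WL)
      qed
    qed
    have "vs ! 1 \<in> K" using inK[of 1] len by simp
    then show "K \<noteq> {}" by auto
  qed
  have CK: "C \<subseteq> K"
  proof -
    have "vs ! 1 \<in> K" using inK[of 1] len by simp
    moreover have "vs ! (if odd ?N then ?N - 2 else ?N - 1) \<in> K"
      using len inK[of "?N - 2"] inK[of "?N - 1"] by auto
    ultimately show ?thesis by (simp add: C_def)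
  qed
  \<comment> \<open>An odd position other than the two control positions is far enough from both
    ends for its two even neighbours to be in \<open>W\<close> and not in \<open>L\<close>.\<close>
  have ends: "k \<in> C" if k: "k \<in> K" and c: "card (E `` {k} \<inter> W) \<le> 1" for k
  proof (rule ccontr)
    assume "k \<notin> C"
    moreover obtain i where i: "k = vs ! i" "i < ?N" "odd i" using k by (auto simp: K_def)
    ultimately have ne: "i \<noteq> 1" "i \<noteq> (if odd ?N then ?N - 2 else ?N - 1)" by (auto simp: C_def)
    have i3: "i \<ge> 3" using i(3) ne(1) by presburger
    have up: "Suc i < ?N - 1"
    proof (cases "odd ?N")
      case True
      have "i \<noteq> ?N - 1" using i(3) True by auto
      then show ?thesis using ne(2) i(2) True by auto
    next
      case False
      have "i \<noteq> ?N - 2" using i(3) False len by auto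
      then show ?thesis using ne(2) i(2) False by auto
    qed
    have "(k, vs ! (i - 1)) \<in> E" unfolding i(1) adj[OF i(2)]
      using i3 i(2) by (intro exI[of _ "i - 1"]) auto
    moreover have "(k, vs ! Suc i) \<in> E" unfolding i(1) adj[OF i(2)]
      using up by (intro exI[of _ "Suc i"]) auto
    ultimately have "vs ! (i - 1) \<in> E `` {k} \<inter> W" "vs ! Suc i \<in> E `` {k} \<inter> W"
      using inW[of "i - 1"] inW[of "Suc i"] i(3) i3 up by auto
    moreover have "vs ! (i - 1) \<noteq> vs ! Suc i" using eq[of "i - 1" "Suc i"] i3 up by auto
    ultimately have "2 \<le> card (E `` {k} \<inter> W)" using finN by (intro card_two_le) auto
    then show False using c by simp
  qed
  have cK: "card K = ?N div 2"
  proof -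
    have "?KI = (\<lambda>k. 2 * k + 1) ` {0..<?N div 2}" by (auto elim!: oddE simp: image_iff)
    then have "card ?KI = ?N div 2" by (simp add: card_image inj_on_def)
    then show ?thesis unfolding K_def by (subst card_image[OF inj])
  qed
  have "{v \<in> V. deg E v = 1} \<subseteq> {vs ! 0, vs ! (?N - 1)}"
  proof
    fix v assume v: "v \<in> {v \<in> V. deg E v = 1}"
    then obtain i where i: "i < ?N" "v = vs ! i" using Vi by blast
    then have "\<not> (0 < i \<and> Suc i < ?N)" using v deg2[of i] by auto
    then have "i = 0 \<or> i = ?N - 1" using i by auto
    then show "v \<in> {vs ! 0, vs ! (?N - 1)}" using i by auto
  qed
  then have "card {v \<in> V. deg E v = 1} \<le> card {vs ! 0, vs ! (?N - 1)}" by (intro card_mono) auto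
  also have "\<dots> \<le> 2" by (simp add: card_insert_if)
  finally have "card {v \<in> V. deg E v = 1} \<le> 2" .
  moreover have "card V = ?N" using V d distinct_card by blast
  ultimately show "structured L C" using cK by (intro structuredI[OF sub CK ends]) auto
  show "leaves T = L" if odd: "odd ?N"
  proof -
    have "deg E (vs ! i) = 1 \<longleftrightarrow> vs ! i \<in> L" if i: "i < ?N" for i
    proof (cases "0 < i \<and> Suc i < ?N")
      case True
      then show ?thesis using deg2[of i] inL[OF i] by auto
    next
      case False
      then have "i = 0 \<or> i = ?N - 1" using i by auto
      then show ?thesis using deg1[of i] inL[OF i] odd by auto
    qed
    moreover have "L \<subseteq> V" unfolding L_def V by auto
    ultimately show ?thesis unfolding leaves_mk_graph using Vi by blast
  qed
qed

text \<open>Parity is shifted against the path case: the branch vertex has index 0 and belongs to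
  \<open>K\<close>, so \<open>K\<close> has the even positions, while the last position is odd and
  is a leaf like \<open>a\<close> and \<open>b\<close>.\<close>

lemma D_structured:
  assumes D: "is_D_graph T ws a b"
  shows "structured (leaves T) {ws ! 0, ws ! (length ws - 2)}"
proof -
  let ?N = "length ws"
  have ne: "ws \<noteq> []" and ev: "even ?N" and d: "distinct ws" "a \<noteq> b" "a \<notin> set ws" "b \<notin> set ws"
    and V: "V = insert a (insert b (set ws))"
    and E: "E = (set (vwalk_arcs ws) \<union> {(hd ws, a), (hd ws, b)}) \<union> (set (vwalk_arcs ws) \<union> {(hd ws, a), (hd ws, b)})\<inverse>"
    using D by (auto simp: is_D_graph_def ugraph_def)
  have N2: "?N \<ge> 2" using ne ev by (cases ws; cases "tl ws") auto
  have hd: "hd ws = ws ! 0" using ne by (simp add: hd_conv_nth)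
  have eq: "ws ! i = ws ! j \<longleftrightarrow> i = j" if "i < ?N" "j < ?N" for i j
    using d that by (simp add: nth_eq_iff_index_eq)
  have ab: "ws ! i \<noteq> a" "ws ! i \<noteq> b" if "i < ?N" for i using d that nth_mem by metis+
  have ws_ex: "\<exists>i<?N. v = ws ! i" if "v \<in> set ws" for v using that by (metis in_set_conv_nth)
  have adj: "(ws ! i, w) \<in> E \<longleftrightarrow> (\<exists>j<?N. w = ws ! j \<and> (j = Suc i \<or> i = Suc j)) \<or> i = 0 \<and> w \<in> {a, b}"
    if i: "i < ?N" for i w
  proof
    assume "(ws ! i, w) \<in> E"
    then consider j where "ws ! i = ws ! j" "w = ws ! Suc j" "Suc j < ?N" |
      j where "ws ! i = ws ! Suc j" "w = ws ! j" "Suc j < ?N" | "ws ! i = ws ! 0" "w \<in> {a, b}"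
      unfolding E set_vwalk_arcs_nth hd using ab[OF i] by auto
    then show "(\<exists>j<?N. w = ws ! j \<and> (j = Suc i \<or> i = Suc j)) \<or> i = 0 \<and> w \<in> {a, b}"
    proof cases
      case 1
      then have "i = j" using eq[OF i, of j] by simp
      then show ?thesis using 1 by auto
    next
      case 2
      then have "i = Suc j" using eq[OF i, of "Suc j"] by simp
      moreover have "j < ?N" using 2(3) by simp
      ultimately show ?thesis using 2(2) by blast
    next
      case 3
      then have "i = 0" using eq[OF i, of 0] ne by simp
      then show ?thesis using 3 by auto
    qed
  next
    assume "(\<exists>j<?N. w = ws ! j \<and> (j = Suc i \<or> i = Suc j)) \<or> i = 0 \<and> w \<in> {a, b}"
    then show "(ws ! i, w) \<in> E" unfolding E set_vwalk_arcs_nth hd using i by auto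
  qed
  have Nab: "E `` {a} = {ws ! 0}" "E `` {b} = {ws ! 0}"
  proof -
    have "a \<noteq> ws ! i" "b \<noteq> ws ! i" if "i < ?N" for i using ab[OF that] by auto
    moreover have "0 < ?N" using ne by simp
    ultimately show "E `` {a} = {ws ! 0}" "E `` {b} = {ws ! 0}"
      unfolding E set_vwalk_arcs_nth hd using d(2) Suc_lessD by (auto, metis+)
  qed
  have nbrs: "E `` {ws ! i} = (!) ws ` {j. j < ?N \<and> (j = Suc i \<or> i = Suc j)}" if "0 < i" "i < ?N" for i
    using adj[OF that(2)] that by auto
  have inj: "inj_on ((!) ws) {j. j < ?N \<and> Q j}" for Q using eq by (auto simp: inj_on_def)
  have degi: "deg E (ws ! i) = card {j. j < ?N \<and> (j = Suc i \<or> i = Suc j)}" if "0 < i" "i < ?N" for i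
    unfolding nbrs[OF that] by (rule card_image[OF inj])
  have deg2: "deg E (ws ! i) = 2" if "0 < i" "Suc i < ?N" for i
  proof -
    have "{j. j < ?N \<and> (j = Suc i \<or> i = Suc j)} = {i - 1, Suc i}" using that by auto
    then show ?thesis using degi[of i] that by simp
  qed
  have deg_last: "deg E (ws ! (?N - 1)) = 1"
  proof -
    have "{j. j < ?N \<and> (j = Suc (?N - 1) \<or> ?N - 1 = Suc j)} = {?N - 2}" using N2 by auto
    then show ?thesis using degi[of "?N - 1"] N2 by simp
  qed
  have deg0: "deg E (ws ! 0) \<noteq> 1"
  proof -
    have "a \<in> E `` {ws ! 0}" "b \<in> E `` {ws ! 0}" using adj[of 0] ne by auto
    then have "2 \<le> deg E (ws ! 0)" using d(2) finN by (intro card_two_le) auto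
    then show ?thesis by simp
  qed
  define L where "L = {a, b, ws ! (?N - 1)}"
  define K where "K = (!) ws ` {i. i < ?N \<and> even i}"
  define W where "W = (!) ws ` {i. i < ?N \<and> (odd i \<and> i < ?N - 1)}"
  have inK: "ws ! i \<in> K \<longleftrightarrow> even i" and inW: "ws ! i \<in> W \<longleftrightarrow> odd i \<and> i < ?N - 1"
    and inL: "ws ! i \<in> L \<longleftrightarrow> i = ?N - 1" if "i < ?N" for i
    using eq[OF that] that ab[OF that] unfolding K_def W_def L_def by (auto simp: image_iff)
  have abn: "a \<notin> K" "a \<notin> W" "b \<notin> K" "b \<notin> W" using ab unfolding K_def W_def by blast+
  have oddl: "odd (?N - 1)" using ev N2 by auto
  have leaves: "leaves T = L"
  proof -
    have "deg E (ws ! i) = 1 \<longleftrightarrow> ws ! i \<in> L" if i: "i < ?N" for i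
    proof -
      consider "i = 0" | "0 < i" "Suc i < ?N" | "i = ?N - 1" using i by linarith
      then show ?thesis
        by cases (use deg0 deg2[of i] deg_last inL[OF i] N2 in auto)
    qed
    moreover have "deg E a = 1" "deg E b = 1" using Nab by auto
    moreover have "a \<in> L" "b \<in> L" by (auto simp: L_def)
    moreover have "L \<subseteq> V" unfolding L_def V using ne by auto
    ultimately show ?thesis unfolding leaves_mk_graph using ws_ex V by blast
  qed
  have sub: "subdivided_tree V E x \<rho> K W L"
  proof
    show "V = K \<union> W \<union> L"
    proof
      show "V \<subseteq> K \<union> W \<union> L"
      proof
        fix v assume "v \<in> V"
        then consider "v \<in> L" | i where "i < ?N" "v = ws ! i" using ws_ex unfolding V L_def by blast
        then show "v \<in> K \<union> W \<union> L"
        proof cases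
          case (2 i)
          then show ?thesis using inK[OF 2(1)] inW[OF 2(1)] inL[OF 2(1)] by auto
        qed auto
      qed
      show "K \<union> W \<union> L \<subseteq> V" unfolding K_def W_def L_def V using ne by auto
    qed
    show "K \<inter> W = {}" using inK inW by (auto simp: K_def)
    show "K \<inter> L = {}" using inK[of "?N - 1"] ne oddl abn by (auto simp: L_def)
    show "W \<inter> L = {}" using inW[of "?N - 1"] ne abn by (auto simp: L_def)
    show "E `` {w} \<subseteq> K" if mem: "w \<in> W" for w
    proof -
      obtain i where i: "w = ws ! i" "i < ?N" "odd i" using mem unfolding W_def by blast
      then have "0 < i" by (cases i) auto
      then show ?thesis unfolding i(1) nbrs[OF \<open>0 < i\<close> i(2)] using i(3) inK by auto
    qed
    show "deg E w = 2" if mem: "w \<in> W" for w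
    proof -
      obtain i where i: "w = ws ! i" "i < ?N - 1" "odd i" using mem unfolding W_def by blast
      then have "0 < i" by (cases i) auto
      then show ?thesis using deg2[of i] i by auto
    qed
    show "E `` {l} \<subseteq> K" if mem: "l \<in> L" for l
    proof -
      have 0: "ws ! 0 \<in> K" using inK[of 0] ne by simp
      have l: "0 < ?N - 1" "?N - 1 < ?N" using N2 by auto
      have "E `` {ws ! (?N - 1)} \<subseteq> K"
        unfolding nbrs[OF l]
      proof (rule image_subsetI)
        fix j assume j: "j \<in> {j. j < ?N \<and> (j = Suc (?N - 1) \<or> ?N - 1 = Suc j)}"
        then have "?N - 1 = Suc j" by auto
        then have "odd (Suc j)" using oddl by metis
        then show "ws ! j \<in> K" using inK[of j] j by auto
      qed
      moreover have "E `` {a} \<subseteq> K" "E `` {b} \<subseteq> K" unfolding Nab using 0 by blast+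
      ultimately show ?thesis using mem unfolding L_def by blast
    qed
    show "deg E l = 1" if mem: "l \<in> L" for l using that deg_last Nab by (auto simp: L_def)
    show "E `` {k} \<subseteq> W \<union> L" if mem: "k \<in> K" for k
    proof -
      obtain i where i: "k = ws ! i" "i < ?N" "even i" using mem by (auto simp: K_def)
      have WL: "ws ! j \<in> W \<union> L" if "j < ?N" "odd j" for j
        using inW[OF that(1)] inL[OF that(1)] that by auto
      show ?thesis
      proof
        fix w assume "w \<in> E `` {k}"
        then consider j where "j < ?N" "w = ws ! j" "j = Suc i \<or> i = Suc j" | "w \<in> {a, b}"
          using adj[OF i(2), of w] i(1) by auto
        then show "w \<in> W \<union> L"
        proof cases
          case (1 j)
          then have "odd j" using i(3) by auto
          then show ?thesis using WL 1 by blast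
        qed (auto simp: L_def)
      qed
    qed
    show "K \<noteq> {}" using inK[of 0] ne by auto
  qed
  have CK: "{ws ! 0, ws ! (?N - 2)} \<subseteq> K" using inK[of 0] inK[of "?N - 2"] ne ev by auto
  have ends: "k \<in> {ws ! 0, ws ! (?N - 2)}" if k: "k \<in> K" and c: "card (E `` {k} \<inter> W) \<le> 1" for k
  proof (rule ccontr)
    assume nk: "k \<notin> {ws ! 0, ws ! (?N - 2)}"
    obtain i where i: "k = ws ! i" "i < ?N" "even i" using k by (auto simp: K_def)
    have ne: "i \<noteq> 0" "i \<noteq> ?N - 2" using nk i(1) by (metis insertI1, metis insertI1 insertI2)
    have "i \<noteq> ?N - 1" using i(3) oddl by auto
    then have up: "Suc i < ?N - 1" using ne i by linarith
    have "(k, ws ! (i - 1)) \<in> E" unfolding i(1) adj[OF i(2)]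
      using ne i(2) by (intro disjI1 exI[of _ "i - 1"]) auto
    moreover have "(k, ws ! Suc i) \<in> E" unfolding i(1) adj[OF i(2)]
      using up by (intro disjI1 exI[of _ "Suc i"]) auto
    ultimately have "ws ! (i - 1) \<in> E `` {k} \<inter> W" "ws ! Suc i \<in> E `` {k} \<inter> W"
      using inW[of "i - 1"] inW[of "Suc i"] i(3) ne up by auto
    moreover have "ws ! (i - 1) \<noteq> ws ! Suc i" using eq[of "i - 1" "Suc i"] up by auto
    ultimately have "2 \<le> card (E `` {k} \<inter> W)" using finN by (intro card_two_le) auto
    then show False using c by simp
  qed
  have cK: "card K = ?N div 2"
  proof -
    have "{i. i < ?N \<and> even i} = (\<lambda>k. 2 * k) ` {0..<?N div 2}" using ev by (auto elim!: evenE simp: image_iff)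
    then have "card {i. i < ?N \<and> even i} = ?N div 2" by (simp add: card_image inj_on_def)
    then show ?thesis unfolding K_def by (subst card_image[OF inj])
  qed
  have "card {v \<in> V. deg E v = 1} \<le> 3"
    unfolding leaves_mk_graph[symmetric] leaves L_def by (auto simp: card_insert_if)
  moreover have "card V = ?N + 2" unfolding V using d distinct_card by simp
  moreover have "2 * (?N div 2) = ?N" using ev by simp
  ultimately show ?thesis unfolding leaves using cK by (intro structuredI[OF sub CK ends]) auto
qed

text \<open>Rooted at a leaf, a tree with degrees at most 2 has no vertex with two children.\<close>

lemma path_if_deg_le_2:
  assumes d2: "\<And>v. v \<in> V \<Longrightarrow> deg E v \<le> 2"
  shows "\<exists>vs. is_path_graph T vs"
proof -
  have "\<exists>r0\<in>V. deg E r0 = 1"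
  proof -
    obtain S where "S \<subseteq> V" "indep E S" "\<alpha> \<le> card S" using ex_indep by blast
    then show ?thesis using indep_leaf[of S] large by (metis le_trans mult_le_mono2 subsetD)
  qed
  then obtain r0 where r0: "r0 \<in> V" "deg E r0 = 1" by blast
  obtain par and dep :: "'a \<Rightarrow> nat" where pd: "dep r0 = 0"
    "\<forall>v\<in>V. v \<noteq> r0 \<longrightarrow> (v, par v) \<in> E \<and> dep v = Suc (dep (par v))"
    "\<forall>(u, v)\<in>E. u \<noteq> r0 \<and> par u = v \<or> v \<noteq> r0 \<and> par v = u"
    using rooted[OF r0(1)] by (elim exE conjE) (rule that)
  have parV: "par v \<in> V \<and> dep v = Suc (dep (par v))" if "v \<in> V" "v \<noteq> r0" for v
    using pd(2) that inV by blast
  have child: "u = v" if uv: "u \<in> V" "v \<in> V" "u \<noteq> r0" "v \<noteq> r0" "par u = par v" for u v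
  proof (rule ccontr)
    assume ne: "u \<noteq> v"
    let ?w = "par u"
    have w: "?w \<in> V" "(?w, u) \<in> E" "(?w, v) \<in> E" using pd(2) uv inV Esym by metis+
    then have two: "2 \<le> deg E ?w" using ne finN by (intro card_two_le) auto
    then have wr: "?w \<noteq> r0" using r0(2) by auto
    have dw: "dep u = Suc (dep ?w)" "dep v = Suc (dep ?w)" "dep ?w = Suc (dep (par ?w))"
      using parV[OF uv(1,3)] parV[OF uv(2,4)] parV[OF w(1) wr] uv(5) by auto
    have "par ?w \<noteq> u" "par ?w \<noteq> v" using dw by auto
    then have "card {u, v, par ?w} = 3" using ne by auto
    moreover have "card {u, v, par ?w} \<le> deg E ?w"
      using w pd(2) wr finN by (intro card_mono) auto
    ultimately show False using d2[OF w(1)] by simp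
  qed
  obtain vs where vs: "distinct vs" "set vs = V" "vs \<noteq> []" "vs ! 0 = r0"
    "\<And>i. Suc i < length vs \<Longrightarrow> par (vs ! Suc i) = vs ! i"
    by (rule linear_order_of_parents[OF fin r0(1) pd(1) parV child]) blast+
  have step: "(vs ! i, vs ! Suc i) \<in> E" if i: "Suc i < length vs" for i
  proof -
    have "vs ! Suc i \<noteq> vs ! 0" using vs(1,3) i by (subst nth_eq_iff_index_eq) auto
    moreover have "vs ! Suc i \<in> V" using vs(2) i nth_mem by blast
    ultimately have "(vs ! Suc i, par (vs ! Suc i)) \<in> E" using pd(2) vs(4) by auto
    then show ?thesis using vs(5)[OF i] Esym by simp
  qed
  have up: "(par u, u) \<in> set (vwalk_arcs vs)" if u: "u \<in> V" "u \<noteq> r0" for u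
  proof -
    obtain i where i: "i < length vs" "u = vs ! i" using u vs(2) by (metis in_set_conv_nth)
    then obtain k where "i = Suc k" using u vs(4) by (cases i) auto
    then show ?thesis unfolding set_vwalk_arcs_nth using vs(5)[of k] i by auto
  qed
  have "E = set (vwalk_arcs vs) \<union> (set (vwalk_arcs vs))\<inverse>"
  proof
    show "E \<subseteq> set (vwalk_arcs vs) \<union> (set (vwalk_arcs vs))\<inverse>"
    proof (rule subrelI)
      fix u v assume uv: "(u, v) \<in> E"
      then have "u \<in> V" "v \<in> V" using inV by auto
      moreover have "u \<noteq> r0 \<and> par u = v \<or> v \<noteq> r0 \<and> par v = u" using pd(3) uv by auto
      ultimately show "(u, v) \<in> set (vwalk_arcs vs) \<union> (set (vwalk_arcs vs))\<inverse>"
        using up[of u] up[of v] by auto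
    qed
    show "set (vwalk_arcs vs) \<union> (set (vwalk_arcs vs))\<inverse> \<subseteq> E"
      using step Esym unfolding set_vwalk_arcs_nth by auto
  qed
  then have "T = ugraph (set vs) (set (vwalk_arcs vs))" using vs(2) by (simp add: ugraph_def)
  then show ?thesis using vs by (auto simp: is_path_graph_def)
qed

text \<open>Without \<open>a\<close> and \<open>b\<close>, and rooted at \<open>z\<close>, the tree
  is a chain: \<open>z\<close> keeps only the child \<open>c\<close>, and every other vertex has at
  most one.\<close>

lemma D_graph_if_twin_leaves:
  assumes z: "z \<in> V" "E `` {z} = {a, b, c}" "a \<noteq> b" "a \<noteq> c" "b \<noteq> c"
    and a: "E `` {a} = {z}" and b: "E `` {b} = {z}"
    and d2: "\<And>v. v \<in> V - {z} \<Longrightarrow> deg E v \<le> 2" and ev: "even (card V)"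
  shows "\<exists>ws a b. is_D_graph T ws a b"
proof -
  obtain par and dep :: "'a \<Rightarrow> nat" where pd: "dep z = 0"
    "\<forall>v\<in>V. v \<noteq> z \<longrightarrow> (v, par v) \<in> E \<and> dep v = Suc (dep (par v))"
    "\<forall>(u, v)\<in>E. u \<noteq> z \<and> par u = v \<or> v \<noteq> z \<and> par v = u"
    using rooted[OF z(1)] by (elim exE conjE) (rule that)
  let ?U = "V - {a, b}"
  have arcs: "(z, a) \<in> E" "(z, b) \<in> E" using z(2) by auto
  have ab: "a \<in> V" "b \<in> V" "a \<noteq> z" "b \<noteq> z" using arcs inV irr by blast+
  have only: "v = z" if "(v, a) \<in> E \<or> (v, b) \<in> E" for v using that a b Esym by blast
  have pa: "par a = z" "par b = z" using pd(2) ab a b by blast+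
  have zU: "z \<in> ?U" using z ab by auto
  have parU: "par v \<in> ?U \<and> dep v = Suc (dep (par v))" if "v \<in> ?U" "v \<noteq> z" for v
  proof -
    have e: "(v, par v) \<in> E" "dep v = Suc (dep (par v))" using pd(2) that by auto
    then have "par v \<in> V" "par v \<noteq> a" "par v \<noteq> b" using inV only that(2) by blast+
    then show ?thesis using e by simp
  qed
  have child: "u = v" if uv: "u \<in> ?U" "v \<in> ?U" "u \<noteq> z" "v \<noteq> z" "par u = par v" for u v
  proof (rule ccontr)
    assume ne: "u \<noteq> v"
    let ?w = "par u"
    have w: "?w \<in> V" "(?w, u) \<in> E" "(?w, v) \<in> E" using pd(2) uv inV Esym by (metis DiffD1)+
    have wz: "?w \<noteq> z"
    proof
      assume "?w = z"
      then have "u \<in> {a, b, c}" "v \<in> {a, b, c}" using w z(2) by auto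
      then show False using uv ne by auto
    qed
    have dw: "dep u = Suc (dep ?w)" "dep v = Suc (dep ?w)" "dep ?w = Suc (dep (par ?w))"
      using parU[OF uv(1,3)] parU[OF uv(2,4)] pd(2) w(1) wz uv(5) by auto
    have "par ?w \<noteq> u" "par ?w \<noteq> v" using dw by auto
    then have "card {u, v, par ?w} = 3" using ne by auto
    moreover have "card {u, v, par ?w} \<le> deg E ?w"
      using w pd(2) wz finN by (intro card_mono) auto
    ultimately show False using d2[of ?w] w(1) wz by simp
  qed
  have finU: "finite ?U" using fin by simp
  obtain ws where ws: "distinct ws" "set ws = ?U" "ws \<noteq> []" "ws ! 0 = z"
    "\<And>i. Suc i < length ws \<Longrightarrow> par (ws ! Suc i) = ws ! i"
    by (rule linear_order_of_parents[OF finU zU pd(1) parU child]) blast+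
  have step: "(ws ! i, ws ! Suc i) \<in> E" if i: "Suc i < length ws" for i
  proof -
    have "ws ! Suc i \<noteq> ws ! 0" using ws(1,3) i by (subst nth_eq_iff_index_eq) auto
    moreover have "ws ! Suc i \<in> ?U" using ws(2) i nth_mem by blast
    ultimately have "(ws ! Suc i, par (ws ! Suc i)) \<in> E" using pd(2) ws(4) by auto
    then show ?thesis using ws(5)[OF i] Esym by simp
  qed
  have hd: "hd ws = z" using ws(3,4) by (simp add: hd_conv_nth)
  let ?R = "set (vwalk_arcs ws) \<union> {(hd ws, a), (hd ws, b)}"
  have up: "(par u, u) \<in> ?R" if u: "u \<in> V" "u \<noteq> z" for u
  proof (cases "u \<in> ?U")
    case True
    then obtain i where i: "i < length ws" "u = ws ! i" using ws(2) by (metis in_set_conv_nth)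
    then obtain k where "i = Suc k" using u ws(4) by (cases i) auto
    then show ?thesis unfolding set_vwalk_arcs_nth using ws(5)[of k] i by auto
  next
    case False
    then show ?thesis using u pa hd by auto
  qed
  have "E = ?R \<union> ?R\<inverse>"
  proof
    show "E \<subseteq> ?R \<union> ?R\<inverse>"
    proof (rule subrelI)
      fix u v assume uv: "(u, v) \<in> E"
      then have "u \<in> V" "v \<in> V" using inV by auto
      moreover have "u \<noteq> z \<and> par u = v \<or> v \<noteq> z \<and> par v = u" using pd(3) uv by auto
      ultimately show "(u, v) \<in> ?R \<union> ?R\<inverse>" using up[of u] up[of v] by auto
    qed
    show "?R \<union> ?R\<inverse> \<subseteq> E"
      using step Esym arcs unfolding set_vwalk_arcs_nth hd by auto
  qed
  moreover have "V = set (a # b # ws)" using ws(2) ab by auto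
  ultimately have "T = ugraph (set (a # b # ws)) ?R" by (simp add: ugraph_def)
  moreover have "distinct (a # b # ws)" using ws z(3) by auto
  moreover have "even (length ws)"
  proof -
    have "card V = length ws + 2"
      using distinct_card[OF \<open>distinct (a # b # ws)\<close>] \<open>V = set (a # b # ws)\<close> by simp
    then show ?thesis using ev by simp
  qed
  ultimately have "is_D_graph T ws a b" using ws(3) by (simp add: is_D_graph_def)
  then show ?thesis by blast
qed

text \<open>Deleting \<open>k\<close> isolates each pendant vertex at \<open>k\<close>, and a single
  vertex is a path. At least deg - 1 components arise in this way.\<close>

lemma branch_control_if:
  assumes k: "k \<in> V" "deg E k \<ge> 3" and few: "card {v \<in> E `` {k}. deg E v \<noteq> 1} \<le> 1"
  shows "branch_control T k"
proof -
  let ?G = "delete_verts T {k}"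
  let ?A = "{v \<in> E `` {k}. deg E v = 1}"
  have G: "?G = mk_graph (V - {k}) (E \<inter> (V - {k}) \<times> (V - {k}))"
    by (auto simp: delete_verts_def induce_def)
  let ?V = "V - {k}" and ?E = "E \<inter> (V - {k}) \<times> (V - {k})"
  have "?A = E `` {k} \<inter> {v. deg E v = 1}" "{v \<in> E `` {k}. deg E v \<noteq> 1} = E `` {k} - {v. deg E v = 1}" by auto
  then have "card (E `` {k}) = card ?A + card {v \<in> E `` {k}. deg E v \<noteq> 1}"
    using card_Int_Diff[OF finN, of k "{v. deg E v = 1}"] by simp
  then have big: "deg E k - 1 \<le> card ?A" using few by simp
  have "{l} \<in> path_components ?G" if l: "l \<in> ?A" for l
  proof -
    have kl: "(k, l) \<in> E" "deg E l = 1" using l by auto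
    obtain y where "E `` {l} = {y}" using kl(2) by (rule leafE)
    then have Nl: "E `` {l} = {k}" using Esym[OF kl(1)] by auto
    have lV: "l \<in> ?V" using kl inV irr by blast
    have nol: "(l, v) \<notin> ?E" "(v, l) \<notin> ?E" for v using Nl Esym by blast+
    have reach: "reachable (with_proj ?G) l v \<longleftrightarrow> v = l" for v
    proof -
      have "reachable (with_proj ?G) l v \<longleftrightarrow> (l, v) \<in> ?E\<^sup>*"
        unfolding reachable_def G using rtrancl_on_iff[of ?E ?V l v] lV by simp
      also have "\<dots> \<longleftrightarrow> v = l" using nol(1) by (auto elim: converse_rtranclE)
      finally show ?thesis .
    qed
    have "{l} \<in> pre_digraph.sccs_verts (with_proj ?G)"
      unfolding pre_digraph.sccs_verts_def using reach by auto
    moreover have "is_path_graph (induce ?G {l}) [l]"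
      using lV irr by (auto simp: is_path_graph_def induce_def G ugraph_def)
    ultimately show ?thesis unfolding path_components_def by blast
  qed
  then have "(\<lambda>l. {l}) ` ?A \<subseteq> path_components ?G" by auto
  moreover have "finite (path_components ?G)"
  proof -
    have "S \<subseteq> V" if S: "S \<in> pre_digraph.sccs_verts (with_proj ?G)" for S
    proof
      fix u assume "u \<in> S"
      then have "reachable (with_proj ?G) u u" using S by (auto simp: pre_digraph.sccs_verts_def)
      then show "u \<in> V" unfolding reachable_def G using in_rtrancl_on_in_F(1) by fastforce
    qed
    then have "path_components ?G \<subseteq> Pow V" by (auto simp: path_components_def)
    then show ?thesis using fin by (meson finite_Pow_iff finite_subset)
  qed
  ultimately have "card ((\<lambda>l. {l}) ` ?A) \<le> card (path_components ?G)" by (rule card_mono[rotated])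
  then have "card ?A \<le> card (path_components ?G)" by (simp add: card_image inj_on_def)
  then show ?thesis using big k by (simp add: branch_control_def vertex_degree_mk_graph)
qed

text \<open>A branch vertex makes the excess positive, and excess 1 would make the tree D_n, so
  \<open>leaf_nbr_is_branch\<close> applies to all pendant vertices.\<close>

lemma other_structured:
  assumes np: "\<nexists>vs. is_path_graph T vs" and nD: "\<nexists>ws a b. is_D_graph T ws a b"
  shows "structured (leaves T) {v. branch_control T v}"
proof -
  obtain S where S: "S \<subseteq> V" "indep E S" "indep E (V - S)" "card S = \<alpha>" "\<And>s. s \<in> S \<Longrightarrow> deg E s \<le> 2"
    and alt: "(\<forall>v\<in>V. deg E v \<le> 2) \<or> (\<forall>v\<in>V - S. deg E v \<ge> 2)"
    by (rule extremal_bipartition) blast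
  have nd: "\<not> (\<forall>v\<in>V. deg E v \<le> 2)" using path_if_deg_le_2 np by blast
  then have K2: "deg E v \<ge> 2" if "v \<in> V - S" for v using alt that by blast
  have finK: "finite (V - S)" using fin by simp
  obtain z where z: "z \<in> V - S" "deg E z \<ge> 3"
    using nd S(5) by (metis DiffI not_less_eq_eq numeral_2_eq_2 numeral_3_eq_3)
  have "(\<Sum>v\<in>V - S. 2) < (\<Sum>v\<in>V - S. deg E v)"
  proof (rule sum_strict_mono_ex1)
    show "\<exists>v\<in>V - S. 2 < deg E v" using z by (intro bexI[of _ z]) auto
  qed (use finK K2 in auto)
  then have p2: "card V + 2 \<le> 2 * \<alpha>" using sum_deg_cover[OF S(1-4)] by simp
  have "card V + 2 \<noteq> 2 * \<alpha>"
  proof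
    assume p: "card V + 2 = 2 * \<alpha>"
    then have "even (card V)" by presburger
    moreover have "\<exists>z a b c. z \<in> V \<and> E `` {z} = {a, b, c} \<and> a \<noteq> b \<and> a \<noteq> c \<and> b \<noteq> c \<and>
        E `` {a} = {z} \<and> E `` {b} = {z} \<and> (\<forall>v\<in>V - {z}. deg E v \<le> 2)"
      by (rule twin_leaves[OF S(1-5) K2 p])
    ultimately show False using D_graph_if_twin_leaves nD by blast
  qed
  then have p3: "card V + 3 \<le> 2 * \<alpha>" using p2 by simp
  have leaf_nbr: "deg E k \<ge> 3" if "E `` {l} = {k}" for l k
    by (rule leaf_nbr_is_branch[OF S(1-5) K2 p3 that])
  define L where "L = {s \<in> S. deg E s = 1}"
  define W where "W = {s \<in> S. deg E s \<noteq> 1}"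
  have SK: "v \<in> V - S" if "s \<in> S" "(s, v) \<in> E" for s v
    using that S(2) inV(2)[OF that(2)] unfolding indep_def by blast
  have KS: "v \<in> S" if "k \<in> V - S" "(k, v) \<in> E" for k v
    using that S(3) inV(2)[OF that(2)] unfolding indep_def by blast
  have leaves: "leaves T = L"
  proof -
    have "deg E v \<noteq> 1" if "v \<in> V - S" for v using K2[OF that] by simp
    then show ?thesis unfolding leaves_mk_graph L_def using S(1) by blast
  qed
  have sub: "subdivided_tree V E x \<rho> (V - S) W L"
  proof
    show "V = V - S \<union> W \<union> L" using S(1) by (auto simp: W_def L_def)
    show "deg E w = 2" if "w \<in> W" for w
      using that S(1) S(5)[of w] deg_pos[of w] by (fastforce simp: W_def)
    show "V - S \<noteq> {}" using z by auto
    show "E `` {w} \<subseteq> V - S" if "w \<in> W" for w using SK[of w] that by (auto simp: W_def)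
    show "E `` {l} \<subseteq> V - S" if "l \<in> L" for l using SK[of l] that by (auto simp: L_def)
    show "E `` {k} \<subseteq> W \<union> L" if "k \<in> V - S" for k using KS[OF that] by (auto simp: W_def L_def)
  qed (auto simp: W_def L_def)
  have CK: "{v. branch_control T v} \<subseteq> V - S"
  proof
    fix v assume "v \<in> {v. branch_control T v}"
    then have "v \<in> V" "deg E v \<ge> 3" by (auto simp: branch_control_def vertex_degree_mk_graph)
    then show "v \<in> V - S" using S(5)[of v] by fastforce
  qed
  \<comment> \<open>A vertex of \<open>K\<close> with at most one neighbour in \<open>W\<close> has
    a pendant neighbour, since its degree is at least 2. So its degree is at least 3, and all but at
    most one of its neighbours are pendant.\<close>
  have ends: "k \<in> {v. branch_control T v}" if k: "k \<in> V - S" and c: "card (E `` {k} \<inter> W) \<le> 1" for k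
  proof -
    have eq: "{v \<in> E `` {k}. deg E v \<noteq> 1} = E `` {k} \<inter> W" using KS[OF k] by (auto simp: W_def)
    have "\<not> E `` {k} \<subseteq> W"
    proof
      assume "E `` {k} \<subseteq> W"
      then have "deg E k \<le> 1" using c by (simp add: Int_absorb2)
      then show False using K2[OF k] by simp
    qed
    then obtain l where l: "(k, l) \<in> E" "deg E l = 1" using KS[OF k] by (auto simp: W_def)
    obtain y where "E `` {l} = {y}" using l(2) by (rule leafE)
    then have "E `` {l} = {k}" using Esym[OF l(1)] by auto
    then have "deg E k \<ge> 3" by (rule leaf_nbr)
    then show ?thesis using branch_control_if[of k] k c eq by simp
  qed
  have "card {v \<in> V. deg E v = 1} + 2 * card (V - S) \<le> card V + 2"
  proof -
    have "{v \<in> V. deg E v = 1} = L" using leaves by (simp add: leaves_mk_graph)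
    moreover have "card L + card V = 2 * card S + 1" unfolding L_def by (rule card_leaves[OF S(1-3,5)])
    moreover have "card (V - S) + card S = card V"
      using S(1) fin by (metis Diff_partition add.commute card_Un_disjoint Diff_disjoint finite_Diff finite_subset)
    ultimately show ?thesis by simp
  qed
  then show ?thesis unfolding leaves by (intro structuredI[OF sub CK ends]) auto
qed

lemma marking_structured:
  assumes "tree_marking T L C"
  shows "structured L C"
  using assms
proof cases
  case (odd_path vs)
  let ?L = "(!) vs ` {i. i < length vs \<and> (i = 0 \<or> i = length vs - 1 \<and> odd (length vs))}"
  have "leaves T = ?L" using path_structured(2)[OF odd_path(3,5) refl refl odd_path(4)] .
  then show ?thesis using path_structured(1)[OF odd_path(3,5) refl refl] odd_path by simp
next
  case (even_path vs)
  have "V = set vs" "distinct vs" using even_path(3) by (auto simp: is_path_graph_def ugraph_def)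
  then have len: "length vs \<ge> 2" using card2 distinct_card by metis
  have "{i. i < length vs \<and> (i = 0 \<or> i = length vs - 1 \<and> odd (length vs))} = {0}"
    using even_path(4) len by auto
  then show ?thesis using path_structured(1)[OF even_path(3) len refl refl] even_path by simp
next
  case (D_graph ws a b)
  then show ?thesis using D_structured by simp
next
  case other_tree
  then show ?thesis using other_structured by simp
qed

end

theorem theorem3p1:
  fixes n \<alpha> :: nat and T :: "'a pair_pre_digraph"
  assumes "\<lceil>real n / 2\<rceil> \<le> int \<alpha>" and "int \<alpha> \<le> int n - 1"
    and "minimizer_graph n \<alpha> T"
  shows "is_tree T \<and>
    (\<forall>L C. tree_marking T L C \<longrightarrow>
       main_tree T L \<in> main_trees n \<alpha> \<and>
       bipartition (main_tree T L) (odd_verts T L C) (even_verts T L C) \<and>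
       (\<exists>f. graph_isomorphism f T
              (attach_pendants (main_tree T L) (even_verts T L C) (pendant_count T L)) \<and>
            (\<forall>u\<in>pverts (main_tree T L). f u = Inl u)) \<and>
       (\<Sum>u\<in>even_verts T L C. pendant_count T L u) = card L \<and>
       int (card L) = 2 * int \<alpha> - int n + 1)"
proof -
  obtain V E where T: "T = mk_graph V E" by (cases T) auto
  have n: "n \<le> 2 * \<alpha>" "n \<ge> 2" using assms(1,2) by linarith+
  have ext: "extremal V E \<alpha>" and V: "card V = n"
    using minimizer_extremal[of n \<alpha> V E] assms(3) n unfolding T by auto
  interpret extremal V E \<alpha> by (rule ext)
  show ?thesis using tree marking_structured unfolding T V by blast
qed

end
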